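(* Let $\bm{y}_n=(y_1,\dots,y_n)$ be independent variables. Set $$s^{\mathbb{L},(2)}(u):=\frac{1}{\mathscr{P}^{\mathbb{L}}(u)}\cdot\frac{u^{2n}}{\prod_{j=1}^n(u+_{\mathbb{L}}y_j)(u+_{\mathbb{L}}\overline{y}_j)},$$ $$s^{\mathbb{L},(2)}(u_1,\dots,u_q):=\prod_{i=1}^q s^{\mathbb{L},(2)}(u_i)\prod_{1\le i<j\le q}\frac{u_j+_{\mathbb{L}}\overline{u}_i}{u_j}\cdot\frac{u_j+_{\mathbb{L}}u_i}{u_j}.$$ Then for every partition $\lambda=(\lambda_1,\dots,\lambda_q)$ of length $\ell(\lambda)=q\le n$, the universal quadratic Schur function $s^{\mathbb{L},(2)}_\lambda(\bm{y}_n)$ is the coefficient of $u_1^{-\lambda_1}\cdots u_q^{-\lambda_q}$ in $s^{\mathbb{L},(2)}(u_1,\dots,u_q)$, that is, $$s^{\mathbb{L},(2)}_\lambda(\bm{y}_n)=[u_1^{-\lambda_1}\cdots u_q^{-\lambda_q}]\left(s^{\mathbb{L},(2)}(u_1,\dots,u_q)\right).$$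
   Context: $\mathbb{L}$ is the Lazard ring, $u+_{\mathbb{L}}v=F_{\mathbb{L}}(u,v)=u+v+\sum_{i,j\ge1}a^{\mathbb{L}}_{i,j}u^iv^j$ is the universal formal group law, $\overline{u}$ is the formal inverse of $u$, $[2]_{\mathbb{L}}(u)=u+_{\mathbb{L}}u$, and $\mathscr{P}^{\mathbb{L}}(u)=1+\sum_{i\ge1}a^{\mathbb{L}}_{i,1}u^i$. Universal quadratic Schur function: for a partition $\lambda=(\lambda_1,\dots,\lambda_q)$ of length $q\le n$ (so $\lambda_1\ge\cdots\ge\lambda_q>0$), $$s^{\mathbb{L},(2)}_\lambda(\bm{y}_n)=\sum_{\overline{w}\in C_n/C_{n-q}}w\cdot\left[\frac{\prod_{i=1}^q y_i^{\lambda_i+2n-2i+1}}{\prod_{i=1}^q[2]_{\mathbb{L}}(y_i)\cdot\prod_{1\le i\le q}\prod_{i<j\le n}(y_i+_{\mathbb{L}}y_j)(y_i+_{\mathbb{L}}\overline{y}_j)}\right],$$ where $C_n=(\mathbb{Z}/2\mathbb{Z})^n\rtimes S_n$ acts by permuting $y_1,\dots,y_n$ and by the sign changes $y_i\mapsto\overline{y}_i$, and $C_{n-q}$ is the corresponding subgroup acting on $y_{q+1},\dots,y_n$. (Geometrically, it is the Gysin push-forward of $\prod_{i=1}^q y_i^{\lambda_i+2n-2i+1}$ along the bundle of isotropic flags of dimensions $1,\dots,q$ in a symplectic bundle $E$ of rank $2n$ whose form has values in the trivial line bundle, where $y_i,\overline{y}_i$ ($1\le i\le n$) are the $MU^*$-theory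 Chern roots of $E^\vee$.) Expansion convention for coefficient extraction: $1/\mathscr{P}^{\mathbb{L}}(u)$ is expanded as a power series in $u$; for $x=y_j$ or $x=\overline{y}_j$, $\frac{1}{u+_{\mathbb{L}}\overline{x}}=u^{-1}\cdot\frac{u-x}{u+_{\mathbb{L}}\overline{x}}\cdot\sum_{k\ge0}x^ku^{-k}$, where $\frac{u-x}{u+_{\mathbb{L}}\overline{x}}$ is a power series in $u,x$; and $u_j+_{\mathbb{L}}\overline{u}_i$, $u_j+_{\mathbb{L}}u_i$ are power series in $u_i,u_j$. Coefficients of monomials in the $u_i$ are then elements of $\mathbb{L}[[y_1,\dots,y_n]]$. *)

theory Defs
  imports
    Complex_Main
    "HOL-Library.Poly_Mapping"
    "HOL-Combinatorics.Permutations"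
    "HOL-Algebra.Left_Coset"
begin

abbreviation lookup :: "('a \<Rightarrow>\<^sub>0 'b::zero) \<Rightarrow> 'a \<Rightarrow> 'b" where "lookup \<equiv> Poly_Mapping.lookup"
abbreviation keys :: "('a \<Rightarrow>\<^sub>0 'b::zero) \<Rightarrow> 'a set" where "keys \<equiv> Poly_Mapping.keys"

section \<open>Formal power series in a family of variables\<close>

text \<open>A formal power series over \<open>'a\<close> in the variables indexed by \<open>'v\<close> is an arbitrary family of
  coefficients indexed by the monomials, i.e. by the finitely supported exponents.\<close>

typedef ('v, 'a) mps = "UNIV :: (('v \<Rightarrow>\<^sub>0 nat) \<Rightarrow> 'a) set"
  morphisms mps_coeff Mps
  by simp

lemma mps_coeff_Mps [simp]: "mps_coeff (Mps f) = f"
  by (simp add: Mps_inverse)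

lemma mps_eqI: "(\<And>e. mps_coeff f e = mps_coeff g e) \<Longrightarrow> f = g"
  by (metis ext mps_coeff_inject)

lemma finite_poly_mapping_between:
  fixes l u :: "'v \<Rightarrow>\<^sub>0 int"
  shows "finite {a :: 'v \<Rightarrow>\<^sub>0 int. \<forall>i. lookup l i \<le> lookup a i \<and> lookup a i \<le> lookup u i}"
proof -
  let ?K = "keys l \<union> keys u"
  let ?B = "\<Union>i\<in>?K. {lookup l i..lookup u i}"
  let ?F = "{f. \<forall>i. (i \<in> ?K \<longrightarrow> f i \<in> ?B) \<and> (i \<notin> ?K \<longrightarrow> f i = (0::int))}"
  have "lookup ` {a :: 'v \<Rightarrow>\<^sub>0 int. \<forall>i. lookup l i \<le> lookup a i \<and> lookup a i \<le> lookup u i} \<subseteq> ?F"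
  proof clarify
    fix a :: "'v \<Rightarrow>\<^sub>0 int" and i
    assume a: "\<forall>i. lookup l i \<le> lookup a i \<and> lookup a i \<le> lookup u i"
    show "(i \<in> ?K \<longrightarrow> lookup a i \<in> ?B) \<and> (i \<notin> ?K \<longrightarrow> lookup a i = 0)"
    proof (intro conjI impI)
      assume "i \<in> ?K" then show "lookup a i \<in> ?B" using a by (intro UN_I[of i]) auto
    next
      assume "i \<notin> ?K"
      then have "lookup l i = 0" "lookup u i = 0" by (auto simp: in_keys_iff)
      then show "lookup a i = 0" using a by (metis order_antisym)
    qed
  qed
  moreover have "finite ?F"
    by (rule finite_set_of_finite_funs) auto
  ultimately have "finite (lookup ` {a :: 'v \<Rightarrow>\<^sub>0 int. \<forall>i. lookup l i \<le> lookup a i \<and> lookup a i \<le> lookup u i})"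
    by (rule finite_subset)
  then show ?thesis
    by (rule finite_imageD) (simp add: inj_on_def)
qed

lemma finite_mps_splittings: "finite {(a, b). a + b = (m :: 'v \<Rightarrow>\<^sub>0 nat)}"
proof -
  let ?B = "\<Union>i\<in>keys m. {0..lookup m i}"
  let ?F = "{f. \<forall>i. (i \<in> keys m \<longrightarrow> f i \<in> ?B) \<and> (i \<notin> keys m \<longrightarrow> f i = (0::nat))}"
  have "(\<lambda>p. lookup (fst p)) ` {(a, b). a + b = m} \<subseteq> ?F"
  proof clarsimp
    fix a b :: "'v \<Rightarrow>\<^sub>0 nat" and i
    have "lookup a i \<le> lookup (a + b) i" by (simp add: lookup_add)
    then show "(i \<in> keys (a + b) \<longrightarrow> (\<exists>x\<in>keys (a + b). lookup a i \<le> lookup (a + b) x)) \<and>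
        (i \<notin> keys (a + b) \<longrightarrow> lookup a i = 0)"
      by (metis in_keys_iff le_zero_eq)
  qed
  moreover have "finite ?F" by (rule finite_set_of_finite_funs) auto
  ultimately have "finite ((\<lambda>p. lookup (fst p)) ` {(a, b). a + b = m})"
    by (rule finite_subset)
  then show ?thesis
    by (rule finite_imageD) (auto simp: inj_on_def)
qed

instantiation mps :: (type, comm_ring_1) comm_ring_1
begin

definition "0 = Mps (\<lambda>_. 0)"
definition "1 = Mps (\<lambda>e. if e = 0 then 1 else 0)"
definition "f + g = Mps (\<lambda>e. mps_coeff f e + mps_coeff g e)"
definition "- f = Mps (\<lambda>e. - mps_coeff f e)"
definition "f - g = Mps (\<lambda>e. mps_coeff f e - mps_coeff g e)"
definition "f * g = Mps (\<lambda>e. \<Sum>(a, b)\<in>{(a, b). a + b = e}. mps_coeff f a * mps_coeff g b)"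

instance
proof
  fix f g h :: "('a, 'b) mps"
  show "f * g * h = f * (g * h)"
  proof (rule mps_eqI)
    fix e
    have "mps_coeff (f * g * h) e =
        (\<Sum>p\<in>{(x, c). x + c = e}. \<Sum>r\<in>{(a, b). a + b = fst p}.
           mps_coeff f (fst r) * mps_coeff g (snd r) * mps_coeff h (snd p))"
      by (simp add: times_mps_def case_prod_unfold sum_distrib_right)
    also have "\<dots> = (\<Sum>(p, r)\<in>(SIGMA p:{(x, c). x + c = e}. {(a, b). a + b = fst p}).
           mps_coeff f (fst r) * mps_coeff g (snd r) * mps_coeff h (snd p))"
      by (rule sum.Sigma) (auto simp: finite_mps_splittings)
    also have "\<dots> = (\<Sum>(p, r)\<in>(SIGMA p:{(a, x). a + x = e}. {(b, c). b + c = snd p}).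
           mps_coeff f (fst p) * (mps_coeff g (fst r) * mps_coeff h (snd r)))"
      by (rule sum.reindex_bij_witness[where
            i = "\<lambda>(p, r). ((fst p + fst r, snd r), (fst p, fst r))" and
            j = "\<lambda>(p, r). ((fst r, snd r + snd p), (snd r, snd p))"])
         (auto simp: algebra_simps)
    also have "\<dots> = (\<Sum>p\<in>{(a, x). a + x = e}. \<Sum>r\<in>{(b, c). b + c = snd p}.
           mps_coeff f (fst p) * (mps_coeff g (fst r) * mps_coeff h (snd r)))"
      by (rule sum.Sigma[symmetric]) (auto simp: finite_mps_splittings)
    also have "\<dots> = mps_coeff (f * (g * h)) e"
      by (simp add: times_mps_def case_prod_unfold sum_distrib_left)
    finally show "mps_coeff (f * g * h) e = mps_coeff (f * (g * h)) e" .
  qed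
  show "f * g = g * f"
  proof (rule mps_eqI)
    fix e
    show "mps_coeff (f * g) e = mps_coeff (g * f) e"
      unfolding times_mps_def mps_coeff_Mps
      by (rule sum.reindex_bij_witness[where i = "\<lambda>(a, b). (b, a)" and j = "\<lambda>(a, b). (b, a)"])
         (auto simp: ac_simps)
  qed
  show "1 * f = f"
  proof (rule mps_eqI)
    fix e
    have "mps_coeff (1 * f) e = (\<Sum>(a, b)\<in>{(0, e)}. mps_coeff 1 a * mps_coeff f b)"
      unfolding times_mps_def mps_coeff_Mps
      by (rule sum.mono_neutral_right)
         (auto simp: finite_mps_splittings one_mps_def split: if_splits)
    then show "mps_coeff (1 * f) e = mps_coeff f e"
      by (simp add: one_mps_def)
  qed
  show "(f + g) * h = f * h + g * h"
    by (rule mps_eqI)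
       (simp add: times_mps_def plus_mps_def case_prod_unfold distrib_right sum.distrib)
  show "f + g + h = f + (g + h)" "f + g = g + f" "0 + f = f" "- f + f = 0" "f - g = f + - g"
    by (auto simp: plus_mps_def zero_mps_def uminus_mps_def minus_mps_def ac_simps
        mps_coeff_inverse)
  show "(0 :: ('a, 'b) mps) \<noteq> 1"
  proof
    assume "(0 :: ('a, 'b) mps) = 1"
    then have "mps_coeff (0 :: ('a, 'b) mps) 0 = mps_coeff 1 0" by simp
    then show False by (simp add: zero_mps_def one_mps_def)
  qed
qed

end

definition mps_const :: "'a::zero \<Rightarrow> ('v, 'a) mps" where
  "mps_const c = Mps (\<lambda>e. if e = 0 then c else 0)"

definition mps_var :: "'v \<Rightarrow> ('v, 'a::zero_neq_one) mps" where
  "mps_var v = Mps (\<lambda>e. if e = Poly_Mapping.single v 1 then 1 else 0)"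

text \<open>Infinite sums are taken coefficientwise. They are meaningful when each monomial occurs in only
  finitely many summands (\<open>Sum_any\<close> is \<open>0\<close> otherwise); all uses below are of this kind.\<close>

definition mps_sum :: "('i \<Rightarrow> ('v, 'a::comm_monoid_add) mps) \<Rightarrow> ('v, 'a) mps" where
  "mps_sum f = Mps (\<lambda>e. Sum_any (\<lambda>i. mps_coeff (f i) e))"

definition mps_subst :: "('v \<Rightarrow> ('w, 'a) mps) \<Rightarrow> ('v, 'a::comm_ring_1) mps \<Rightarrow> ('w, 'a) mps" where
  "mps_subst \<phi> f = mps_sum (\<lambda>m. mps_const (mps_coeff f m) * (\<Prod>v\<in>keys m. \<phi> v ^ lookup m v))"

text \<open>The quotient of \<open>f\<close> by \<open>g\<close> inside the ring of power series; it is used only where \<open>g\<close> is a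
  non-zero-divisor dividing \<open>f\<close>.\<close>

definition mps_quot :: "('v, 'a::comm_ring_1) mps \<Rightarrow> ('v, 'a) mps \<Rightarrow> ('v, 'a) mps" where
  "mps_quot f g = (THE h. h * g = f)"


section \<open>Formal Laurent series in a family of variables\<close>

text \<open>The exponents occurring in a Laurent series are bounded below by one fixed exponent, so that
  each Laurent series is a monomial times a power series.\<close>

definition mls_bound :: "('v \<Rightarrow>\<^sub>0 int) \<Rightarrow> (('v \<Rightarrow>\<^sub>0 int) \<Rightarrow> 'a::zero) \<Rightarrow> bool" where
  "mls_bound c f \<longleftrightarrow> (\<forall>m. f m \<noteq> 0 \<longrightarrow> (\<forall>i. lookup c i \<le> lookup m i))"

typedef (overloaded) ('v, 'a::zero) mls = "{f :: ('v \<Rightarrow>\<^sub>0 int) \<Rightarrow> 'a. \<exists>c. mls_bound c f}"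
  morphisms mls_coeff Mls
  by (rule exI[of _ "\<lambda>_. 0"]) (simp add: mls_bound_def)

lemma mls_eqI: "(\<And>m. mls_coeff f m = mls_coeff g m) \<Longrightarrow> f = g"
  by (metis ext mls_coeff_inject)

lemma mls_coeff_bounded: obtains c where "mls_bound c (mls_coeff f)"
  using mls_coeff[of f] by auto

lemma mls_coeff_Mls: "mls_bound c f \<Longrightarrow> mls_coeff (Mls f) = f"
  by (rule Mls_inverse) auto

lemma mls_bound_mono:
  "mls_bound c f \<Longrightarrow> (\<And>i. lookup d i \<le> lookup c i) \<Longrightarrow> mls_bound d f"
  unfolding mls_bound_def by (meson order_trans)

lemma mls_common_bound:
  obtains d where "mls_bound d (mls_coeff f)" "mls_bound d (mls_coeff g)"
proof -
  obtain c where c: "mls_bound c (mls_coeff f)" by (rule mls_coeff_bounded)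
  obtain c' where c': "mls_bound c' (mls_coeff g)" by (rule mls_coeff_bounded)
  have fin: "finite {i. min (lookup c i) (lookup c' i) \<noteq> 0}"
    by (rule finite_subset[of _ "keys c \<union> keys c'"]) (auto simp: in_keys_iff)
  define d where "d = Abs_poly_mapping (\<lambda>i. min (lookup c i) (lookup c' i))"
  have "lookup d i = min (lookup c i) (lookup c' i)" for i
    unfolding d_def by (simp add: Abs_poly_mapping_inverse fin)
  then show ?thesis
    using that[of d] mls_bound_mono[OF c, of d] mls_bound_mono[OF c', of d] by auto
qed

lemma lookup_add_mono:
  fixes a b c d :: "'v \<Rightarrow>\<^sub>0 int"
  shows "lookup c i \<le> lookup a i \<Longrightarrow> lookup d i \<le> lookup b i \<Longrightarrow> lookup (c + d) i \<le> lookup (a + b) i"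
  by (simp add: lookup_add add_mono)

definition mls_splittings ::
    "('v \<Rightarrow>\<^sub>0 int) \<Rightarrow> ('v \<Rightarrow>\<^sub>0 int) \<Rightarrow> ('v \<Rightarrow>\<^sub>0 int) \<Rightarrow> (('v \<Rightarrow>\<^sub>0 int) \<times> ('v \<Rightarrow>\<^sub>0 int)) set" where
  "mls_splittings c d m =
     {(a, b). a + b = m \<and> (\<forall>i. lookup c i \<le> lookup a i) \<and> (\<forall>i. lookup d i \<le> lookup b i)}"

lemma finite_mls_splittings: "finite (mls_splittings c d m)"
proof -
  have "fst ` mls_splittings c d m \<subseteq>
      {a. \<forall>i. lookup c i \<le> lookup a i \<and> lookup a i \<le> lookup (m - d) i}"
    by (auto simp: mls_splittings_def lookup_minus lookup_add algebra_simps)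
  then have "finite (fst ` mls_splittings c d m)"
    using finite_poly_mapping_between finite_subset by blast
  then show ?thesis
    by (rule finite_imageD) (auto simp: inj_on_def mls_splittings_def)
qed

definition mls_convol ::
    "(('v \<Rightarrow>\<^sub>0 int) \<Rightarrow> 'a::comm_ring_1) \<Rightarrow> (('v \<Rightarrow>\<^sub>0 int) \<Rightarrow> 'a) \<Rightarrow> ('v \<Rightarrow>\<^sub>0 int) \<Rightarrow> 'a" where
  "mls_convol f g m = (\<Sum>(a, b)\<in>{(a, b). a + b = m \<and> f a \<noteq> 0 \<and> g b \<noteq> 0}. f a * g b)"

lemma mls_convol_eq:
  assumes "mls_bound c f" "mls_bound d g"
  shows "mls_convol f g m = (\<Sum>(a, b)\<in>mls_splittings c d m. f a * g b)"
  unfolding mls_convol_def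
  by (rule sum.mono_neutral_left)
     (use assms in \<open>auto simp: finite_mls_splittings, auto simp: mls_splittings_def mls_bound_def\<close>)

lemma mls_bound_convol:
  assumes "mls_bound c f" "mls_bound d g"
  shows "mls_bound (c + d) (mls_convol f g)"
  unfolding mls_bound_def
proof (intro allI impI)
  fix m i assume "mls_convol f g m \<noteq> 0"
  then have "mls_splittings c d m \<noteq> {}"
    by (auto simp: mls_convol_eq[OF assms])
  then show "lookup (c + d) i \<le> lookup m i"
    by (auto simp: mls_splittings_def lookup_add add_mono)
qed

instantiation mls :: (type, comm_ring_1) comm_ring_1
begin

definition "0 = Mls (\<lambda>_. 0)"
definition "1 = Mls (\<lambda>m. if m = 0 then 1 else 0)"
definition "f + g = Mls (\<lambda>m. mls_coeff f m + mls_coeff g m)"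
definition "- f = Mls (\<lambda>m. - mls_coeff f m)"
definition "f - g = Mls (\<lambda>m. mls_coeff f m - mls_coeff g m)"
definition "f * g = Mls (mls_convol (mls_coeff f) (mls_coeff g))"

lemma mls_coeff_zero: "mls_coeff (0 :: ('a, 'b) mls) m = 0"
  unfolding zero_mls_def by (subst mls_coeff_Mls[of 0]) (auto simp: mls_bound_def)

lemma mls_coeff_one: "mls_coeff (1 :: ('a, 'b) mls) m = (if m = 0 then 1 else 0)"
  unfolding one_mls_def by (subst mls_coeff_Mls[of 0]) (auto simp: mls_bound_def)

lemma mls_coeff_add: "mls_coeff (f + g :: ('a, 'b) mls) m = mls_coeff f m + mls_coeff g m"
proof -
  obtain d where "mls_bound d (mls_coeff f)" "mls_bound d (mls_coeff g)"
    by (rule mls_common_bound)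
  then have "mls_bound d (\<lambda>m. mls_coeff f m + mls_coeff g m)"
    unfolding mls_bound_def by (metis add_0)
  then show ?thesis by (simp add: plus_mls_def mls_coeff_Mls)
qed

lemma mls_coeff_uminus: "mls_coeff (- f :: ('a, 'b) mls) m = - mls_coeff f m"
proof -
  obtain d where "mls_bound d (mls_coeff f)" by (rule mls_coeff_bounded)
  then have "mls_bound d (\<lambda>m. - mls_coeff f m)" unfolding mls_bound_def by auto
  then show ?thesis by (simp add: uminus_mls_def mls_coeff_Mls)
qed

lemma mls_coeff_mult:
  "mls_coeff (f * g :: ('a, 'b) mls) = mls_convol (mls_coeff f) (mls_coeff g)"
proof -
  obtain c where c: "mls_bound c (mls_coeff f)" by (rule mls_coeff_bounded)
  obtain d where d: "mls_bound d (mls_coeff g)" by (rule mls_coeff_bounded)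
  show ?thesis
    unfolding times_mls_def by (rule mls_coeff_Mls[OF mls_bound_convol[OF c d]])
qed

instance
proof
  fix f g h :: "('a, 'b) mls"
  obtain cf where cf: "mls_bound cf (mls_coeff f)" by (rule mls_coeff_bounded)
  obtain cg where cg: "mls_bound cg (mls_coeff g)" by (rule mls_coeff_bounded)
  obtain ch where ch: "mls_bound ch (mls_coeff h)" by (rule mls_coeff_bounded)
  show "f * g * h = f * (g * h)"
  proof (rule mls_eqI)
    fix m
    have "mls_coeff (f * g * h) m =
        (\<Sum>p\<in>mls_splittings (cf + cg) ch m. \<Sum>r\<in>mls_splittings cf cg (fst p).
           mls_coeff f (fst r) * mls_coeff g (snd r) * mls_coeff h (snd p))"
      by (simp add: mls_coeff_mult mls_convol_eq[OF mls_bound_convol[OF cf cg] ch]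
          mls_convol_eq[OF cf cg] case_prod_unfold sum_distrib_right)
    also have "\<dots> =
        (\<Sum>(p, r)\<in>(SIGMA p:mls_splittings (cf + cg) ch m. mls_splittings cf cg (fst p)).
           mls_coeff f (fst r) * mls_coeff g (snd r) * mls_coeff h (snd p))"
      by (rule sum.Sigma) (auto simp: finite_mls_splittings)
    also have "\<dots> =
        (\<Sum>(p, r)\<in>(SIGMA p:mls_splittings cf (cg + ch) m. mls_splittings cg ch (snd p)).
           mls_coeff f (fst p) * (mls_coeff g (fst r) * mls_coeff h (snd r)))"
      by (rule sum.reindex_bij_witness[where
            i = "\<lambda>(p, r). ((fst p + fst r, snd r), (fst p, fst r))" and
            j = "\<lambda>(p, r). ((fst r, snd r + snd p), (snd r, snd p))"])
         (auto simp: mls_splittings_def add.assoc intro!: lookup_add_mono)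
    also have "\<dots> =
        (\<Sum>p\<in>mls_splittings cf (cg + ch) m. \<Sum>r\<in>mls_splittings cg ch (snd p).
           mls_coeff f (fst p) * (mls_coeff g (fst r) * mls_coeff h (snd r)))"
      by (rule sum.Sigma[symmetric]) (auto simp: finite_mls_splittings)
    also have "\<dots> = mls_coeff (f * (g * h)) m"
      by (simp add: mls_coeff_mult mls_convol_eq[OF cf mls_bound_convol[OF cg ch]]
          mls_convol_eq[OF cg ch] case_prod_unfold sum_distrib_left)
    finally show "mls_coeff (f * g * h) m = mls_coeff (f * (g * h)) m" .
  qed
  show "f * g = g * f"
  proof (rule mls_eqI)
    fix m
    show "mls_coeff (f * g) m = mls_coeff (g * f) m"
      unfolding mls_coeff_mult mls_convol_def
      by (rule sum.reindex_bij_witness[where i = "\<lambda>(a, b). (b, a)" and j = "\<lambda>(a, b). (b, a)"])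
         (auto simp: ac_simps)
  qed
  show "1 * f = f"
  proof (rule mls_eqI)
    fix m
    have "mls_coeff (1 * f) m =
        (\<Sum>(a, b)\<in>(if mls_coeff f m = 0 then {} else {(0, m)}). mls_coeff 1 a * mls_coeff f b)"
      unfolding mls_coeff_mult mls_convol_def
      by (rule sum.cong) (auto simp: mls_coeff_one split: if_splits)
    then show "mls_coeff (1 * f) m = mls_coeff f m"
      by (simp add: mls_coeff_one)
  qed
  show "(f + g) * h = f * h + g * h"
  proof (rule mls_eqI)
    fix m
    obtain d where d: "mls_bound d (mls_coeff f)" "mls_bound d (mls_coeff g)"
      by (rule mls_common_bound)
    then have fg: "mls_bound d (mls_coeff (f + g))"
      unfolding mls_bound_def mls_coeff_add by (metis add_0)
    show "mls_coeff ((f + g) * h) m = mls_coeff (f * h + g * h) m"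
      unfolding mls_coeff_add mls_coeff_mult mls_convol_eq[OF fg ch]
        mls_convol_eq[OF d(1) ch] mls_convol_eq[OF d(2) ch]
      by (simp add: mls_coeff_add case_prod_unfold distrib_right sum.distrib)
  qed
  show "f + g + h = f + (g + h)" "f + g = g + f" "0 + f = f" "- f + f = 0"
    by (auto intro!: mls_eqI simp: mls_coeff_add mls_coeff_zero mls_coeff_uminus ac_simps)
  have "f - g = f + - g"
    unfolding minus_mls_def plus_mls_def mls_coeff_uminus by simp
  then show "f - g = f + - g" .
  show "(0 :: ('a, 'b) mls) \<noteq> 1"
    by (metis mls_coeff_one mls_coeff_zero zero_neq_one)
qed

end


section \<open>The Lazard ring and the universal formal group law\<close>

text \<open>\<open>\<alpha> i j\<close> is the coefficient of \<open>u\<^sup>i\<^sup>+\<^sup>1 v\<^sup>j\<^sup>+\<^sup>1\<close>; the index shift builds in \<open>F(u,0) = u\<close> and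
  \<open>F(0,v) = v\<close>. The series \<open>f\<close> and \<open>g\<close> are meant to have zero constant term.\<close>

definition fgl_add :: "(nat \<Rightarrow> nat \<Rightarrow> 'a::comm_ring_1) \<Rightarrow>
    ('v, 'a) mps \<Rightarrow> ('v, 'a) mps \<Rightarrow> ('v, 'a) mps" where
  "fgl_add \<alpha> f g = f + g + mps_sum (\<lambda>(i, j). mps_const (\<alpha> i j) * f ^ Suc i * g ^ Suc j)"

text \<open>The polynomial ring over the integers whose variable with index \<open>(i, j)\<close> stands for
  \<open>a\<close> with indices \<open>i+1, j+1\<close>.\<close>

type_synonym lazard_poly = "((nat \<times> nat) \<Rightarrow>\<^sub>0 nat) \<Rightarrow>\<^sub>0 int"

definition lazard_gen :: "nat \<Rightarrow> nat \<Rightarrow> lazard_poly" where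
  "lazard_gen i j = Poly_Mapping.single (Poly_Mapping.single (i, j) 1) 1"

abbreviation generic_add ::
    "(nat, lazard_poly) mps \<Rightarrow> (nat, lazard_poly) mps \<Rightarrow> (nat, lazard_poly) mps" where
  "generic_add \<equiv> fgl_add lazard_gen"

definition lazard_relations :: "lazard_poly set" where
  "lazard_relations = (let X = mps_var 0; Y = mps_var 1; Z = mps_var 2 in
     range (mps_coeff (generic_add X Y - generic_add Y X)) \<union>
     range (mps_coeff (generic_add (generic_add X Y) Z - generic_add X (generic_add Y Z))))"

global_interpretation lazard_poly: Modules.module "(*) :: lazard_poly \<Rightarrow> lazard_poly \<Rightarrow> lazard_poly"
  defines lazard_poly_ideal = lazard_poly.span
  by unfold_locales (simp_all add: algebra_simps)

quotient_type lazard = lazard_poly /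
  "\<lambda>p r. p - r \<in> lazard_poly_ideal lazard_relations"
proof (rule equivpI)
  let ?I = "lazard_poly_ideal lazard_relations"
  show "reflp (\<lambda>p r. p - r \<in> ?I)"
    by (auto intro!: reflpI simp: lazard_poly.span_zero)
  show "symp (\<lambda>p r. p - r \<in> ?I)"
  proof (rule sympI)
    fix p r assume "p - r \<in> ?I"
    then have "- (p - r) \<in> ?I" by (rule lazard_poly.span_neg)
    then show "r - p \<in> ?I" by simp
  qed
  show "transp (\<lambda>p r. p - r \<in> ?I)"
  proof (rule transpI)
    fix p r s assume "p - r \<in> ?I" "r - s \<in> ?I"
    then have "(p - r) + (r - s) \<in> ?I" by (rule lazard_poly.span_add)
    then show "p - s \<in> ?I" by simp
  qed
qed


text \<open>The ring is non-trivial because all relations have vanishing constant coefficient.\<close>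

lemma lazard_poly_constant_coeff_mult: "lookup (p * r :: lazard_poly) 0 = lookup p 0 * lookup r 0"
proof -
  have eq: "(0 = l + q) \<longleftrightarrow> l = 0 \<and> q = 0" for l q :: "(nat \<times> nat) \<Rightarrow>\<^sub>0 nat"
    by (auto simp: poly_mapping_eq_iff plus_poly_mapping.rep_eq fun_eq_iff)
  have "lookup (p * r) 0 = (\<Sum>l. lookup p l * (\<Sum>q. lookup r q when 0 = l + q))"
    by (simp add: times_poly_mapping.rep_eq prod_fun_def)
  also have "\<dots> = (\<Sum>l. lookup p l * lookup r 0 when l = 0)"
    by (rule arg_cong[where f = Sum_any]) (auto simp: eq when_def fun_eq_iff)
  finally show ?thesis by simp
qed

lemma lazard_poly_constant_coeff_Sum_any:
  fixes f :: "'i \<Rightarrow> lazard_poly"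
  assumes "\<And>i. lookup (f i) 0 = 0"
  shows "lookup (Sum_any f) 0 = 0"
  using assms by (simp add: Sum_any.expand_set lookup_sum)

lemma generic_add_constant_coeff:
  "lookup (mps_coeff (generic_add f g) e) 0 = lookup (mps_coeff f e) 0 + lookup (mps_coeff g e) 0"
proof -
  have "lookup (mps_coeff (mps_const (lazard_gen i j) * h) e) 0 = 0"
    for i j and h :: "(nat, lazard_poly) mps"
  proof -
    have "lookup (lazard_gen i j) 0 = 0"
      by (simp add: lazard_gen_def lookup_single when_def poly_mapping_eq_iff fun_eq_iff)
    then show ?thesis
      by (simp add: times_mps_def mps_const_def lookup_sum case_prod_unfold
          lazard_poly_constant_coeff_mult sum.neutral)
  qed
  then show ?thesis
    by (simp add: fgl_add_def plus_mps_def lookup_add mps_sum_def mult.assoc case_prod_unfold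
        lazard_poly_constant_coeff_Sum_any)
qed

lemma one_notin_lazard_ideal: "1 \<notin> lazard_poly_ideal lazard_relations"
proof
  assume one: "1 \<in> lazard_poly_ideal lazard_relations"
  have "lazard_poly.subspace {p :: lazard_poly. lookup p 0 = 0}"
    by (auto simp: lazard_poly.subspace_def lookup_add lazard_poly_constant_coeff_mult)
  moreover have "lazard_relations \<subseteq> {p. lookup p 0 = 0}"
    by (auto simp: lazard_relations_def Let_def minus_mps_def lookup_minus
        generic_add_constant_coeff)
  ultimately have "(1 :: lazard_poly) \<in> {p. lookup p 0 = 0}"
    using one lazard_poly.span_minimal by blast
  then show False by (simp add: lookup_one)
qed

instantiation lazard :: comm_ring_1
begin

lift_definition zero_lazard :: lazard is 0 .
lift_definition one_lazard :: lazard is 1 .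

lift_definition plus_lazard :: "lazard \<Rightarrow> lazard \<Rightarrow> lazard" is "(+)"
proof -
  fix p p' r r' :: lazard_poly
  let ?I = "lazard_poly_ideal lazard_relations"
  assume "p - p' \<in> ?I" "r - r' \<in> ?I"
  then have "(p - p') + (r - r') \<in> ?I" by (rule lazard_poly.span_add)
  then show "(p + r) - (p' + r') \<in> ?I" by (simp add: algebra_simps)
qed

lift_definition uminus_lazard :: "lazard \<Rightarrow> lazard" is uminus
proof -
  fix p p' :: lazard_poly
  let ?I = "lazard_poly_ideal lazard_relations"
  assume "p - p' \<in> ?I"
  then have "- (p - p') \<in> ?I" by (rule lazard_poly.span_neg)
  then show "- p - - p' \<in> ?I" by (simp add: algebra_simps)
qed

lift_definition minus_lazard :: "lazard \<Rightarrow> lazard \<Rightarrow> lazard" is "(-)"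
proof -
  fix p p' r r' :: lazard_poly
  let ?I = "lazard_poly_ideal lazard_relations"
  assume "p - p' \<in> ?I" "r - r' \<in> ?I"
  then have "(p - p') - (r - r') \<in> ?I" by (rule lazard_poly.span_diff)
  then show "(p - r) - (p' - r') \<in> ?I" by (simp add: algebra_simps)
qed

lift_definition times_lazard :: "lazard \<Rightarrow> lazard \<Rightarrow> lazard" is "(*)"
proof -
  fix p p' r r' :: lazard_poly
  let ?I = "lazard_poly_ideal lazard_relations"
  assume "p - p' \<in> ?I" "r - r' \<in> ?I"
  then have "r * (p - p') + p' * (r - r') \<in> ?I"
    by (intro lazard_poly.span_add lazard_poly.span_scale)
  then show "p * r - p' * r' \<in> ?I" by (simp add: algebra_simps)
qed

lemmas abs_lazard_ops = plus_lazard.abs_eq times_lazard.abs_eq uminus_lazard.abs_eq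
  minus_lazard.abs_eq zero_lazard_def one_lazard_def

instance
proof
  fix a b c :: lazard
  have rep: "\<exists>p. x = abs_lazard p" for x
    by (induct x rule: lazard.abs_induct) auto
  obtain p r s where p: "a = abs_lazard p" and r: "b = abs_lazard r" and s: "c = abs_lazard s"
    using rep[of a] rep[of b] rep[of c] by blast
  show "a * b * c = a * (b * c)" "a * b = b * a" "1 * a = a"
    "a + b + c = a + (b + c)" "a + b = b + a" "0 + a = a"
    unfolding p r s abs_lazard_ops by (simp_all only: ac_simps mult_1_left add_0_left)
  show "(a + b) * c = a * c + b * c" "- a + a = 0" "a - b = a + - b"
    unfolding p r s abs_lazard_ops by (simp_all only: distrib_right left_minus diff_conv_add_uminus)
  show "(0 :: lazard) \<noteq> 1"
  proof
    assume "(0 :: lazard) = 1"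
    then have "(0 :: lazard_poly) - 1 \<in> lazard_poly_ideal lazard_relations"
      unfolding zero_lazard_def one_lazard_def lazard.abs_eq_iff .
    then have "- (0 - 1) \<in> lazard_poly_ideal lazard_relations"
      by (rule lazard_poly.span_neg)
    then show False using one_notin_lazard_ideal by simp
  qed
qed

end

lift_definition lazard_coeff :: "nat \<Rightarrow> nat \<Rightarrow> lazard" is lazard_gen .

text \<open>The coefficients in the usual indexing, starting from 1.\<close>

definition aL :: "nat \<Rightarrow> nat \<Rightarrow> lazard" where
  "aL i j = lazard_coeff (i - 1) (j - 1)"

definition addL :: "('v, lazard) mps \<Rightarrow> ('v, lazard) mps \<Rightarrow> ('v, lazard) mps" (infixl "+\<^sub>L" 65) where
  "f +\<^sub>L g = fgl_add lazard_coeff f g"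

definition invL :: "('v, lazard) mps \<Rightarrow> ('v, lazard) mps" where
  "invL f = (THE g. mps_coeff g 0 = 0 \<and> f +\<^sub>L g = 0)"

definition twoL :: "('v, lazard) mps \<Rightarrow> ('v, lazard) mps" where
  "twoL f = f +\<^sub>L f"

definition PL :: "('v, lazard) mps \<Rightarrow> ('v, lazard) mps" where
  "PL f = 1 + mps_sum (\<lambda>i. if i \<ge> 1 then mps_const (aL i 1) * f ^ i else 0)"


section \<open>The localised power series ring\<close>

type_synonym yseries = "(nat, lazard) mps"

abbreviation Y :: "nat \<Rightarrow> yseries" where "Y \<equiv> mps_var"

text \<open>The image of \<open>y\<^sub>i\<close> under a sign change or not.\<close>

definition sgnY :: "bool \<Rightarrow> nat \<Rightarrow> yseries" where
  "sgnY s i = (if s then invL (Y i) else Y i)"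

text \<open>The multiplicative set generated by the denominators of the quadratic Schur functions and
  their images under sign changes and permutations. The Lazard ring is an integral domain of
  characteristic 0 (Lazard), and none of the generators is 0, so that the localisation
  contains the ring of power series and is contained in its field of fractions. It is the ring in
  which the sum of fractions defining the quadratic Schur functions is formed.\<close>

inductive_set schur_denoms :: "yseries set" where
  one: "1 \<in> schur_denoms"
| two: "f \<in> schur_denoms \<Longrightarrow> f * twoL (sgnY s i) \<in> schur_denoms"
| add: "f \<in> schur_denoms \<Longrightarrow> i \<noteq> j \<Longrightarrow> f * (sgnY s i +\<^sub>L sgnY t j) \<in> schur_denoms"

lemma schur_denoms_mult:
  assumes "f \<in> schur_denoms" "g \<in> schur_denoms"
  shows "f * g \<in> schur_denoms"
  using assms(2)
proof (induction g rule: schur_denoms.induct)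
  case one
  show ?case using assms(1) by simp
next
  case (two g s i)
  then show ?case using schur_denoms.two[of "f * g" s i] by (simp add: mult.assoc)
next
  case (add g i j s t)
  then show ?case using schur_denoms.add[of "f * g" i j s t] by (simp add: mult.assoc)
qed

definition yfrac_rel :: "yseries \<times> yseries \<Rightarrow> yseries \<times> yseries \<Rightarrow> bool" where
  "yfrac_rel = (\<lambda>(a, b) (c, d). b \<in> schur_denoms \<and> d \<in> schur_denoms \<and>
     (\<exists>t\<in>schur_denoms. t * (a * d - c * b) = 0))"

lemma yfrac_rel_trans:
  assumes "yfrac_rel x y" "yfrac_rel y z"
  shows "yfrac_rel x z"
proof -
  obtain a b c d e f where xyz: "x = (a, b)" "y = (c, d)" "z = (e, f)"
    by (metis surj_pair)
  obtain t t' where t: "t \<in> schur_denoms" "t * (a * d - c * b) = 0"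
    and t': "t' \<in> schur_denoms" "t' * (c * f - e * d) = 0"
    using assms by (auto simp: yfrac_rel_def xyz)
  have "t * t' * d * (a * f - e * b) =
      t' * f * (t * (a * d - c * b)) + t * b * (t' * (c * f - e * d))"
    by (simp add: algebra_simps)
  then have "t * t' * d * (a * f - e * b) = 0"
    using t t' by simp
  moreover have "t * t' * d \<in> schur_denoms"
    using assms t t' by (auto simp: yfrac_rel_def xyz intro!: schur_denoms_mult)
  ultimately show ?thesis
    using assms by (auto simp: yfrac_rel_def xyz)
qed

quotient_type yfrac = "yseries \<times> yseries" / partial: yfrac_rel
proof (rule part_equivpI)
  show "\<exists>x. yfrac_rel x x"
    by (rule exI[of _ "(0, 1)"]) (auto simp: yfrac_rel_def intro: schur_denoms.one)
  show "symp yfrac_rel"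
  proof (rule sympI)
    fix x y assume xy: "yfrac_rel x y"
    obtain a b c d where eq: "x = (a, b)" "y = (c, d)" by (metis surj_pair)
    obtain t where "t \<in> schur_denoms" "t * (a * d - c * b) = 0"
      using xy by (auto simp: yfrac_rel_def eq)
    then have "t * (c * b - a * d) = 0" by (simp add: algebra_simps)
    then show "yfrac_rel y x"
      using xy \<open>t \<in> schur_denoms\<close> by (auto simp: yfrac_rel_def eq)
  qed
  show "transp yfrac_rel"
    by (rule transpI) (rule yfrac_rel_trans)
qed

lemma yfrac_relI:
  "b \<in> schur_denoms \<Longrightarrow> d \<in> schur_denoms \<Longrightarrow> t \<in> schur_denoms \<Longrightarrow> t * (a * d - c * b) = 0
     \<Longrightarrow> yfrac_rel (a, b) (c, d)"
  by (auto simp: yfrac_rel_def)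

lemma yfrac_rel_refl: "b \<in> schur_denoms \<Longrightarrow> yfrac_rel (a, b) (a, b)"
  by (rule yfrac_relI[where t = 1]) (auto intro: schur_denoms.one)

lemma abs_yfrac_eq: "yfrac_rel x y \<Longrightarrow> abs_yfrac x = abs_yfrac y"
  by (rule Quotient_rel_abs[OF Quotient_yfrac])

lemma abs_yfrac_eqI:
  assumes "b \<in> schur_denoms" "d \<in> schur_denoms" "a * d = c * b"
  shows "abs_yfrac (a, b) = abs_yfrac (c, d)"
  by (rule abs_yfrac_eq, rule yfrac_relI[where t = 1])
     (use assms in \<open>auto intro: schur_denoms.one\<close>)

lemma yfrac_rel_rep_abs: "b \<in> schur_denoms \<Longrightarrow> yfrac_rel (rep_yfrac (abs_yfrac (a, b))) (a, b)"
  by (rule Quotient_rep_abs[OF Quotient_yfrac]) (rule yfrac_rel_refl)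

lemma yfrac_cases: obtains a b where "x = abs_yfrac (a, b)" "b \<in> schur_denoms"
proof -
  have rel: "yfrac_rel (rep_yfrac x) (rep_yfrac x)"
    by (rule Quotient_rep_reflp[OF Quotient_yfrac])
  have abs: "x = abs_yfrac (rep_yfrac x)"
    by (rule Quotient_abs_rep[OF Quotient_yfrac, symmetric])
  obtain a b where ab: "rep_yfrac x = (a, b)" by (cases "rep_yfrac x")
  show ?thesis
    using that[of a b] rel abs by (simp add: ab yfrac_rel_def)
qed

lemma yfrac_rel_add:
  assumes x: "yfrac_rel (a, b) (a', b')" and y: "yfrac_rel (c, d) (c', d')"
  shows "yfrac_rel (a * d + c * b, b * d) (a' * d' + c' * b', b' * d')"
proof -
  obtain t t' where t: "t \<in> schur_denoms" "t * (a * b' - a' * b) = 0"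
    and t': "t' \<in> schur_denoms" "t' * (c * d' - c' * d) = 0"
    using x y unfolding yfrac_rel_def by blast
  have "t * t' * ((a * d + c * b) * (b' * d') - (a' * d' + c' * b') * (b * d)) =
      t' * d * d' * (t * (a * b' - a' * b)) + t * b * b' * (t' * (c * d' - c' * d))"
    by (simp add: algebra_simps)
  also have "\<dots> = 0" by (simp only: t t') simp
  finally show ?thesis
    using x y t t' unfolding yfrac_rel_def by (blast intro: schur_denoms_mult)
qed

lemma yfrac_rel_mult:
  assumes x: "yfrac_rel (a, b) (a', b')" and y: "yfrac_rel (c, d) (c', d')"
  shows "yfrac_rel (a * c, b * d) (a' * c', b' * d')"
proof -
  obtain t t' where t: "t \<in> schur_denoms" "t * (a * b' - a' * b) = 0"
    and t': "t' \<in> schur_denoms" "t' * (c * d' - c' * d) = 0"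
    using x y unfolding yfrac_rel_def by blast
  have "t * t' * ((a * c) * (b' * d') - (a' * c') * (b * d)) =
      t' * c * d' * (t * (a * b' - a' * b)) + t * a' * b * (t' * (c * d' - c' * d))"
    by (simp add: algebra_simps)
  also have "\<dots> = 0" by (simp only: t t') simp
  finally show ?thesis
    using x y t t' unfolding yfrac_rel_def by (blast intro: schur_denoms_mult)
qed

lemma yfrac_rel_uminus:
  assumes x: "yfrac_rel (a, b) (a', b')"
  shows "yfrac_rel (- a, b) (- a', b')"
proof -
  obtain t where t: "t \<in> schur_denoms" "t * (a * b' - a' * b) = 0"
    using x unfolding yfrac_rel_def by blast
  have "t * (- a * b' - - a' * b) = - (t * (a * b' - a' * b))"
    by (simp add: algebra_simps)
  also have "\<dots> = 0" by (simp only: t) simp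
  finally show ?thesis
    using x t unfolding yfrac_rel_def by blast
qed

instantiation yfrac :: "{comm_ring, comm_monoid_mult}"
begin

definition "0 = abs_yfrac (0, 1)"
definition "1 = abs_yfrac (1, 1)"
definition "x + y = (let (a, b) = rep_yfrac x; (c, d) = rep_yfrac y
                     in abs_yfrac (a * d + c * b, b * d))"
definition "x * y = (let (a, b) = rep_yfrac x; (c, d) = rep_yfrac y
                     in abs_yfrac (a * c, b * d))"
definition "- x = (let (a, b) = rep_yfrac x in abs_yfrac (- a, b))"
definition "x - y = x + - (y :: yfrac)"

lemma abs_yfrac_add:
  assumes "b \<in> schur_denoms" "d \<in> schur_denoms"
  shows "abs_yfrac (a, b) + abs_yfrac (c, d) = abs_yfrac (a * d + c * b, b * d)"
proof -
  obtain a' b' c' d' where rep: "rep_yfrac (abs_yfrac (a, b)) = (a', b')"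
      "rep_yfrac (abs_yfrac (c, d)) = (c', d')"
    by (metis surj_pair)
  show ?thesis
    using abs_yfrac_eq[OF yfrac_rel_add[of a' b' a b c' d' c d]]
      yfrac_rel_rep_abs[OF assms(1), of a] yfrac_rel_rep_abs[OF assms(2), of c]
    by (simp add: plus_yfrac_def rep)
qed

lemma abs_yfrac_mult:
  assumes "b \<in> schur_denoms" "d \<in> schur_denoms"
  shows "abs_yfrac (a, b) * abs_yfrac (c, d) = abs_yfrac (a * c, b * d)"
proof -
  obtain a' b' c' d' where rep: "rep_yfrac (abs_yfrac (a, b)) = (a', b')"
      "rep_yfrac (abs_yfrac (c, d)) = (c', d')"
    by (metis surj_pair)
  show ?thesis
    using abs_yfrac_eq[OF yfrac_rel_mult[of a' b' a b c' d' c d]]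
      yfrac_rel_rep_abs[OF assms(1), of a] yfrac_rel_rep_abs[OF assms(2), of c]
    by (simp add: times_yfrac_def rep)
qed

lemma abs_yfrac_uminus:
  assumes "b \<in> schur_denoms"
  shows "- abs_yfrac (a, b) = abs_yfrac (- a, b)"
proof -
  obtain a' b' where rep: "rep_yfrac (abs_yfrac (a, b)) = (a', b')"
    by (metis surj_pair)
  show ?thesis
    using abs_yfrac_eq[OF yfrac_rel_uminus[of a' b' a b]] yfrac_rel_rep_abs[OF assms(1), of a]
    by (simp add: uminus_yfrac_def rep)
qed

lemmas abs_yfrac_ops = abs_yfrac_add abs_yfrac_mult abs_yfrac_uminus

instance
proof
  fix x y z :: yfrac
  obtain a a' where x: "x = abs_yfrac (a, a')" "a' \<in> schur_denoms" by (rule yfrac_cases)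
  obtain b b' where y: "y = abs_yfrac (b, b')" "b' \<in> schur_denoms" by (rule yfrac_cases)
  obtain c c' where z: "z = abs_yfrac (c, c')" "c' \<in> schur_denoms" by (rule yfrac_cases)
  note eqs = x y z abs_yfrac_ops schur_denoms_mult schur_denoms.one zero_yfrac_def one_yfrac_def
  show "x * y * z = x * (y * z)" "x * y = y * x" "1 * x = x"
    by (simp_all add: eqs ac_simps)
  show "(x + y) * z = x * z + y * z"
    by (simp add: eqs, rule abs_yfrac_eqI) (simp_all add: eqs algebra_simps)
  show "x + y + z = x + (y + z)"
    by (simp add: eqs, rule abs_yfrac_eqI) (simp_all add: eqs algebra_simps)
  show "x + y = y + x" "0 + x = x"
    by (simp_all add: eqs ac_simps)
  show "- x + x = 0"
    by (simp add: eqs, rule abs_yfrac_eqI) (simp_all add: eqs algebra_simps)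
  show "x - y = x + - y" by (simp add: minus_yfrac_def)
qed

end

text \<open>The value \<open>0\<close> for a denominator outside the multiplicative set is a dummy; all denominators
  below belong to it.\<close>

definition yfrac_of :: "yseries \<Rightarrow> yseries \<Rightarrow> yfrac" where
  "yfrac_of f g = (if g \<in> schur_denoms then abs_yfrac (f, g) else 0)"

definition yfrac_embed :: "yseries \<Rightarrow> yfrac" where
  "yfrac_embed f = yfrac_of f 1"


section \<open>The universal quadratic Schur function\<close>

text \<open>The pair \<open>(E, \<sigma>)\<close> first permutes the variables by \<open>\<sigma>\<close> and then changes the signs of the
  variables in \<open>E\<close>. This is the semidirect product of the sign changes and the permutations
  of \<open>y\<^sub>i\<close>, \<open>i \<in> I\<close>.\<close>

definition signed_perms :: "nat set \<Rightarrow> (nat set \<times> (nat \<Rightarrow> nat)) monoid" where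
  "signed_perms I = \<lparr>
     carrier = {(E, \<sigma>). E \<subseteq> I \<and> \<sigma> permutes I},
     monoid.mult = (\<lambda>(E, \<sigma>) (E', \<sigma>'). ((E - \<sigma> ` E') \<union> (\<sigma> ` E' - E), \<sigma> \<circ> \<sigma>')),
     one = ({}, id)\<rparr>"

definition weyl_act :: "nat set \<times> (nat \<Rightarrow> nat) \<Rightarrow> yseries \<Rightarrow> yseries" where
  "weyl_act = (\<lambda>(E, \<sigma>). mps_subst (\<lambda>i. sgnY (\<sigma> i \<in> E) (\<sigma> i)))"

text \<open>A partition is the list of its parts, so that its \<open>i\<close>-th part is \<open>lam ! (i - 1)\<close>.\<close>

definition is_partition :: "nat list \<Rightarrow> bool" where
  "is_partition lam \<longleftrightarrow> sorted_wrt (\<ge>) lam \<and> (\<forall>l\<in>set lam. 0 < l)"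

definition schur_numer :: "nat \<Rightarrow> nat list \<Rightarrow> yseries" where
  "schur_numer n lam = (\<Prod>i=1..length lam. Y i ^ (lam ! (i - 1) + 2 * n - 2 * i + 1))"

definition schur_denom :: "nat \<Rightarrow> nat \<Rightarrow> yseries" where
  "schur_denom n q = (\<Prod>i=1..q. twoL (Y i)) *
     (\<Prod>i=1..q. \<Prod>j=i+1..n. (Y i +\<^sub>L Y j) * (Y i +\<^sub>L invL (Y j)))"

text \<open>The summand of a coset does not depend on the representative, because the fraction is fixed
  by the signed permutations of the variables with index greater than \<open>q\<close>.\<close>

definition quadratic_schur :: "nat \<Rightarrow> nat list \<Rightarrow> yfrac" where
  "quadratic_schur n lam = (let q = length lam in
     \<Sum>c\<in>lcosets\<^bsub>signed_perms {1..n}\<^esub> (carrier (signed_perms {q+1..n})).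
       let w = (SOME w. w \<in> c) in
       yfrac_of (weyl_act w (schur_numer n lam)) (weyl_act w (schur_denom n q)))"


section \<open>The generating function\<close>

text \<open>The generating function lives in the ring of power series in the \<open>y\<^sub>j\<close> whose coefficients are
  Laurent series in the \<open>u\<^sub>i\<close>. The variable \<open>Inl i\<close> of \<open>uyseries\<close> is \<open>u\<^sub>i\<close>, and \<open>Inr j\<close>
  is \<open>y\<^sub>j\<close>.\<close>

type_synonym uyseries = "(nat + nat, lazard) mps"
type_synonym laurent = "(nat, (nat, lazard) mls) mps"

abbreviation uvar :: "nat \<Rightarrow> uyseries" where "uvar i \<equiv> mps_var (Inl i)"
abbreviation yvar :: "nat \<Rightarrow> uyseries" where "yvar j \<equiv> mps_var (Inr j)"

definition join_exponent :: "(nat \<Rightarrow>\<^sub>0 int) \<Rightarrow> (nat \<Rightarrow>\<^sub>0 nat) \<Rightarrow> (nat + nat \<Rightarrow>\<^sub>0 nat)" where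
  "join_exponent m e = Abs_poly_mapping (case_sum (\<lambda>i. nat (lookup m i)) (lookup e))"

definition to_laurent :: "uyseries \<Rightarrow> laurent" where
  "to_laurent f = Mps (\<lambda>e. Mls (\<lambda>m.
     if \<forall>i. 0 \<le> lookup m i then mps_coeff f (join_exponent m e) else 0))"

definition uinv :: "nat \<Rightarrow> laurent" where
  "uinv i = mps_const (Mls (\<lambda>m. if m = Poly_Mapping.single i (- 1) then 1 else 0))"

text \<open>The expansion of \<open>1 / (u\<^sub>i +\<^sub>L invL x)\<close>, where \<open>x\<close> is \<open>y\<^sub>j\<close> or its formal inverse.\<close>

definition recip_expansion :: "nat \<Rightarrow> uyseries \<Rightarrow> laurent" where
  "recip_expansion i x =
     uinv i * to_laurent (mps_quot (uvar i - x) (uvar i +\<^sub>L invL x)) *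
     mps_sum (\<lambda>k::nat. to_laurent x ^ k * uinv i ^ k)"

text \<open>Since \<open>y\<^sub>j\<close> is the inverse of its inverse, the expansion of \<open>1 / (u\<^sub>i +\<^sub>L y\<^sub>j)\<close> is obtained from
  \<open>x = invL y\<^sub>j\<close>.\<close>

definition gen_one :: "nat \<Rightarrow> nat \<Rightarrow> laurent" where
  "gen_one n i = to_laurent (mps_quot 1 (PL (uvar i))) * to_laurent (uvar i) ^ (2 * n) *
     (\<Prod>j=1..n. recip_expansion i (invL (yvar j)) * recip_expansion i (yvar j))"

definition gen_series :: "nat \<Rightarrow> nat \<Rightarrow> laurent" where
  "gen_series n q = (\<Prod>i=1..q. gen_one n i) *
     (\<Prod>i=1..q. \<Prod>j=i+1..q.
        (to_laurent (uvar j +\<^sub>L invL (uvar i)) * uinv j) *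
        (to_laurent (uvar j +\<^sub>L uvar i) * uinv j))"

definition u_coeff :: "(nat \<Rightarrow>\<^sub>0 int) \<Rightarrow> laurent \<Rightarrow> yseries" where
  "u_coeff m s = Mps (\<lambda>e. mls_coeff (mps_coeff s e) m)"

definition neg_exponent :: "nat list \<Rightarrow> (nat \<Rightarrow>\<^sub>0 int)" where
  "neg_exponent lam = (\<Sum>i=1..length lam. Poly_Mapping.single i (- int (lam ! (i - 1))))"

end

(*
  Let z range over the 2n Chern roots y_j and their formal inverses. Up to a power series factor,
  the generating function in u_1, ..., u_q is the product of the inverses of u_i - z over all i
  and z, and the coefficient in question is an iterated residue. Partial fractions in each u_i turn
  it into a sum over all q-tuples (z_1, ..., z_q) of Chern roots of the values of that factor at
  u_i = z_i. The factors u_j +_L u_i and u_j +_L inv(u_i) kill the tuples in which a root meets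
  itself or its inverse; the other tuples are in bijection with the cosets of C_n / C_(n-q), and
  their terms are the summands of the quadratic Schur function.

  The formal group law is compared with the additive one through the divided difference
  V(z, w) = (z +_L w - z) / w. For w = u +_L inv(z) it gives u - z = w V(z, w), and V(z, 0) is the
  series PL(z), which is why PL(u) appears in the generating function.

  The common denominator of the partial fractions is the discriminant of the roots. It is a unit
  times a product of denominators of the localisation, and can therefore be cancelled there.
*)

theory Submission
  imports Defs
begin

section \<open>Formal power series\<close>

text \<open>Differences of roots are not invertible among power series, so partial fractions are
  available only after multiplication by the discriminant. Each variable u_i costs one factor
  \<open>root_disc n\<close>; the identity is therefore proved for \<open>root_disc n ^ q\<close>
  times both sides. The remaining factors fit together as follows. At u_i = z the slope V(z, u_i +_L
  inv(z)) becomes V(z, 0) and is cancelled by 1 / PL(u_i). The slopes at the other roots z' turn the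
  product of the z - z' into that of the z +_L inv(z'), in which z' = inv(z) contributes [2](z) and
  the other roots form one pair for each other variable. The resulting denominators contain every
  pair of indices in both orders; the values of u_j +_L u_i and u_j +_L inv(u_i), i < j, remove from
  the j-th one the pairs with smaller index, which leaves the triangular product of the definition.
  The exponent lambda_i + 2n - 2i + 1 is (lambda_i - 1) + 2n - 2(i - 1): the shift that turns the
  coefficient into a residue, the numerator u_i^(2n), and the i - 1 divisions by u_i^2.\<close>

lemma mps_coeff_zero [simp]: "mps_coeff 0 e = 0"
  by (simp add: zero_mps_def)

lemma mps_coeff_one: "mps_coeff 1 e = (if e = 0 then 1 else 0)"
  by (simp add: one_mps_def)

lemma mps_coeff_add [simp]: "mps_coeff (f + g) e = mps_coeff f e + mps_coeff g e"
  by (simp add: plus_mps_def)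

lemma mps_coeff_uminus [simp]: "mps_coeff (- f) e = - mps_coeff f e"
  by (simp add: uminus_mps_def)

lemma mps_coeff_minus [simp]: "mps_coeff (f - g) e = mps_coeff f e - mps_coeff g e"
  by (simp add: minus_mps_def)

lemma mps_coeff_mult:
  "mps_coeff (f * g) e = (\<Sum>(a, b)\<in>{(a, b). a + b = e}. mps_coeff f a * mps_coeff g b)"
  by (simp add: times_mps_def)

lemma mps_coeff_const: "mps_coeff (mps_const c) e = (if e = 0 then c else 0)"
  by (simp add: mps_const_def)

lemma mps_coeff_var: "mps_coeff (mps_var v) e = (if e = Poly_Mapping.single v 1 then 1 else 0)"
  by (simp add: mps_var_def)

lemma mps_coeff_mps_sum: "mps_coeff (mps_sum f) e = Sum_any (\<lambda>i. mps_coeff (f i) e)"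
  by (simp add: mps_sum_def)

lemma mps_coeff_sum: "mps_coeff (sum f A) e = (\<Sum>x\<in>A. mps_coeff (f x) e)"
  by (induction A rule: infinite_finite_induct) auto

lemma pm_eq_zero_iff: "a + b = 0 \<longleftrightarrow> a = 0 \<and> b = (0 :: 'v \<Rightarrow>\<^sub>0 nat)"
  by (auto simp: poly_mapping_eq_iff plus_poly_mapping.rep_eq fun_eq_iff)

lemma mps_coeff_mult_zero: "mps_coeff (f * g) 0 = mps_coeff f 0 * mps_coeff g 0"
  for f g :: "('v, 'a::comm_ring_1) mps"
proof -
  have "{(a, b). a + b = (0 :: 'v \<Rightarrow>\<^sub>0 nat)} = {(0, 0)}"
    by (auto simp: pm_eq_zero_iff)
  then show ?thesis by (simp add: mps_coeff_mult)
qed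

lemma mps_coeff_power_zero: "mps_coeff (f ^ n) 0 = mps_coeff f 0 ^ n"
  by (induction n) (auto simp: mps_coeff_one mps_coeff_mult_zero)

lemma mps_coeff_const_mult [simp]: "mps_coeff (mps_const c * f) e = c * mps_coeff f e"
  for f :: "('v, 'a::comm_ring_1) mps"
proof -
  have "mps_coeff (mps_const c * f) e =
      (\<Sum>(a, b)\<in>{(0, e)}. mps_coeff (mps_const c :: ('v, 'a) mps) a * mps_coeff f b)"
    unfolding mps_coeff_mult
    by (rule sum.mono_neutral_right)
       (simp_all add: finite_mps_splittings, auto simp: mps_coeff_const split: if_splits)
  then show ?thesis by (simp add: mps_coeff_const)
qed

section \<open>Monomials and the degree filtration\<close>

definition mps_monom :: "('v \<Rightarrow>\<^sub>0 nat) \<Rightarrow> ('v, 'a::comm_ring_1) mps" where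
  "mps_monom m = Mps (\<lambda>e. if e = m then 1 else 0)"

lemma mps_coeff_monom: "mps_coeff (mps_monom m) e = (if e = m then 1 else 0)"
  by (simp add: mps_monom_def)

lemma mps_coeff_monom_mult:
  "mps_coeff (mps_monom a * f) e = (if \<exists>b. a + b = e then mps_coeff f (e - a) else 0)"
proof (cases "\<exists>b. a + b = e")
  case True
  then obtain b where b: "a + b = e" by blast
  have "mps_coeff (mps_monom a * f) e = (\<Sum>(a', b)\<in>{(a, b)}. mps_coeff (mps_monom a) a' * mps_coeff f b)"
    unfolding mps_coeff_mult
    by (rule sum.mono_neutral_right)
       (use b in \<open>simp_all add: finite_mps_splittings, auto simp: mps_coeff_monom split: if_splits\<close>)
  then show ?thesis using b by (auto simp: mps_coeff_monom)
next
  case False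
  then show ?thesis
    unfolding mps_coeff_mult by (auto simp: mps_coeff_monom intro!: sum.neutral)
qed

lemma mps_monom_add: "mps_monom (a + b) = mps_monom a * mps_monom b"
  by (rule mps_eqI) (auto simp: mps_coeff_monom_mult mps_coeff_monom)

lemma mps_monom_zero [simp]: "mps_monom 0 = 1"
  by (rule mps_eqI) (simp add: mps_coeff_monom mps_coeff_one)

lemma mps_var_eq_monom: "mps_var v = mps_monom (Poly_Mapping.single v 1)"
  by (rule mps_eqI) (simp add: mps_coeff_var mps_coeff_monom)

definition pm_degree :: "('v \<Rightarrow>\<^sub>0 nat) \<Rightarrow> nat" where
  "pm_degree m = (\<Sum>v\<in>keys m. lookup m v)"

lemma pm_degree_superset: "finite A \<Longrightarrow> keys m \<subseteq> A \<Longrightarrow> pm_degree m = (\<Sum>v\<in>A. lookup m v)"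
  unfolding pm_degree_def by (rule sum.mono_neutral_left) (auto simp: in_keys_iff)

lemma pm_degree_add: "pm_degree (a + b) = pm_degree a + pm_degree b"
proof -
  let ?A = "keys a \<union> keys b"
  have "keys (a + b) \<subseteq> ?A" by (rule Poly_Mapping.keys_add)
  then show ?thesis
    by (simp add: pm_degree_superset[of ?A] lookup_add sum.distrib)
qed

lemma pm_degree_eq_0_iff [simp]: "pm_degree m = 0 \<longleftrightarrow> m = 0"
  by (auto simp: pm_degree_def in_keys_iff poly_mapping_eq_iff fun_eq_iff)

lemma pm_nat_induct [case_names zero add]:
  fixes m :: "'v \<Rightarrow>\<^sub>0 nat"
  assumes "P 0" and add: "\<And>v m. P m \<Longrightarrow> P (Poly_Mapping.single v 1 + m)"
  shows "P m"
proof (induction "pm_degree m" arbitrary: m)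
  case 0
  then show ?case using assms(1) by simp
next
  case (Suc k)
  then have "m \<noteq> 0" by (metis pm_degree_eq_0_iff nat.simps(3))
  then obtain v where v: "v \<in> keys m" by (metis ex_in_conv keys_eq_empty)
  define m' where "m' = m - Poly_Mapping.single v 1"
  have m: "m = Poly_Mapping.single v 1 + m'"
    using v by (intro poly_mapping_eqI)
      (auto simp: m'_def lookup_add lookup_minus lookup_single when_def in_keys_iff)
  have "pm_degree (Poly_Mapping.single v (1::nat)) = 1"
    by (simp add: pm_degree_superset[of "{v}"])
  then have "P m'" using Suc unfolding m pm_degree_add by simp
  then show ?case unfolding m by (rule add)
qed

definition mps_ord :: "nat \<Rightarrow> ('v, 'a::comm_ring_1) mps \<Rightarrow> bool" where
  "mps_ord k f \<longleftrightarrow> (\<forall>e. pm_degree e < k \<longrightarrow> mps_coeff f e = 0)"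

lemma mps_ord_0 [simp]: "mps_ord 0 f"
  by (simp add: mps_ord_def)

lemma mps_ord_1_iff: "mps_ord 1 f \<longleftrightarrow> mps_coeff f 0 = 0"
  by (auto simp: mps_ord_def)

lemma mps_ord_mono: "mps_ord k f \<Longrightarrow> l \<le> k \<Longrightarrow> mps_ord l f"
  by (auto simp: mps_ord_def)

lemma mps_ord_mult:
  fixes f g :: "('v, 'a::comm_ring_1) mps"
  assumes "mps_ord k f" "mps_ord l g"
  shows "mps_ord (k + l) (f * g)"
  unfolding mps_ord_def mps_coeff_mult
proof (intro allI impI sum.neutral ballI)
  fix e :: "'v \<Rightarrow>\<^sub>0 nat" and p assume e: "pm_degree e < k + l" and p: "p \<in> {(a, b). a + b = e}"
  then have "pm_degree (fst p) < k \<or> pm_degree (snd p) < l"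
    by (auto simp: pm_degree_add)
  then show "(case p of (a, b) \<Rightarrow> mps_coeff f a * mps_coeff g b) = 0"
    using assms by (auto simp: mps_ord_def case_prod_unfold)
qed

lemma mps_ord_power: "mps_ord k f \<Longrightarrow> mps_ord (k * n) (f ^ n)"
  by (induction n) (auto dest: mps_ord_mult)

lemma mps_ord_prod:
  "(\<And>x. x \<in> A \<Longrightarrow> mps_ord (k x) (f x)) \<Longrightarrow> mps_ord (\<Sum>x\<in>A. k x) (\<Prod>x\<in>A. f x)"
  by (induction A rule: infinite_finite_induct) (auto intro: mps_ord_mult)

lemma mps_ord_add: "mps_ord k f \<Longrightarrow> mps_ord k g \<Longrightarrow> mps_ord k (f + g)"
  by (simp add: mps_ord_def)

text \<open>\<open>Sum_any\<close> returns 0 on an infinite support; summability excludes this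
  default at every monomial.\<close>

definition mps_summable :: "('i \<Rightarrow> ('v, 'a::comm_ring_1) mps) \<Rightarrow> bool" where
  "mps_summable f \<longleftrightarrow> (\<forall>e. finite {i. mps_coeff (f i) e \<noteq> 0})"

lemma mps_summable_ordI:
  assumes "\<And>i. mps_ord (d i) (f i)" "\<And>k. finite {i. d i \<le> k}"
  shows "mps_summable f"
  unfolding mps_summable_def
proof
  fix e
  have "{i. mps_coeff (f i) e \<noteq> 0} \<subseteq> {i. d i \<le> pm_degree e}"
    using assms(1) by (force simp: mps_ord_def)
  then show "finite {i. mps_coeff (f i) e \<noteq> 0}"
    using assms(2) finite_subset by blast
qed

text \<open>Continuity: an output coefficient looks at finitely many input coefficients, and each of
  these is nonzero for finitely many summands, so two finite sums are exchanged. It is applied to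
  multiplication, substitution and the residue functional.\<close>

lemma mps_sum_linear:
  fixes T :: "('v, 'a::comm_ring_1) mps \<Rightarrow> ('w, 'a) mps" and F :: "'i \<Rightarrow> ('v, 'a) mps"
  assumes fin: "\<And>e. finite (M e)"
    and T: "\<And>f e. mps_coeff (T f) e = (\<Sum>m\<in>M e. mps_coeff f m * t m e)"
    and F: "mps_summable F"
  shows "mps_summable (\<lambda>i. T (F i))" "T (mps_sum F) = mps_sum (\<lambda>i. T (F i))"
proof -
  define A where "A e = (\<Union>m\<in>M e. {i. mps_coeff (F i) m \<noteq> 0})" for e
  have A: "finite (A e)" for e
    using F fin by (auto simp: A_def mps_summable_def)
  have sub: "{i. mps_coeff (T (F i)) e \<noteq> 0} \<subseteq> A e" for e
    unfolding A_def T by (force intro: sum.neutral)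
  show "mps_summable (\<lambda>i. T (F i))"
    unfolding mps_summable_def using A sub finite_subset by blast
  show "T (mps_sum F) = mps_sum (\<lambda>i. T (F i))"
  proof (rule mps_eqI)
    fix e
    have "mps_coeff (T (mps_sum F)) e = (\<Sum>m\<in>M e. (\<Sum>i\<in>A e. mps_coeff (F i) m) * t m e)"
      unfolding T mps_coeff_mps_sum
      by (intro sum.cong refl arg_cong2[where f = "(*)"] Sum_any.expand_superset A)
         (auto simp: A_def)
    also have "\<dots> = (\<Sum>i\<in>A e. \<Sum>m\<in>M e. mps_coeff (F i) m * t m e)"
      by (simp add: sum_distrib_right sum.swap[of _ "A e"])
    also have "\<dots> = mps_coeff (mps_sum (\<lambda>i. T (F i))) e"
      unfolding mps_coeff_mps_sum T[symmetric]
      by (rule Sum_any.expand_superset[symmetric, OF A sub])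
    finally show "mps_coeff (T (mps_sum F)) e = mps_coeff (mps_sum (\<lambda>i. T (F i))) e" .
  qed
qed

lemma finite_pm_divisors: "finite {b. \<exists>a. a + b = (m :: 'v \<Rightarrow>\<^sub>0 nat)}"
proof -
  have "{b. \<exists>a. a + b = m} = snd ` {(a, b). a + b = m}" by force
  then show ?thesis by (simp add: finite_mps_splittings)
qed

text \<open>The form of multiplication by \<open>g\<close> that \<open>mps_sum_linear\<close> asks
  for.\<close>

lemma mps_coeff_mult_right:
  "mps_coeff (g * f) e = (\<Sum>b\<in>{b. \<exists>a. a + b = e}. mps_coeff f b * mps_coeff g (e - b))"
  unfolding mps_coeff_mult
  by (rule sum.reindex_bij_witness[where i = "\<lambda>b. (e - b, b)" and j = snd]) (auto simp: mult.commute)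

lemma
  assumes "mps_summable F"
  shows mps_summable_mult: "mps_summable (\<lambda>i. g * F i)"
    and mps_sum_mult: "g * mps_sum F = mps_sum (\<lambda>i. g * F i)"
  by (rule mps_sum_linear[where T = "\<lambda>f. g * f", OF finite_pm_divisors mps_coeff_mult_right assms])+

lemma mps_expansion:
  "mps_summable (\<lambda>m. mps_const (mps_coeff f m) * mps_monom m)"
  "f = mps_sum (\<lambda>m. mps_const (mps_coeff f m) * mps_monom m)"
proof -
  have sub: "{m. mps_coeff (mps_const (mps_coeff f m) * mps_monom m) e \<noteq> 0} \<subseteq> {e}" for e
    by (auto simp: mps_coeff_monom)
  then show "mps_summable (\<lambda>m. mps_const (mps_coeff f m) * mps_monom m)"
    unfolding mps_summable_def by (meson finite.emptyI finite.insertI finite_subset)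
  show "f = mps_sum (\<lambda>m. mps_const (mps_coeff f m) * mps_monom m)"
    by (rule mps_eqI) (subst mps_coeff_mps_sum, subst Sum_any.expand_superset[OF _ sub], auto simp: mps_coeff_monom)
qed

lemma mps_geometric:
  fixes f :: "('v, 'a::comm_ring_1) mps"
  assumes "mps_coeff f 0 = 0"
  shows "mps_summable (\<lambda>k. f ^ k)" "(1 - f) * mps_sum (\<lambda>k. f ^ k) = 1"
proof -
  have "mps_ord k (f ^ k)" for k
    using mps_ord_power[of 1 f k] assms by (simp flip: mps_ord_1_iff)
  then show s: "mps_summable (\<lambda>k. f ^ k)"
    by (rule mps_summable_ordI) auto
  show "(1 - f) * mps_sum (\<lambda>k. f ^ k) = 1"
  proof (rule mps_eqI)
    fix e :: "'v \<Rightarrow>\<^sub>0 nat"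
    \<comment> \<open>Powers of \<open>f\<close> beyond the degree of \<open>e\<close> do not reach
      the coefficient at \<open>e\<close>, so the series may be replaced by a finite geometric
      sum.\<close>
    let ?N = "pm_degree e"
    have ord: "mps_coeff (f ^ k) e = 0" if "k > ?N" for k
      using \<open>\<And>k. mps_ord k (f ^ k)\<close> that by (auto simp: mps_ord_def)
    have s': "mps_summable (\<lambda>k. (1 - f) * f ^ k)" by (rule mps_summable_mult[OF s])
    have ord': "mps_coeff ((1 - f) * f ^ k) e = 0" if "k > ?N" for k
      using ord[of k] ord[of "Suc k"] that by (simp add: algebra_simps)
    have "mps_coeff ((1 - f) * mps_sum (\<lambda>k. f ^ k)) e = Sum_any (\<lambda>k. mps_coeff ((1 - f) * f ^ k) e)"
      by (simp add: mps_sum_mult[OF s] mps_coeff_mps_sum)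
    also have "\<dots> = (\<Sum>k\<le>?N. mps_coeff ((1 - f) * f ^ k) e)"
      by (rule Sum_any.expand_superset) (use ord' in \<open>auto simp: not_less[symmetric]\<close>)
    also have "\<dots> = mps_coeff ((1 - f) * (\<Sum>k\<le>?N. f ^ k)) e"
      by (simp add: mps_coeff_sum sum_distrib_left)
    also have "(1 - f) * (\<Sum>k\<le>?N. f ^ k) = 1 - f ^ Suc ?N"
      using sum_gp_basic[of f ?N] by (simp add: mult.commute)
    also have "mps_coeff \<dots> e = mps_coeff 1 e"
      using ord[of "Suc ?N"] by simp
    finally show "mps_coeff ((1 - f) * mps_sum (\<lambda>k. f ^ k)) e = mps_coeff 1 e" .
  qed
qed

lemma mps_unit:
  fixes f :: "('v, 'a::comm_ring_1) mps"
  assumes "mps_coeff f 0 = 1"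
  shows "f dvd 1"
  using mps_geometric(2)[of "1 - f"] assms by (auto simp: mps_coeff_one) (metis dvd_triv_left)

lemma mps_quotI:
  assumes "h * g = f" "\<And>a. a * g = 0 \<Longrightarrow> a = 0"
  shows "mps_quot f g = h"
  unfolding mps_quot_def
proof (rule the_equality)
  fix h' assume "h' * g = f"
  then have "(h' - h) * g = 0" using assms(1) by (simp add: left_diff_distrib)
  then show "h' = h" using assms(2) by fastforce
qed (rule assms(1))

section \<open>Substitution of power series\<close>

definition mps_pow :: "('v \<Rightarrow> ('w, 'a::comm_ring_1) mps) \<Rightarrow> ('v \<Rightarrow>\<^sub>0 nat) \<Rightarrow> ('w, 'a) mps" where
  "mps_pow \<phi> m = (\<Prod>v\<in>keys m. \<phi> v ^ lookup m v)"

lemma mps_pow_superset: "finite A \<Longrightarrow> keys m \<subseteq> A \<Longrightarrow> mps_pow \<phi> m = (\<Prod>v\<in>A. \<phi> v ^ lookup m v)"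
  unfolding mps_pow_def by (rule prod.mono_neutral_left) (auto simp: in_keys_iff)

lemma mps_pow_add: "mps_pow \<phi> (a + b) = mps_pow \<phi> a * mps_pow \<phi> b"
proof -
  let ?A = "keys a \<union> keys b"
  have "keys (a + b) \<subseteq> ?A" by (rule Poly_Mapping.keys_add)
  then show ?thesis
    by (simp add: mps_pow_superset[of ?A] lookup_add prod.distrib power_add)
qed

lemma mps_pow_zero [simp]: "mps_pow \<phi> 0 = 1"
  by (simp add: mps_pow_def)

lemma mps_pow_single [simp]: "mps_pow \<phi> (Poly_Mapping.single v k) = \<phi> v ^ k"
  by (simp add: mps_pow_superset[of "{v}"])

lemma mps_subst_alt: "mps_subst \<phi> f = mps_sum (\<lambda>m. mps_const (mps_coeff f m) * mps_pow \<phi> m)"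
  by (simp add: mps_subst_def mps_pow_def)

text \<open>With infinitely many variables, zero constant terms do not make a substitution converge;
  each monomial must also occur in only finitely many of the substituted series.\<close>

definition mps_admissible :: "('v \<Rightarrow> ('w, 'a::comm_ring_1) mps) \<Rightarrow> bool" where
  "mps_admissible \<phi> \<longleftrightarrow> mps_summable \<phi> \<and> (\<forall>v. mps_coeff (\<phi> v) 0 = 0)"

lemma mps_coeff_mult_nonzero:
  assumes "mps_coeff (f * g) e \<noteq> 0"
  shows "\<exists>a b. a + b = e \<and> mps_coeff f a \<noteq> 0 \<and> mps_coeff g b \<noteq> 0"
proof -
  obtain p where "p \<in> {(a, b). a + b = e}" "(case p of (a, b) \<Rightarrow> mps_coeff f a * mps_coeff g b) \<noteq> 0"
    using assms unfolding mps_coeff_mult by (rule sum.not_neutral_contains_not_neutral)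
  then show ?thesis by (intro exI[of _ "fst p"] exI[of _ "snd p"]) auto
qed

lemma finite_pm_bounded: 
  assumes "finite A"
  shows "finite {m :: 'v \<Rightarrow>\<^sub>0 nat. keys m \<subseteq> A \<and> pm_degree m \<le> k}"
proof -
  let ?S = "{m :: 'v \<Rightarrow>\<^sub>0 nat. keys m \<subseteq> A \<and> pm_degree m \<le> k}"
  have "lookup ` ?S \<subseteq> {f. \<forall>i. (i \<in> A \<longrightarrow> f i \<in> {..k}) \<and> (i \<notin> A \<longrightarrow> f i = 0)}"
  proof clarsimp
    fix m :: "'v \<Rightarrow>\<^sub>0 nat" and i
    assume m: "keys m \<subseteq> A" "pm_degree m \<le> k"
    have "lookup m i \<le> (\<Sum>v\<in>A. lookup m v)" if "i \<in> A"
      using assms that by (rule member_le_sum[rotated -1]) auto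
    then show "(i \<in> A \<longrightarrow> lookup m i \<le> k) \<and> (i \<notin> A \<longrightarrow> lookup m i = 0)"
      using m assms by (auto simp: pm_degree_superset in_keys_iff)
  qed
  moreover have "finite {f. \<forall>i. (i \<in> A \<longrightarrow> f i \<in> {..k}) \<and> (i \<notin> A \<longrightarrow> f i = (0::nat))}"
    by (rule finite_set_of_finite_funs[OF assms]) simp
  ultimately have "finite (lookup ` ?S)" by (rule finite_subset)
  then show ?thesis by (rule finite_imageD) (simp add: inj_on_def)
qed

text \<open>A product contributing to the monomial \<open>e\<close> has degree at most that of
  \<open>e\<close>, because every factor has order at least 1, and it involves only variables from a
  finite set. Both bounds together leave finitely many products.\<close>

lemma mps_summable_pow:
  assumes "mps_admissible \<phi>"
  shows "mps_summable (mps_pow \<phi>)"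
  unfolding mps_summable_def
proof
  fix e
  \<comment> \<open>The variables whose image has a nonzero coefficient at some divisor of
    \<open>e\<close>. If \<open>v\<close> occurs in \<open>m\<close>, then \<open>\<phi> v\<close>
    is a factor of \<open>mps_pow \<phi> m\<close>, which forces \<open>v\<close> into this
    set.\<close>
  define W where "W = (\<Union>e'\<in>{b. \<exists>a. a + b = e}. {v. mps_coeff (\<phi> v) e' \<noteq> 0})"
  have W: "finite W"
    using assms by (auto simp: W_def finite_pm_divisors mps_admissible_def mps_summable_def)
  have "{m. mps_coeff (mps_pow \<phi> m) e \<noteq> 0} \<subseteq> {m. keys m \<subseteq> W \<and> pm_degree m \<le> pm_degree e}"
  proof clarify
    fix m assume m: "mps_coeff (mps_pow \<phi> m) e \<noteq> 0"
    have "mps_ord (pm_degree m) (mps_pow \<phi> m)"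
      unfolding pm_degree_def mps_pow_def
    proof (rule mps_ord_prod)
      fix v
      have "mps_ord 1 (\<phi> v)" using assms unfolding mps_admissible_def mps_ord_1_iff by blast
      from mps_ord_power[OF this] show "mps_ord (lookup m v) (\<phi> v ^ lookup m v)" by simp
    qed
    then have "pm_degree m \<le> pm_degree e" using m by (auto simp: mps_ord_def not_less[symmetric])
    moreover have "v \<in> W" if "v \<in> keys m" for v
    proof -
      have "mps_pow \<phi> m = (\<Prod>w\<in>keys m - {v}. \<phi> w ^ lookup m w) * \<phi> v ^ lookup m v"
        using that unfolding mps_pow_def by (subst prod.remove[of _ v]) (auto simp: mult.commute)
      also have "\<dots> = ((\<Prod>w\<in>keys m - {v}. \<phi> w ^ lookup m w) * \<phi> v ^ (lookup m v - 1)) * \<phi> v"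
        using that by (cases "lookup m v") (auto simp: in_keys_iff mult_ac)
      finally show ?thesis
        using m mps_coeff_mult_nonzero unfolding W_def by fastforce
    qed
    ultimately show "keys m \<subseteq> W \<and> pm_degree m \<le> pm_degree e" by blast
  qed
  then show "finite {m. mps_coeff (mps_pow \<phi> m) e \<noteq> 0}"
    using finite_pm_bounded[OF W] finite_subset by blast
qed

context
  fixes \<phi> :: "'v \<Rightarrow> ('w, 'a::comm_ring_1) mps"
  assumes adm: "mps_admissible \<phi>"
begin

lemma mps_coeff_subst:
  "mps_coeff (mps_subst \<phi> f) e =
     (\<Sum>m\<in>{m. mps_coeff (mps_pow \<phi> m) e \<noteq> 0}. mps_coeff f m * mps_coeff (mps_pow \<phi> m) e)"
  unfolding mps_subst_alt mps_coeff_mps_sum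
  by (subst Sum_any.expand_superset)
     (use mps_summable_pow[OF adm] in \<open>auto simp: mps_summable_def\<close>)

lemma
  assumes "mps_summable F"
  shows mps_summable_subst: "mps_summable (\<lambda>i. mps_subst \<phi> (F i))"
    and mps_subst_mps_sum: "mps_subst \<phi> (mps_sum F) = mps_sum (\<lambda>i. mps_subst \<phi> (F i))"
  using mps_sum_linear[where T = "mps_subst \<phi>", OF _ mps_coeff_subst assms] mps_summable_pow[OF adm]
  by (auto simp: mps_summable_def)

lemma mps_subst_add [simp]: "mps_subst \<phi> (f + g) = mps_subst \<phi> f + mps_subst \<phi> g"
  by (rule mps_eqI) (simp add: mps_coeff_subst distrib_right sum.distrib)

lemma mps_subst_zero [simp]: "mps_subst \<phi> 0 = 0"
  by (rule mps_eqI) (simp add: mps_coeff_subst)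

lemma mps_subst_diff [simp]: "mps_subst \<phi> (f - g) = mps_subst \<phi> f - mps_subst \<phi> g"
  by (rule mps_eqI) (simp add: mps_coeff_subst left_diff_distrib sum_subtractf)

lemma mps_subst_monom [simp]: "mps_subst \<phi> (mps_monom a) = mps_pow \<phi> a"
proof (rule mps_eqI)
  fix e
  have "finite {m. mps_coeff (mps_pow \<phi> m) e \<noteq> 0}"
    using mps_summable_pow[OF adm] by (simp add: mps_summable_def)
  then show "mps_coeff (mps_subst \<phi> (mps_monom a)) e = mps_coeff (mps_pow \<phi> a) e"
    by (simp add: mps_coeff_subst mps_coeff_monom if_distrib[of "\<lambda>x. x * _"] sum.If_cases cong: if_cong)
qed

lemma mps_subst_const_mult: "mps_subst \<phi> (mps_const c * f) = mps_const c * mps_subst \<phi> f"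
  by (rule mps_eqI) (simp add: mps_coeff_subst sum_distrib_left mult.assoc)

text \<open>First half of multiplicativity: one factor is a monomial and the other is expanded into
  monomials. The general case then expands the remaining factor.\<close>

lemma mps_subst_monom_mult: "mps_subst \<phi> (mps_monom a * g) = mps_pow \<phi> a * mps_subst \<phi> g"
proof -
  let ?G = "\<lambda>m. mps_const (mps_coeff g m) * mps_monom m"
  have "mps_subst \<phi> (mps_monom a * g) = mps_subst \<phi> (mps_monom a * mps_sum ?G)"
    by (simp flip: mps_expansion(2))
  also have "\<dots> = mps_sum (\<lambda>m. mps_subst \<phi> (mps_monom a * ?G m))"
    by (simp add: mps_sum_mult mps_subst_mps_sum mps_summable_mult mps_expansion(1))
  also have "\<dots> = mps_sum (\<lambda>m. mps_pow \<phi> a * mps_subst \<phi> (?G m))"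
  proof -
    have "mps_subst \<phi> (mps_monom a * ?G m) = mps_pow \<phi> a * mps_subst \<phi> (?G m)" for m
      unfolding mult.left_commute[of "mps_monom a"] mps_subst_const_mult mps_monom_add[symmetric]
        mps_subst_monom mps_pow_add by (rule mult.left_commute)
    then show ?thesis by simp
  qed
  also have "\<dots> = mps_pow \<phi> a * mps_subst \<phi> (mps_sum ?G)"
    by (simp add: mps_sum_mult mps_subst_mps_sum mps_summable_subst mps_expansion(1))
  finally show ?thesis by (simp flip: mps_expansion(2))
qed

lemma mps_subst_mult [simp]: "mps_subst \<phi> (f * g) = mps_subst \<phi> f * mps_subst \<phi> g"
proof -
  let ?F = "\<lambda>m. mps_const (mps_coeff f m) * mps_monom m"
  have "mps_subst \<phi> (f * g) = mps_subst \<phi> (g * mps_sum ?F)"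
    by (simp add: mult.commute[of f g] flip: mps_expansion(2))
  also have "\<dots> = mps_sum (\<lambda>m. mps_subst \<phi> (g * ?F m))"
    by (simp add: mps_sum_mult mps_subst_mps_sum mps_summable_mult mps_expansion(1))
  also have "\<dots> = mps_sum (\<lambda>m. mps_subst \<phi> g * mps_subst \<phi> (?F m))"
  proof -
    have "mps_subst \<phi> (g * ?F m) = mps_subst \<phi> g * mps_subst \<phi> (?F m)" for m
    proof -
      have eq: "g * ?F m = mps_const (mps_coeff f m) * (mps_monom m * g)"
        by (simp only: mult_ac)
      show ?thesis
        unfolding eq mps_subst_const_mult mps_subst_monom_mult mps_subst_monom
        by (simp only: mult_ac)
    qed
    then show ?thesis by simp
  qed
  also have "\<dots> = mps_subst \<phi> g * mps_subst \<phi> (mps_sum ?F)"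
    by (simp add: mps_sum_mult mps_subst_mps_sum mps_summable_subst mps_expansion(1))
  finally show ?thesis by (simp add: mult.commute[of _ "mps_subst \<phi> g"] flip: mps_expansion(2))
qed

lemma mps_subst_one [simp]: "mps_subst \<phi> 1 = 1"
  using mps_subst_monom[of 0] by simp

lemma mps_subst_const [simp]: "mps_subst \<phi> (mps_const c) = mps_const c"
  using mps_subst_const_mult[of c 1] by simp

lemma mps_subst_var [simp]: "mps_subst \<phi> (mps_var v) = \<phi> v"
  by (simp add: mps_var_eq_monom)

lemma mps_subst_power [simp]: "mps_subst \<phi> (f ^ n) = mps_subst \<phi> f ^ n"
  by (induction n) auto

lemma mps_subst_prod [simp]: "mps_subst \<phi> (\<Prod>x\<in>A. f x) = (\<Prod>x\<in>A. mps_subst \<phi> (f x))"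
  by (induction A rule: infinite_finite_induct) auto

lemma mps_coeff_subst_zero [simp]: "mps_coeff (mps_subst \<phi> f) 0 = mps_coeff f 0"
proof -
  have "mps_coeff (mps_pow \<phi> m) 0 = (if m = 0 then 1 else 0)" for m
  proof (cases "m = 0")
    case False
    then obtain v where "v \<in> keys m" by (metis ex_in_conv keys_eq_empty)
    moreover have "mps_coeff (\<phi> v ^ lookup m v) 0 = 0" if "v \<in> keys m" for v
      using that adm by (auto simp: mps_coeff_power_zero mps_admissible_def in_keys_iff power_0_left)
    ultimately show ?thesis using False
      unfolding mps_pow_def by (subst prod.remove[of _ v]) (auto simp: mps_coeff_mult_zero)
  qed (simp add: mps_coeff_one)
  then show ?thesis by (simp add: mps_coeff_subst)
qed

end


section \<open>The formal group law\<close>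

lemma mps_ord_dvd: "mps_ord k f \<Longrightarrow> f dvd g \<Longrightarrow> mps_ord k g"
  using mps_ord_mult[of k f 0] by auto

lemma mps_ord_power_null: "mps_coeff f 0 = 0 \<Longrightarrow> mps_ord n (f ^ n)"
  using mps_ord_power[of 1 f n] unfolding mps_ord_1_iff by simp

lemma mps_ord_const_powers:
  assumes "mps_coeff f 0 = 0" "mps_coeff g 0 = 0"
  shows "mps_ord (i + j) (mps_const c * f ^ i * g ^ j)"
  using mps_ord_mult[OF mps_ord_mult[OF mps_ord_0 mps_ord_power_null[OF assms(1)]] mps_ord_power_null[OF assms(2)]]
  by simp

text \<open>The offsets \<open>k\<close> and \<open>l\<close> serve three series: the formal group
  law (1, 1), its quotient by the second argument (1, 0), and its quotient by the first (0,
  1).\<close>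

lemma mps_summable_powers:
  assumes "mps_coeff f 0 = 0" "mps_coeff g 0 = 0"
  shows "mps_summable (\<lambda>(i, j). mps_const (\<alpha> i j) * f ^ (k + i) * g ^ (l + j))"
proof (rule mps_summable_ordI)
  fix p
  show "mps_ord (k + fst p + (l + snd p)) (case p of (i, j) \<Rightarrow> mps_const (\<alpha> i j) * f ^ (k + i) * g ^ (l + j))"
    using mps_ord_const_powers[OF assms] by (cases p) simp
next
  fix N
  have "{p. k + fst p + (l + snd p) \<le> N} \<subseteq> {..N} \<times> {..N}" by auto
  then show "finite {p. k + fst p + (l + snd p) \<le> N}" by (rule finite_subset) simp
qed

lemmas mps_summable_fgl = mps_summable_powers[where k = "Suc 0" and l = "Suc 0", simplified]

lemma mps_sum_coeff_0: "(\<And>i. mps_coeff (F i) 0 = 0) \<Longrightarrow> mps_coeff (mps_sum F) 0 = 0"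
  by (simp add: mps_coeff_mps_sum)

lemma addL_alt:
  "f +\<^sub>L g = f + g + mps_sum (\<lambda>(i, j). mps_const (lazard_coeff i j) * f ^ Suc i * g ^ Suc j)"
  by (simp add: addL_def fgl_add_def)

lemma fgl_add_coeff_0:
  assumes "mps_coeff f 0 = 0" "mps_coeff g 0 = 0"
  shows "mps_coeff (fgl_add \<alpha> f g) 0 = 0"
  using assms unfolding fgl_add_def mps_coeff_add
  by (subst mps_sum_coeff_0) (auto simp: mps_coeff_mult_zero split: prod.splits)

lemma addL_coeff_0 [simp]:
  "mps_coeff f 0 = 0 \<Longrightarrow> mps_coeff g 0 = 0 \<Longrightarrow> mps_coeff (f +\<^sub>L g) 0 = 0"
  unfolding addL_def by (rule fgl_add_coeff_0)

lemma mps_sum_zero [simp]: "mps_sum (\<lambda>_. 0) = 0"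
  by (rule mps_eqI) (simp add: mps_coeff_mps_sum)

lemma addL_0_right [simp]: "f +\<^sub>L 0 = f"
  by (simp add: addL_alt case_prod_unfold)

lemma addL_0_left [simp]: "0 +\<^sub>L f = f"
  by (simp add: addL_alt case_prod_unfold)

lemma mps_var_coeff_0 [simp]: "mps_coeff (mps_var v) 0 = 0"
proof -
  have "lookup (Poly_Mapping.single v (1::nat)) v \<noteq> lookup 0 v" by simp
  then show ?thesis unfolding mps_coeff_var by metis
qed

lemma mps_subst_addL:
  assumes "mps_admissible \<phi>" "mps_coeff f 0 = 0" "mps_coeff g 0 = 0"
  shows "mps_subst \<phi> (f +\<^sub>L g) = mps_subst \<phi> f +\<^sub>L mps_subst \<phi> g"
proof -
  have "mps_subst \<phi> (mps_sum (\<lambda>(i, j). mps_const (lazard_coeff i j) * f ^ Suc i * g ^ Suc j)) =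
      mps_sum (\<lambda>p. mps_subst \<phi> (case p of (i, j) \<Rightarrow> mps_const (lazard_coeff i j) * f ^ Suc i * g ^ Suc j))"
    by (rule mps_subst_mps_sum[OF assms(1)]) (use mps_summable_fgl[OF assms(2,3)] in simp)
  then show ?thesis
    unfolding addL_alt using assms(1) by (simp add: case_prod_unfold)
qed

section \<open>From the relations of the Lazard ring to the laws of formal addition\<close>

definition mps_lazard :: "('v, lazard_poly) mps \<Rightarrow> ('v, lazard) mps" where
  "mps_lazard f = Mps (\<lambda>e. abs_lazard (mps_coeff f e))"

lemma mps_coeff_lazard: "mps_coeff (mps_lazard f) e = abs_lazard (mps_coeff f e)"
  by (simp add: mps_lazard_def)

lemma abs_lazard_sum: "abs_lazard (sum f A) = (\<Sum>x\<in>A. abs_lazard (f x))"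
  by (induction A rule: infinite_finite_induct) (auto simp flip: abs_lazard_ops)

lemma mps_lazard_mult: "mps_lazard (f * g) = mps_lazard f * mps_lazard g"
  by (rule mps_eqI)
     (simp add: mps_coeff_lazard mps_coeff_mult abs_lazard_sum case_prod_unfold flip: abs_lazard_ops)

lemma mps_lazard_add: "mps_lazard (f + g) = mps_lazard f + mps_lazard g"
  by (rule mps_eqI) (simp add: mps_coeff_lazard flip: abs_lazard_ops)

lemma mps_lazard_diff: "mps_lazard (f - g) = mps_lazard f - mps_lazard g"
  by (rule mps_eqI) (simp add: mps_coeff_lazard flip: abs_lazard_ops)

lemma mps_lazard_const: "mps_lazard (mps_const c) = mps_const (abs_lazard c)"
  by (rule mps_eqI) (simp add: mps_coeff_lazard mps_coeff_const flip: abs_lazard_ops)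

lemma mps_lazard_one: "mps_lazard 1 = 1"
  by (rule mps_eqI) (simp add: mps_coeff_lazard mps_coeff_one flip: abs_lazard_ops)

lemma mps_lazard_var: "mps_lazard (mps_var v) = mps_var v"
  by (rule mps_eqI) (simp add: mps_coeff_lazard mps_coeff_var flip: abs_lazard_ops)

lemma mps_lazard_power: "mps_lazard (f ^ n) = mps_lazard f ^ n"
  by (induction n) (auto simp: mps_lazard_one mps_lazard_mult)

lemma mps_lazard_mps_sum:
  assumes "mps_summable F"
  shows "mps_lazard (mps_sum F) = mps_sum (\<lambda>i. mps_lazard (F i))"
proof (rule mps_eqI)
  fix e
  let ?A = "{i. mps_coeff (F i) e \<noteq> 0}"
  have A: "finite ?A" using assms by (simp add: mps_summable_def)
  have "mps_coeff (mps_lazard (mps_sum F)) e = (\<Sum>i\<in>?A. abs_lazard (mps_coeff (F i) e))"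
    by (simp add: mps_coeff_lazard mps_coeff_mps_sum Sum_any.expand_set abs_lazard_sum)
  also have "\<dots> = mps_coeff (mps_sum (\<lambda>i. mps_lazard (F i))) e"
    unfolding mps_coeff_mps_sum mps_coeff_lazard
    by (rule Sum_any.expand_superset[symmetric, OF A]) (auto simp flip: abs_lazard_ops)
  finally show "mps_coeff (mps_lazard (mps_sum F)) e = mps_coeff (mps_sum (\<lambda>i. mps_lazard (F i))) e" .
qed

lemma mps_lazard_generic_add:
  assumes "mps_coeff f 0 = 0" "mps_coeff g 0 = 0"
  shows "mps_lazard (generic_add f g) = mps_lazard f +\<^sub>L mps_lazard g"
proof -
  have "mps_lazard (mps_sum (\<lambda>(i, j). mps_const (lazard_gen i j) * f ^ Suc i * g ^ Suc j)) =
      mps_sum (\<lambda>p. mps_lazard (case p of (i, j) \<Rightarrow> mps_const (lazard_gen i j) * f ^ Suc i * g ^ Suc j))"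
    by (rule mps_lazard_mps_sum) (use mps_summable_fgl[OF assms] in simp)
  then show ?thesis
    unfolding addL_alt fgl_add_def
    by (simp add: case_prod_unfold mps_lazard_add mps_lazard_mult mps_lazard_const mps_lazard_power
        lazard_coeff.abs_eq)
qed

lemma abs_lazard_relation: "p \<in> lazard_relations \<Longrightarrow> abs_lazard p = 0"
  unfolding zero_lazard_def lazard.abs_eq_iff by (simp add: lazard_poly.span_base)

lemma mps_lazard_relation:
  assumes "range (mps_coeff f) \<subseteq> lazard_relations"
  shows "mps_lazard f = 0"
  by (rule mps_eqI) (use assms in \<open>auto simp: mps_coeff_lazard intro!: abs_lazard_relation\<close>)

lemma addL_generic_commute: "mps_var 0 +\<^sub>L mps_var 1 = mps_var 1 +\<^sub>L (mps_var 0 :: (nat, lazard) mps)"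
proof -
  have "mps_lazard (generic_add (mps_var 0) (mps_var 1) - generic_add (mps_var 1) (mps_var 0)) = 0"
    by (rule mps_lazard_relation) (auto simp: lazard_relations_def Let_def)
  then show ?thesis
    by (simp add: mps_lazard_diff mps_lazard_generic_add mps_lazard_var)
qed

lemma addL_generic_assoc:
  "(mps_var 0 +\<^sub>L mps_var 1) +\<^sub>L mps_var 2 = mps_var 0 +\<^sub>L (mps_var 1 +\<^sub>L (mps_var 2 :: (nat, lazard) mps))"
proof -
  let ?X = "mps_var 0" and ?Y = "mps_var 1" and ?Z = "mps_var 2"
  have "mps_lazard (generic_add (generic_add ?X ?Y) ?Z - generic_add ?X (generic_add ?Y ?Z)) = 0"
    by (rule mps_lazard_relation) (auto simp: lazard_relations_def Let_def)
  then show ?thesis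
    by (simp add: mps_lazard_diff mps_lazard_generic_add mps_lazard_var fgl_add_coeff_0)
qed

lemma mps_admissible_finite:
  assumes "finite {v. \<phi> v \<noteq> 0}" "\<And>v. mps_coeff (\<phi> v) 0 = 0"
  shows "mps_admissible \<phi>"
  unfolding mps_admissible_def mps_summable_def
proof (intro conjI allI)
  fix e show "finite {v. mps_coeff (\<phi> v) e \<noteq> 0}"
    by (rule finite_subset[OF _ assms(1)]) auto
qed (rule assms(2))

context
  fixes f g h :: "('v, lazard) mps"
  assumes f: "mps_coeff f 0 = 0" and g: "mps_coeff g 0 = 0" and h: "mps_coeff h 0 = 0"
begin

text \<open>The relations give the laws only for three independent variables. Substituting
  \<open>f\<close>, \<open>g\<close>, \<open>h\<close> for these carries them over to all series
  without constant term.\<close>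

private definition \<psi> :: "nat \<Rightarrow> ('v, lazard) mps" where
  "\<psi> i = (if i = 0 then f else if i = 1 then g else if i = 2 then h else 0)"

private lemma adm: "mps_admissible \<psi>"
proof (rule mps_admissible_finite)
  have "{v. \<psi> v \<noteq> 0} \<subseteq> {0, 1, 2}" by (auto simp: \<psi>_def)
  then show "finite {v. \<psi> v \<noteq> 0}" by (rule finite_subset) simp
qed (use f g h in \<open>auto simp: \<psi>_def\<close>)

lemma addL_commute: "f +\<^sub>L g = g +\<^sub>L f"
  using arg_cong[OF addL_generic_commute, of "mps_subst \<psi>"]
  by (simp add: mps_subst_addL adm) (simp add: \<psi>_def)

lemma addL_assoc: "(f +\<^sub>L g) +\<^sub>L h = f +\<^sub>L (g +\<^sub>L h)"
  using arg_cong[OF addL_generic_assoc, of "mps_subst \<psi>"]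
  by (simp add: mps_subst_addL adm) (simp add: \<psi>_def)

end

text \<open>The formal inverse of \<open>f\<close> is the fixed point of the contraction
  \<open>g \<mapsto> - f - (f +\<^sub>L g - f - g)\<close>.\<close>

lemma ex_addL_inverse:
  fixes f :: "('v, lazard) mps"
  assumes f: "mps_coeff f 0 = 0"
  shows "\<exists>g. mps_coeff g 0 = 0 \<and> f +\<^sub>L g = 0"
proof -
  define T where "T g = - f - mps_sum (\<lambda>(i, j). mps_const (lazard_coeff i j) * f ^ Suc i * g ^ Suc j)" for g
  \<comment> \<open>Every term of the correction contains \<open>f\<close>, of order 1, besides a
    multiple of \<open>g - g'\<close>; this gains one degree.\<close>
  have contr: "mps_ord (Suc k) (T g - T g')" if gg': "mps_ord k (g - g')" for g g' k
    unfolding mps_ord_def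
  proof (intro allI impI)
    fix e :: "'v \<Rightarrow>\<^sub>0 nat" assume e: "pm_degree e < Suc k"
    have "mps_coeff (mps_const c * f ^ Suc i * g ^ Suc j) e = mps_coeff (mps_const c * f ^ Suc i * g' ^ Suc j) e"
      for c i j
    proof -
      have "(g - g') dvd (g ^ Suc j - g' ^ Suc j)"
        unfolding power_diff_sumr2 by (rule dvd_triv_left)
      then have ord: "mps_ord k (g ^ Suc j - g' ^ Suc j)"
        by (rule mps_ord_dvd[OF gg'])
      have "mps_ord 1 (mps_const c * f ^ Suc i)"
        unfolding mps_ord_1_iff using f by (simp add: mps_coeff_mult_zero)
      from mps_ord_mult[OF this ord]
      have "mps_ord (Suc k) (mps_const c * f ^ Suc i * g ^ Suc j - mps_const c * f ^ Suc i * g' ^ Suc j)"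
        by (simp only: right_diff_distrib plus_1_eq_Suc)
      then show ?thesis using e unfolding mps_ord_def by (metis mps_coeff_minus eq_iff_diff_eq_0)
    qed
    then show "mps_coeff (T g - T g') e = 0"
      by (simp add: T_def mps_coeff_mps_sum case_prod_unfold)
  qed
  define x where "x k = (T ^^ k) 0" for k
  have step: "mps_ord k (x (Suc k) - x k)" for k
    by (induction k) (auto simp: x_def contr)
  have later: "mps_ord k (x (k + l) - x k)" for k l
  proof (induction l)
    case (Suc l)
    have "mps_ord k (x (Suc (k + l)) - x (k + l))" by (rule mps_ord_mono[OF step]) simp
    from mps_ord_add[OF this Suc] show ?case by simp
  qed (simp add: mps_ord_def)
  \<comment> \<open>The limit of the iterates: coefficients of degree d no longer change from the
    iterate d + 1 on.\<close>
  define g where "g = Mps (\<lambda>e. mps_coeff (x (Suc (pm_degree e))) e)"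
  have lim: "mps_ord k (g - x k)" for k
    unfolding mps_ord_def
  proof (intro allI impI)
    fix e :: "'v \<Rightarrow>\<^sub>0 nat" assume "pm_degree e < k"
    then obtain l where "k = Suc (pm_degree e) + l" by (metis Suc_leI le_Suc_ex)
    then show "mps_coeff (g - x k) e = 0"
      using later[of "Suc (pm_degree e)" l] by (simp add: g_def mps_ord_def)
  qed
  have fixp: "T g = g"
  proof (rule mps_eqI)
    fix e :: "'v \<Rightarrow>\<^sub>0 nat"
    let ?k = "pm_degree e"
    have "mps_ord (Suc ?k) (T g - x (Suc ?k))"
      using contr[OF lim[of ?k]] by (simp add: x_def)
    with lim[of "Suc ?k"] show "mps_coeff (T g) e = mps_coeff g e"
      by (simp add: mps_ord_def)
  qed
  have "mps_coeff (T g) 0 = 0"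
    unfolding T_def mps_coeff_minus
    by (subst mps_sum_coeff_0) (use f in \<open>auto simp: mps_coeff_mult_zero split: prod.splits\<close>)
  moreover have "f +\<^sub>L g = 0"
  proof -
    have "f + g + s = g - (- f - s)" for s by simp
    then have "f +\<^sub>L g = g - T g" unfolding addL_alt T_def .
    then show ?thesis by (simp add: fixp)
  qed
  ultimately show ?thesis using fixp by auto
qed

lemma addL_inverse_unique:
  assumes "mps_coeff f 0 = 0" "mps_coeff g 0 = 0" "mps_coeff g' 0 = 0" "f +\<^sub>L g = 0" "f +\<^sub>L g' = 0"
  shows "g = g'"
proof -
  have "g = g +\<^sub>L (f +\<^sub>L g')" using assms by simp
  also have "\<dots> = (g +\<^sub>L f) +\<^sub>L g'" using assms by (simp only: addL_assoc)
  also have "g +\<^sub>L f = f +\<^sub>L g" using assms by (intro addL_commute)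
  finally show ?thesis using assms by simp
qed

lemma
  assumes "mps_coeff f 0 = 0"
  shows invL_coeff_0 [simp]: "mps_coeff (invL f) 0 = 0" and addL_invL: "f +\<^sub>L invL f = 0"
proof -
  have "\<exists>!g. mps_coeff g 0 = 0 \<and> f +\<^sub>L g = 0"
    using ex_addL_inverse[OF assms] addL_inverse_unique[OF assms] by blast
  then have "mps_coeff (invL f) 0 = 0 \<and> f +\<^sub>L invL f = 0"
    unfolding invL_def by (rule theI')
  then show "mps_coeff (invL f) 0 = 0" "f +\<^sub>L invL f = 0" by auto
qed

lemma invL_unique:
  assumes "mps_coeff f 0 = 0" "mps_coeff g 0 = 0" "f +\<^sub>L g = 0"
  shows "invL f = g"
  by (rule addL_inverse_unique[of f]) (use assms in \<open>auto simp: addL_invL\<close>)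

lemma invL_addL: "mps_coeff f 0 = 0 \<Longrightarrow> invL f +\<^sub>L f = 0"
  by (simp add: addL_commute[of "invL f"] addL_invL)

lemma invL_invL: "mps_coeff f 0 = 0 \<Longrightarrow> invL (invL f) = f"
  by (rule invL_unique) (auto simp: invL_addL)

lemma mps_subst_invL:
  assumes "mps_admissible \<phi>" "mps_coeff f 0 = 0"
  shows "mps_subst \<phi> (invL f) = invL (mps_subst \<phi> f)"
proof (rule invL_unique[symmetric])
  have "mps_subst \<phi> (f +\<^sub>L invL f) = 0" using assms by (simp add: addL_invL)
  then show "mps_subst \<phi> f +\<^sub>L mps_subst \<phi> (invL f) = 0"
    using assms by (simp add: mps_subst_addL)
qed (use assms in auto)

text \<open>In the equation \<open>f +\<^sub>L invL f = 0\<close> every term except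
  \<open>invL f\<close> itself contains a factor \<open>f\<close>. This makes sign changes of
  infinitely many variables an admissible substitution.\<close>

lemma dvd_invL:
  assumes "mps_coeff f 0 = 0"
  shows "f dvd invL f"
proof -
  let ?g = "invL f"
  let ?F = "\<lambda>(i, j). mps_const (lazard_coeff i j) * f ^ (0 + i) * ?g ^ (Suc 0 + j)"
  have "mps_sum (\<lambda>(i, j). mps_const (lazard_coeff i j) * f ^ Suc i * ?g ^ Suc j) = f * mps_sum ?F"
    using mps_sum_mult[OF mps_summable_powers, of f ?g f lazard_coeff 0 "Suc 0"] assms
    by (simp add: case_prod_unfold mult_ac)
  then have "f + ?g + f * mps_sum ?F = 0"
    using addL_invL[OF assms] by (simp add: addL_alt)
  moreover have "?g = f * - (1 + mps_sum ?F) + (f + ?g + f * mps_sum ?F)"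
    by (simp only: ring_distribs mult_minus_right mult_1_right) simp
  ultimately have "?g = f * - (1 + mps_sum ?F)" by simp
  then show ?thesis by (rule dvdI)
qed

text \<open>The divided difference \<open>(z +\<^sub>L w - z) / w\<close>. Its value at \<open>w = 0\<close> is the derivative of the
  formal group law that defines \<open>PL\<close>.\<close>

definition addL_slope :: "('v, lazard) mps \<Rightarrow> ('v, lazard) mps \<Rightarrow> ('v, lazard) mps" where
  "addL_slope z w = 1 + mps_sum (\<lambda>(i, j). mps_const (lazard_coeff i j) * z ^ Suc i * w ^ j)"

lemmas mps_summable_slope = mps_summable_powers[where k = "Suc 0" and l = 0, simplified]

lemma addL_eq_slope:
  assumes "mps_coeff z 0 = 0" "mps_coeff w 0 = 0"
  shows "z +\<^sub>L w = z + w * addL_slope z w"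
proof -
  have "w * mps_sum (\<lambda>(i, j). mps_const (lazard_coeff i j) * z ^ Suc i * w ^ j) =
      mps_sum (\<lambda>p. w * (case p of (i, j) \<Rightarrow> mps_const (lazard_coeff i j) * z ^ Suc i * w ^ j))"
    by (rule mps_sum_mult) (use mps_summable_slope[OF assms] in simp)
  then show ?thesis
    unfolding addL_alt addL_slope_def by (simp add: case_prod_unfold algebra_simps)
qed

lemma addL_slope_coeff_0:
  assumes "mps_coeff z 0 = 0"
  shows "mps_coeff (addL_slope z w) 0 = 1"
  unfolding addL_slope_def mps_coeff_add
  by (subst mps_sum_coeff_0) (use assms in \<open>auto simp: mps_coeff_mult_zero mps_coeff_one split: prod.splits\<close>)

lemma mps_subst_slope:
  assumes "mps_admissible \<phi>" "mps_coeff z 0 = 0" "mps_coeff w 0 = 0"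
  shows "mps_subst \<phi> (addL_slope z w) = addL_slope (mps_subst \<phi> z) (mps_subst \<phi> w)"
proof -
  have "mps_subst \<phi> (mps_sum (\<lambda>(i, j). mps_const (lazard_coeff i j) * z ^ Suc i * w ^ j)) =
      mps_sum (\<lambda>p. mps_subst \<phi> (case p of (i, j) \<Rightarrow> mps_const (lazard_coeff i j) * z ^ Suc i * w ^ j))"
    by (rule mps_subst_mps_sum[OF assms(1)]) (use mps_summable_slope[OF assms(2,3)] in simp)
  then show ?thesis
    unfolding addL_slope_def using assms(1) by (simp add: case_prod_unfold)
qed

lemma addL_slope_0: "addL_slope z 0 = PL z"
proof -
  have "Sum_any (\<lambda>(i, j). mps_coeff (mps_const (lazard_coeff i j) * z ^ Suc i * 0 ^ j) e) =
      Sum_any (\<lambda>i. mps_coeff (if i \<ge> 1 then mps_const (aL i 1) * z ^ i else 0) e)" for e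
    unfolding Sum_any.expand_set
    \<comment> \<open>Only \<open>j = 0\<close> survives because of \<open>0 ^ j\<close>; the shift
      by one is that between \<open>lazard_coeff\<close> and \<open>aL\<close>.\<close>
    by (rule sum.reindex_bij_witness[where j = "\<lambda>(i, j). Suc i" and i = "\<lambda>i. (i - 1, 0)"])
       (auto simp: aL_def power_0_left Suc_diff_Suc simp del: power_Suc split: if_splits)
  then show ?thesis
    unfolding addL_slope_def PL_def
    by (intro arg_cong2[where f = "(+)"] refl mps_eqI) (simp add: mps_coeff_mps_sum case_prod_unfold)
qed

lemma PL_coeff_0: "mps_coeff z 0 = 0 \<Longrightarrow> mps_coeff (PL z) 0 = 1"
  by (simp add: addL_slope_coeff_0 flip: addL_slope_0)

lemma mps_subst_PL:
  assumes "mps_admissible \<phi>" "mps_coeff z 0 = 0"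
  shows "mps_subst \<phi> (PL z) = PL (mps_subst \<phi> z)"
  using mps_subst_slope[OF assms(1,2), of 0] assms(1) by (simp add: addL_slope_0)

lemma diff_eq_mult_slope:
  assumes "mps_coeff u 0 = 0" "mps_coeff z 0 = 0"
  shows "u - z = (u +\<^sub>L invL z) * addL_slope z (u +\<^sub>L invL z)"
proof -
  have "z +\<^sub>L (u +\<^sub>L invL z) = u +\<^sub>L (invL z +\<^sub>L z)"
    using assms by (simp add: addL_commute[of z "u +\<^sub>L invL z"] addL_assoc)
  also have "\<dots> = u" using assms by (simp add: invL_addL)
  finally show ?thesis
    using addL_eq_slope[of z "u +\<^sub>L invL z"] assms by (simp add: algebra_simps)
qed


section \<open>Laurent series\<close>

abbreviation uy_coeff :: "laurent \<Rightarrow> (nat \<Rightarrow>\<^sub>0 nat) \<Rightarrow> (nat \<Rightarrow>\<^sub>0 int) \<Rightarrow> lazard" where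
  "uy_coeff s e m \<equiv> mls_coeff (mps_coeff s e) m"

lemma laurent_eqI: "(\<And>e m. uy_coeff s e m = uy_coeff t e m) \<Longrightarrow> s = t"
  by (intro mps_eqI mls_eqI)

lemma mls_coeff_diff: "mls_coeff (f - g) m = mls_coeff f m - mls_coeff g m"
proof -
  have "f - g = f + - g" by simp
  then show ?thesis by (simp only: mls_coeff_add mls_coeff_uminus) simp
qed

lemma mls_coeff_sum: "mls_coeff (sum f A) m = (\<Sum>x\<in>A. mls_coeff (f x) m)"
  by (induction A rule: infinite_finite_induct) (auto simp: mls_coeff_add mls_coeff_zero)

lemma lookup_join_exponent [simp]:
  "lookup (join_exponent m e) (Inl i) = nat (lookup m i)"
  "lookup (join_exponent m e) (Inr j) = lookup e j"
proof -
  have "{x. case_sum (\<lambda>i. nat (lookup m i)) (lookup e) x \<noteq> 0} \<subseteq> Inl ` keys m \<union> Inr ` keys e"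
  proof
    fix x assume "x \<in> {x. case_sum (\<lambda>i. nat (lookup m i)) (lookup e) x \<noteq> 0}"
    then show "x \<in> Inl ` keys m \<union> Inr ` keys e" by (cases x) (auto simp: in_keys_iff)
  qed
  then have "finite {x. case_sum (\<lambda>i. nat (lookup m i)) (lookup e) x \<noteq> 0}"
    by (rule finite_subset) simp
  then show "lookup (join_exponent m e) (Inl i) = nat (lookup m i)"
    "lookup (join_exponent m e) (Inr j) = lookup e j"
    by (simp_all add: join_exponent_def Abs_poly_mapping_inverse)
qed

text \<open>With \<open>exponent_y\<close> this inverts \<open>join_exponent\<close> on exponents
  that are nonnegative in u, where the truncation by \<open>nat\<close> loses nothing.\<close>

definition exponent_u :: "(nat + nat \<Rightarrow>\<^sub>0 nat) \<Rightarrow> (nat \<Rightarrow>\<^sub>0 int)" where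
  "exponent_u x = Abs_poly_mapping (\<lambda>i. int (lookup x (Inl i)))"

definition exponent_y :: "(nat + nat \<Rightarrow>\<^sub>0 nat) \<Rightarrow> (nat \<Rightarrow>\<^sub>0 nat)" where
  "exponent_y x = Abs_poly_mapping (\<lambda>j. lookup x (Inr j))"

lemma lookup_exponent_u [simp]: "lookup (exponent_u x) i = int (lookup x (Inl i))"
proof -
  have "{i. int (lookup x (Inl i)) \<noteq> 0} = Inl -` keys x" by (auto simp: in_keys_iff)
  then have "finite {i. int (lookup x (Inl i)) \<noteq> 0}" by (simp add: finite_vimageI)
  then show ?thesis by (simp add: exponent_u_def Abs_poly_mapping_inverse)
qed

lemma lookup_exponent_y [simp]: "lookup (exponent_y x) i = lookup x (Inr i)"
proof -
  have "{i. lookup x (Inr i) \<noteq> 0} = Inr -` keys x" by (auto simp: in_keys_iff)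
  then have "finite {i. lookup x (Inr i) \<noteq> 0}" by (simp add: finite_vimageI)
  then show ?thesis by (simp add: exponent_y_def Abs_poly_mapping_inverse)
qed

lemma join_exponents [simp]: "join_exponent (exponent_u x) (exponent_y x) = x"
proof (rule poly_mapping_eqI)
  fix k show "lookup (join_exponent (exponent_u x) (exponent_y x)) k = lookup x k"
    by (cases k) auto
qed

lemma exponent_y_join [simp]: "exponent_y (join_exponent m e) = e"
  by (rule poly_mapping_eqI) simp

lemma exponent_u_join: "(\<And>i. 0 \<le> lookup m i) \<Longrightarrow> exponent_u (join_exponent m e) = m"
  by (rule poly_mapping_eqI) simp

lemma exponent_y_add: "exponent_y (a + b) = exponent_y a + exponent_y b"
  by (rule poly_mapping_eqI) (simp add: lookup_add)

lemma exponent_u_add: "exponent_u (a + b) = exponent_u a + exponent_u b"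
  by (rule poly_mapping_eqI) (simp add: lookup_add)

lemma join_exponent_add:
  assumes "\<And>i. 0 \<le> lookup m i" "\<And>i. 0 \<le> lookup m' i"
  shows "join_exponent (m + m') (e + e') = join_exponent m e + join_exponent m' e'"
proof (rule poly_mapping_eqI)
  fix k show "lookup (join_exponent (m + m') (e + e')) k = lookup (join_exponent m e + join_exponent m' e') k"
    using assms by (cases k) (auto simp: lookup_add nat_add_distrib)
qed

lemma to_laurent_bound:
  "mls_bound 0 (\<lambda>m. if \<forall>i. 0 \<le> lookup m i then mps_coeff f (join_exponent m e) else 0)"
  by (auto simp: mls_bound_def)

lemma uy_coeff_to_laurent:
  "uy_coeff (to_laurent f) e m = (if \<forall>i. 0 \<le> lookup m i then mps_coeff f (join_exponent m e) else 0)"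
  by (simp add: to_laurent_def mls_coeff_Mls[OF to_laurent_bound])

lemma to_laurent_coeff_bound: "mls_bound 0 (mls_coeff (mps_coeff (to_laurent f) e))"
  using to_laurent_bound by (simp add: uy_coeff_to_laurent[abs_def])

lemma to_laurent_inject: "to_laurent f = to_laurent g \<longleftrightarrow> f = g"
proof
  assume eq: "to_laurent f = to_laurent g"
  show "f = g"
  proof (rule mps_eqI)
    fix x
    show "mps_coeff f x = mps_coeff g x"
      using arg_cong[OF eq, of "\<lambda>s. uy_coeff s (exponent_y x) (exponent_u x)"]
      by (simp add: uy_coeff_to_laurent)
  qed
qed simp

lemma uy_coeff_mult:
  "uy_coeff (s * t) e m =
     (\<Sum>(a, b)\<in>{(a, b). a + b = e}. mls_convol (mls_coeff (mps_coeff s a)) (mls_coeff (mps_coeff t b)) m)"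
  by (simp add: mps_coeff_mult mls_coeff_sum case_prod_unfold mls_coeff_mult)

lemma to_laurent_mult: "to_laurent (f * g) = to_laurent f * to_laurent g"
proof (rule laurent_eqI)
  fix e :: "nat \<Rightarrow>\<^sub>0 nat" and m :: "nat \<Rightarrow>\<^sub>0 int"
  let ?T = "\<lambda>f e. mls_coeff (mps_coeff (to_laurent f) e)"
  let ?S = "SIGMA p:{(a, b). a + b = e}. mls_splittings 0 0 m"
  have "uy_coeff (to_laurent f * to_laurent g) e m =
      (\<Sum>p\<in>{(a, b). a + b = e}. \<Sum>r\<in>mls_splittings 0 0 m. ?T f (fst p) (fst r) * ?T g (snd p) (snd r))"
    unfolding uy_coeff_mult case_prod_unfold
    by (simp add: mls_convol_eq[OF to_laurent_coeff_bound to_laurent_coeff_bound] case_prod_unfold)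
  also have "\<dots> = (\<Sum>(p, r)\<in>?S. ?T f (fst p) (fst r) * ?T g (snd p) (snd r))"
    by (rule sum.Sigma) (auto simp: finite_mps_splittings finite_mls_splittings)
  also have "\<dots> = uy_coeff (to_laurent (f * g)) e m"
  proof (cases "\<forall>i. 0 \<le> lookup m i")
    case True
    have "(\<Sum>(p, r)\<in>?S. ?T f (fst p) (fst r) * ?T g (snd p) (snd r)) =
        (\<Sum>(x, y)\<in>{(x, y). x + y = join_exponent m e}. mps_coeff f x * mps_coeff g y)"
      by (rule sum.reindex_bij_witness[where
            i = "\<lambda>(x, y). ((exponent_y x, exponent_y y), (exponent_u x, exponent_u y))" and
            j = "\<lambda>(p, r). (join_exponent (fst r) (fst p), join_exponent (snd r) (snd p))"])
         (use True in \<open>auto simp: mls_splittings_def exponent_u_join join_exponent_add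
            uy_coeff_to_laurent simp flip: exponent_u_add exponent_y_add\<close>)
    then show ?thesis using True by (simp add: uy_coeff_to_laurent mps_coeff_mult)
  next
    \<comment> \<open>Both factors have nonnegative exponents in u, so an exponent with a negative
      entry has no splittings and both sides vanish.\<close>
    case False
    have "\<forall>i. 0 \<le> lookup m i" if "p \<in> mls_splittings 0 0 m" for p
      using that by (auto simp: mls_splittings_def lookup_add)
    with False have "mls_splittings 0 0 m = {}" by blast
    then show ?thesis using False by (auto simp add: uy_coeff_to_laurent)
  qed
  finally show "uy_coeff (to_laurent (f * g)) e m = uy_coeff (to_laurent f * to_laurent g) e m" ..
qed

lemma to_laurent_zero [simp]: "to_laurent 0 = 0"
  by (rule laurent_eqI) (simp add: uy_coeff_to_laurent mls_coeff_zero)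

lemma to_laurent_diff: "to_laurent (f - g) = to_laurent f - to_laurent g"
  by (rule laurent_eqI) (simp add: uy_coeff_to_laurent mls_coeff_diff)

lemma join_exponent_eq_0_iff:
  assumes "\<And>i. 0 \<le> lookup m i"
  shows "join_exponent m e = 0 \<longleftrightarrow> m = 0 \<and> e = 0"
proof
  assume "join_exponent m e = 0"
  then have "exponent_u (join_exponent m e) = 0" "exponent_y (join_exponent m e) = 0"
    by (auto intro: poly_mapping_eqI)
  then show "m = 0 \<and> e = 0" using exponent_u_join[OF assms] by simp
next
  assume "m = 0 \<and> e = 0"
  moreover have "join_exponent 0 0 = 0" 
  proof (rule poly_mapping_eqI)
    fix k show "lookup (join_exponent 0 0) k = lookup 0 k" by (cases k) auto
  qed
  ultimately show "join_exponent m e = 0" by simp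
qed

lemma to_laurent_one [simp]: "to_laurent 1 = 1"
proof (rule laurent_eqI)
  fix e m show "uy_coeff (to_laurent 1) e m = uy_coeff 1 e m"
  proof (cases "\<forall>i. 0 \<le> lookup m i")
    case True
    then show ?thesis
      by (simp add: uy_coeff_to_laurent mps_coeff_one join_exponent_eq_0_iff mls_coeff_one mls_coeff_zero)
  next
    case False
    then have "m \<noteq> 0" by auto
    with False show ?thesis
      by (simp add: uy_coeff_to_laurent mps_coeff_one mls_coeff_one mls_coeff_zero)
  qed
qed

lemma to_laurent_power: "to_laurent (f ^ k) = to_laurent f ^ k"
  by (induction k) (auto simp: to_laurent_mult)

lemma to_laurent_prod: "to_laurent (\<Prod>x\<in>A. f x) = (\<Prod>x\<in>A. to_laurent (f x))"
  by (induction A rule: infinite_finite_induct) (auto simp: to_laurent_mult)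

section \<open>Laurent monomials in the u-variables\<close>

definition mls_monom :: "('v \<Rightarrow>\<^sub>0 int) \<Rightarrow> 'a::comm_ring_1 \<Rightarrow> ('v, 'a) mls" where
  "mls_monom a c = Mls (\<lambda>m. if m = a then c else 0)"

lemma mls_coeff_monom: "mls_coeff (mls_monom a c) m = (if m = a then c else 0)"
  unfolding mls_monom_def by (subst mls_coeff_Mls[of a]) (auto simp: mls_bound_def)

lemma mls_coeff_monom_mult: "mls_coeff (mls_monom a c * x) m = c * mls_coeff x (m - a)"
proof (cases "c = 0 \<or> mls_coeff x (m - a) = 0")
  case True
  have "mls_convol (mls_coeff (mls_monom a c)) (mls_coeff x) m = 0"
    unfolding mls_convol_def
    by (rule sum.neutral) (use True in \<open>auto simp: mls_coeff_monom split: if_splits\<close>)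
  then show ?thesis using True by (auto simp: mls_coeff_mult)
next
  case False
  have "{(p, q). p + q = m \<and> mls_coeff (mls_monom a c) p \<noteq> 0 \<and> mls_coeff x q \<noteq> 0} = {(a, m - a)}"
    using False by (auto simp: mls_coeff_monom split: if_splits)
  then show ?thesis by (simp add: mls_coeff_mult mls_convol_def mls_coeff_monom)
qed

definition u_monom :: "(nat \<Rightarrow>\<^sub>0 int) \<Rightarrow> laurent" where
  "u_monom a = mps_const (mls_monom a 1)"

lemma uy_coeff_u_monom_mult: "uy_coeff (u_monom a * s) e m = uy_coeff s e (m - a)"
  by (simp add: u_monom_def mls_coeff_monom_mult)

lemma uy_coeff_u_monom: "uy_coeff (u_monom a) e m = (if e = 0 \<and> m = a then 1 else 0)"
  by (simp add: u_monom_def mps_coeff_const mls_coeff_monom mls_coeff_zero)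

lemma u_monom_add: "u_monom (a + b) = u_monom a * u_monom b"
  by (rule laurent_eqI) (auto simp: uy_coeff_u_monom_mult uy_coeff_u_monom algebra_simps)

lemma u_monom_zero [simp]: "u_monom 0 = 1"
  by (rule laurent_eqI) (auto simp: uy_coeff_u_monom mps_coeff_one mls_coeff_one mls_coeff_zero)

lemma uinv_eq_u_monom: "uinv i = u_monom (Poly_Mapping.single i (- 1))"
  by (simp add: uinv_def u_monom_def mls_monom_def)

lemma to_laurent_uvar: "to_laurent (uvar i) = u_monom (Poly_Mapping.single i 1)"
proof (rule laurent_eqI)
  fix e m
  have *: "join_exponent m e = Poly_Mapping.single (Inl i) 1 \<longleftrightarrow> e = 0 \<and> m = Poly_Mapping.single i 1"
    if "\<And>i. 0 \<le> lookup m i"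
  proof -
    have "join_exponent m e = Poly_Mapping.single (Inl i) 1 \<longleftrightarrow>
        exponent_u (join_exponent m e) = exponent_u (Poly_Mapping.single (Inl i) 1) \<and>
        exponent_y (join_exponent m e) = exponent_y (Poly_Mapping.single (Inl i) 1)"
      by (metis join_exponents)
    moreover have "exponent_u (Poly_Mapping.single (Inl i) 1) = Poly_Mapping.single i 1"
      "exponent_y (Poly_Mapping.single (Inl i) 1) = 0"
      by (auto intro!: poly_mapping_eqI simp: lookup_single when_def)
    ultimately show ?thesis using that by (auto simp: exponent_u_join)
  qed
  show "uy_coeff (to_laurent (uvar i)) e m = uy_coeff (u_monom (Poly_Mapping.single i 1)) e m"
    using * by (auto simp: uy_coeff_to_laurent uy_coeff_u_monom mps_coeff_var lookup_single when_def)
qed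

lemma to_laurent_uvar_uinv: "to_laurent (uvar i) * uinv i = 1"
  by (simp add: to_laurent_uvar uinv_eq_u_monom flip: u_monom_add single_add)

section \<open>Power series in the y-variables as constants of the Laurent ring\<close>

definition y_const :: "yseries \<Rightarrow> laurent" where
  "y_const f = Mps (\<lambda>e. mls_monom 0 (mps_coeff f e))"

lemma uy_coeff_y_const: "uy_coeff (y_const f) e m = (if m = 0 then mps_coeff f e else 0)"
  by (simp add: y_const_def mls_coeff_monom)

lemma uy_coeff_y_const_mult:
  "uy_coeff (y_const f * s) e m = (\<Sum>(a, b)\<in>{(a, b). a + b = e}. mps_coeff f a * uy_coeff s b m)"
  by (simp add: mps_coeff_mult mls_coeff_sum case_prod_unfold y_const_def mls_coeff_monom_mult)

lemma u_coeff_y_const_mult: "u_coeff m (y_const f * s) = f * u_coeff m s"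
  by (rule mps_eqI) (simp add: u_coeff_def uy_coeff_y_const_mult mps_coeff_mult[of f])

lemma mps_coeff_u_coeff: "mps_coeff (u_coeff m s) e = uy_coeff s e m"
  by (simp add: u_coeff_def)

lemma u_coeff_u_monom_mult: "u_coeff m (u_monom a * s) = u_coeff (m - a) s"
  by (rule mps_eqI) (simp add: mps_coeff_u_coeff uy_coeff_u_monom_mult)

lemma u_coeff_add: "u_coeff m (s + t) = u_coeff m s + u_coeff m t"
  by (rule mps_eqI) (simp add: mps_coeff_u_coeff mls_coeff_add)

lemma u_coeff_zero [simp]: "u_coeff m 0 = 0"
  by (rule mps_eqI) (simp add: mps_coeff_u_coeff mls_coeff_zero)

lemma u_coeff_sum: "u_coeff m (sum s A) = (\<Sum>x\<in>A. u_coeff m (s x))"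
  by (induction A rule: infinite_finite_induct) (auto simp: u_coeff_add)

definition y_embed :: "yseries \<Rightarrow> uyseries" where
  "y_embed = mps_subst yvar"

lemma mps_admissible_yvar: "mps_admissible (\<lambda>j. yvar j :: uyseries)"
  unfolding mps_admissible_def mps_summable_def
proof (intro conjI allI)
  fix e :: "nat + nat \<Rightarrow>\<^sub>0 nat"
  have "{j. mps_coeff (yvar j :: uyseries) e \<noteq> 0} \<subseteq> Inr -` keys e"
    by (auto simp: mps_coeff_var)
  then show "finite {j. mps_coeff (yvar j :: uyseries) e \<noteq> 0}"
    by (rule finite_subset) (simp add: finite_vimageI)
qed simp

lemma mps_pow_yvar: "mps_pow (\<lambda>j. yvar j :: uyseries) m = mps_monom (join_exponent 0 m)"
proof (induction m rule: pm_nat_induct)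
  case zero
  then show ?case by (simp add: join_exponent_eq_0_iff[THEN iffD2])
next
  case (add v m')
  have "join_exponent 0 (Poly_Mapping.single v 1 + m') =
      Poly_Mapping.single (Inr v) 1 + join_exponent 0 m'"
  proof (rule poly_mapping_eqI)
    fix k show "lookup (join_exponent 0 (Poly_Mapping.single v 1 + m')) k =
        lookup (Poly_Mapping.single (Inr v) 1 + join_exponent 0 m') k"
      by (cases k) (auto simp: lookup_add lookup_single when_def)
  qed
  then show ?case
    unfolding mps_pow_add add.IH by (simp add: mps_monom_add mps_var_eq_monom)
qed

text \<open>Through this factorisation \<open>y_const\<close> inherits the ring homomorphism laws
  from substitution and \<open>to_laurent\<close>.\<close>

lemma to_laurent_y_embed: "to_laurent (y_embed f) = y_const f"
proof (rule laurent_eqI)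
  fix e m
  show "uy_coeff (to_laurent (y_embed f)) e m = uy_coeff (y_const f) e m"
  proof (cases "\<forall>i. 0 \<le> lookup m i")
    case True
    have join: "join_exponent m e = join_exponent 0 e' \<longleftrightarrow> m = 0 \<and> e = e'" for e'
      by (metis True exponent_u_join exponent_y_join lookup_zero order_refl)
    have "{e'. mps_coeff (mps_pow (\<lambda>j. yvar j :: uyseries) e') (join_exponent m e) \<noteq> 0} =
        (if m = 0 then {e} else {})"
      by (auto simp: mps_pow_yvar mps_coeff_monom join)
    then show ?thesis
      using True by (simp add: uy_coeff_to_laurent y_embed_def mps_coeff_subst[OF mps_admissible_yvar]
          uy_coeff_y_const) (simp add: mps_pow_yvar mps_coeff_monom)
  next
    case False
    then have "m \<noteq> 0" by auto
    with False show ?thesis by (auto simp: uy_coeff_to_laurent uy_coeff_y_const)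
  qed
qed

lemma y_const_mult: "y_const (f * g) = y_const f * y_const g"
  by (simp add: y_embed_def mps_admissible_yvar to_laurent_mult flip: to_laurent_y_embed)

lemma y_const_one [simp]: "y_const 1 = 1"
  by (simp add: y_embed_def mps_admissible_yvar flip: to_laurent_y_embed)

lemma y_const_diff: "y_const (f - g) = y_const f - y_const g"
  by (simp add: y_embed_def mps_admissible_yvar to_laurent_diff flip: to_laurent_y_embed)

lemma y_const_prod: "y_const (\<Prod>x\<in>A. f x) = (\<Prod>x\<in>A. y_const (f x))"
  by (induction A rule: infinite_finite_induct) (auto simp: y_const_mult)

lemma u_coeff_0_y_const: "u_coeff 0 (y_const f) = f"
  by (rule mps_eqI) (simp add: mps_coeff_u_coeff uy_coeff_y_const)

text \<open>The expansion of \<open>1 / (u\<^sub>i - z)\<close> in negative powers of \<open>u\<^sub>i\<close>.\<close>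

definition u_recip :: "nat \<Rightarrow> yseries \<Rightarrow> laurent" where
  "u_recip i z = uinv i * mps_sum (\<lambda>k. y_const z ^ k * uinv i ^ k)"

lemma
  assumes "mps_coeff z 0 = 0"
  shows u_recip_inverse: "(to_laurent (uvar i) - y_const z) * u_recip i z = 1"
    and u_recip_summable: "mps_summable (\<lambda>k. y_const z ^ k * uinv i ^ k)"
proof -
  \<comment> \<open>The geometric series converges in the y-variables: negative powers of u_i sit in
    the coefficients and are unbounded only as the degree in y grows.\<close>
  have "mps_coeff (y_const z * uinv i) 0 = 0"
    using assms by (simp add: mps_coeff_mult_zero y_const_def mls_eqI mls_coeff_monom mls_coeff_zero)
      (metis mls_coeff_monom mls_coeff_zero mls_eqI mult_zero_left)
  note g = mps_geometric[OF this]
  show "mps_summable (\<lambda>k. y_const z ^ k * uinv i ^ k)"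
    using g(1) by (simp add: power_mult_distrib)
  have "(to_laurent (uvar i) - y_const z) * uinv i = 1 - y_const z * uinv i"
    by (simp add: left_diff_distrib to_laurent_uvar_uinv)
  then show "(to_laurent (uvar i) - y_const z) * u_recip i z = 1"
    unfolding u_recip_def using g(2) by (simp add: power_mult_distrib flip: mult.assoc)
qed

text \<open>The element u_i - z becomes invertible after \<open>to_laurent\<close>, which is
  injective.\<close>

lemma uvar_minus_nonzerodivisor:
  assumes "mps_coeff z 0 = 0" "a * (uvar i - y_embed z) = 0"
  shows "a = 0"
proof -
  have "to_laurent a * ((to_laurent (uvar i) - y_const z) * u_recip i z) = 0"
    using arg_cong[OF assms(2), of to_laurent]
    by (simp add: to_laurent_mult to_laurent_diff to_laurent_y_embed flip: mult.assoc)
  then show ?thesis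
    using assms(1) to_laurent_inject[of a 0] by (simp add: u_recip_inverse)
qed

section \<open>Restrictions on the exponents of the u-variables\<close>

definition u_support :: "((nat \<Rightarrow>\<^sub>0 int) \<Rightarrow> bool) \<Rightarrow> laurent \<Rightarrow> bool" where
  "u_support P s \<longleftrightarrow> (\<forall>e m. uy_coeff s e m \<noteq> 0 \<longrightarrow> P m)"

lemma u_support_mult:
  assumes "u_support P s" "u_support Q t" "\<And>a b. P a \<Longrightarrow> Q b \<Longrightarrow> R (a + b)"
  shows "u_support R (s * t)"
  unfolding u_support_def
proof (intro allI impI)
  fix e m assume "uy_coeff (s * t) e m \<noteq> 0"
  then obtain p where "mls_convol (mls_coeff (mps_coeff s (fst p))) (mls_coeff (mps_coeff t (snd p))) m \<noteq> 0"
    unfolding uy_coeff_mult case_prod_unfold by (rule sum.not_neutral_contains_not_neutral)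
  then obtain r where "fst r + snd r = m" "uy_coeff s (fst p) (fst r) \<noteq> 0" "uy_coeff t (snd p) (snd r) \<noteq> 0"
    unfolding mls_convol_def case_prod_unfold by (rule sum.not_neutral_contains_not_neutral) auto
  then show "R m" using assms unfolding u_support_def by metis
qed

lemma u_support_mono: "u_support P s \<Longrightarrow> (\<And>m. P m \<Longrightarrow> Q m) \<Longrightarrow> u_support Q s"
  by (auto simp: u_support_def)

lemma u_support_one: "P 0 \<Longrightarrow> u_support P 1"
  by (auto simp: u_support_def mps_coeff_one mls_coeff_one mls_coeff_zero)

lemma u_support_prod:
  assumes "\<And>x. x \<in> A \<Longrightarrow> u_support P (s x)" "P 0" "\<And>a b. P a \<Longrightarrow> P b \<Longrightarrow> P (a + b)"
  shows "u_support P (\<Prod>x\<in>A. s x)"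
  using assms(1)
  by (induction A rule: infinite_finite_induct) (auto intro: u_support_one u_support_mult assms(2,3))

lemma u_support_mps_sum:
  assumes "mps_summable s" "\<And>i. u_support P (s i)"
  shows "u_support P (mps_sum s)"
  unfolding u_support_def
proof (intro allI impI)
  fix e m assume *: "uy_coeff (mps_sum s) e m \<noteq> 0"
  have "uy_coeff (mps_sum s) e m = (\<Sum>i | mps_coeff (s i) e \<noteq> 0. uy_coeff (s i) e m)"
    by (simp add: mps_coeff_mps_sum Sum_any.expand_set mls_coeff_sum)
  with * have "(\<Sum>i | mps_coeff (s i) e \<noteq> 0. uy_coeff (s i) e m) \<noteq> 0" by simp
  then obtain i where "uy_coeff (s i) e m \<noteq> 0"
    by (rule sum.not_neutral_contains_not_neutral)
  then show "P m" using assms(2) by (auto simp: u_support_def)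
qed

lemma u_support_to_laurent: "u_support (\<lambda>m. \<forall>i. 0 \<le> lookup m i) (to_laurent f)"
  by (auto simp: u_support_def uy_coeff_to_laurent split: if_splits)

lemma u_support_u_monom: "P a \<Longrightarrow> u_support P (u_monom a)"
  by (auto simp: u_support_def uy_coeff_u_monom split: if_splits)

lemma u_support_y_const: "P 0 \<Longrightarrow> u_support P (y_const f)"
  by (auto simp: u_support_def uy_coeff_y_const split: if_splits)

lemma u_support_power:
  assumes "u_support P s" "P 0" "\<And>a b. P a \<Longrightarrow> P b \<Longrightarrow> P (a + b)"
  shows "u_support P (s ^ k)"
  by (induction k) (auto intro: u_support_one u_support_mult assms)

lemma u_support_u_recip:
  assumes "mps_coeff z 0 = 0"
  shows "u_support (\<lambda>m. lookup m i < 0 \<and> (\<forall>j. j \<noteq> i \<longrightarrow> lookup m j = 0)) (u_recip i z)"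
  unfolding u_recip_def
proof (rule u_support_mult)
  let ?P = "\<lambda>m. lookup m i \<le> (0 :: int) \<and> (\<forall>j. j \<noteq> i \<longrightarrow> lookup m j = 0)"
  show "u_support ?P (mps_sum (\<lambda>k. y_const z ^ k * uinv i ^ k))"
    unfolding uinv_eq_u_monom
    by (intro u_support_mps_sum u_support_mult[of ?P _ ?P] u_support_power u_support_y_const u_support_u_monom)
       (use u_recip_summable[OF assms, of i] in \<open>auto simp: uinv_eq_u_monom lookup_add lookup_single when_def\<close>)
  show "u_support (\<lambda>m. lookup m i = - 1 \<and> (\<forall>j. j \<noteq> i \<longrightarrow> lookup m j = 0)) (uinv i)"
    unfolding uinv_eq_u_monom by (rule u_support_u_monom) (auto simp: lookup_single when_def)
qed (auto simp: lookup_add)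

lemma u_coeff_eq_0: "u_support P s \<Longrightarrow> \<not> P m \<Longrightarrow> u_coeff m s = 0"
  by (rule mps_eqI) (auto simp: u_support_def mps_coeff_u_coeff)


section \<open>Residues\<close>

text \<open>Both maps commute with the monomial expansion of \<open>f\<close> by continuity, so
  agreement on monomials spreads to all series.\<close>

lemma mps_linear_eq:
  fixes T T' :: "('v, 'a::comm_ring_1) mps \<Rightarrow> ('w, 'a) mps"
  assumes "\<And>e. finite (M e)" "\<And>f e. mps_coeff (T f) e = (\<Sum>m\<in>M e. mps_coeff f m * t m e)"
    and "\<And>e. finite (M' e)" "\<And>f e. mps_coeff (T' f) e = (\<Sum>m\<in>M' e. mps_coeff f m * t' m e)"
    and "\<And>c m. T (mps_const c * mps_monom m) = T' (mps_const c * mps_monom m)"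
  shows "T f = T' f"
proof -
  let ?F = "\<lambda>m. mps_const (mps_coeff f m) * mps_monom m"
  have "T (mps_sum ?F) = mps_sum (\<lambda>m. T (?F m))"
    using assms(1,2) mps_expansion(1) by (rule mps_sum_linear(2))
  moreover have "T' (mps_sum ?F) = mps_sum (\<lambda>m. T' (?F m))"
    using assms(3,4) mps_expansion(1) by (rule mps_sum_linear(2))
  ultimately show ?thesis using assms(5) by (simp flip: mps_expansion(2))
qed

section \<open>Iterated residues at simple poles\<close>

definition u_neg :: "nat set \<Rightarrow> (nat \<Rightarrow>\<^sub>0 int)" where
  "u_neg I = (\<Sum>i\<in>I. Poly_Mapping.single i (- 1))"

lemma lookup_u_neg: "finite I \<Longrightarrow> lookup (u_neg I) i = (if i \<in> I then - 1 else 0)"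
  by (simp add: u_neg_def lookup_sum lookup_single when_def)

text \<open>A variable u_i outside \<open>I\<close> goes to 0, since the coefficient at
  \<open>u_neg I\<close> has exponent 0 in it and no pole lowers its powers.\<close>

definition u_eval :: "nat set \<Rightarrow> (nat \<Rightarrow> yseries) \<Rightarrow> nat + nat \<Rightarrow> yseries" where
  "u_eval I z = case_sum (\<lambda>i. if i \<in> I then z i else 0) Y"

lemma mps_admissible_u_eval:
  assumes "finite I" "\<And>i. i \<in> I \<Longrightarrow> mps_coeff (z i) 0 = 0"
  shows "mps_admissible (u_eval I z)"
  unfolding mps_admissible_def mps_summable_def
proof (intro conjI allI)
  fix e :: "nat \<Rightarrow>\<^sub>0 nat"
  have "{v. mps_coeff (u_eval I z v) e \<noteq> 0} \<subseteq> Inl ` I \<union> Inr ` keys e"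
  proof
    fix v assume "v \<in> {v. mps_coeff (u_eval I z v) e \<noteq> 0}"
    then show "v \<in> Inl ` I \<union> Inr ` keys e"
      by (cases v) (auto simp: u_eval_def mps_coeff_var split: if_splits)
  qed
  then show "finite {v. mps_coeff (u_eval I z v) e \<noteq> 0}"
    by (rule finite_subset) (simp add: assms(1))
next
  fix v show "mps_coeff (u_eval I z v) 0 = 0"
    using assms(2) by (cases v) (auto simp: u_eval_def)
qed

context
  fixes I :: "nat set" and z :: "nat \<Rightarrow> yseries"
  assumes fin: "finite I" and z0: "\<And>i. i \<in> I \<Longrightarrow> mps_coeff (z i) 0 = 0"
begin

private definition R :: laurent where "R = (\<Prod>i\<in>I. u_recip i (z i))"

private definition \<Lambda> :: "uyseries \<Rightarrow> yseries" where
  "\<Lambda> f = u_coeff (u_neg I) (to_laurent f * R)"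

lemma u_support_prod_u_recip:
  assumes "J \<subseteq> I"
  shows "u_support (\<lambda>m. \<forall>i. i \<notin> J \<longrightarrow> lookup m i = 0) (\<Prod>i\<in>J. u_recip i (z i))"
proof (rule u_support_prod)
  fix i assume "i \<in> J"
  then show "u_support (\<lambda>m. \<forall>j. j \<notin> J \<longrightarrow> lookup m j = 0) (u_recip i (z i))"
    using assms by (intro u_support_mono[OF u_support_u_recip[OF z0]]) auto
qed (auto simp: lookup_add)

text \<open>In 1 / (u_i - z_i) only the leading term 1 / u_i has exponent -1; the rest of the
  geometric series is of lower order in u_i.\<close>

lemma u_coeff_prod_u_recip: "J \<subseteq> I \<Longrightarrow> u_coeff (u_neg J) (\<Prod>i\<in>J. u_recip i (z i)) = 1"
proof (induction J rule: infinite_finite_induct)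
  case (infinite J)
  then show ?case using fin finite_subset by blast
next
  case empty
  then show ?case using u_coeff_0_y_const[of 1] by (simp add: u_neg_def)
next
  case (insert i J)
  let ?P = "\<Prod>i\<in>J. u_recip i (z i)" and ?r = "u_recip i (z i)"
  have zi: "mps_coeff (z i) 0 = 0" using insert.prems by (intro z0) auto
  have "uinv i * ((to_laurent (uvar i) - y_const (z i)) * ?r) =
      to_laurent (uvar i) * uinv i * ?r - y_const (z i) * (uinv i * ?r)"
    by (simp only: left_diff_distrib right_diff_distrib mult_ac)
  then have "?r = uinv i * ((to_laurent (uvar i) - y_const (z i)) * ?r) + y_const (z i) * (uinv i * ?r)"
    unfolding to_laurent_uvar_uinv by simp
  then have "?r = uinv i + y_const (z i) * (uinv i * ?r)"
    unfolding u_recip_inverse[OF zi] mult_1_right .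
  \<comment> \<open>One step of the geometric series. After the shift by u_i its remainder would
    have to contribute at exponent 0 of u_i, where it has no term.\<close>
  from arg_cong[OF this, of "\<lambda>t. t * ?P"]
  have r_eq: "?r * ?P = uinv i * ?P + y_const (z i) * (uinv i * (?r * ?P))"
    unfolding distrib_right mult.assoc .
  have shift: "u_neg (insert i J) - Poly_Mapping.single i (- 1) = u_neg J"
    using insert.hyps by (simp add: u_neg_def)
  have "u_coeff (u_neg (insert i J)) (?r * ?P) = u_coeff (u_neg J) ?P + z i * u_coeff (u_neg J) (?r * ?P)"
    by (subst r_eq) (simp only: u_coeff_add u_coeff_y_const_mult uinv_eq_u_monom u_coeff_u_monom_mult shift)
  moreover have "u_coeff (u_neg J) (?r * ?P) = 0"
  proof (rule u_coeff_eq_0)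
    show "u_support (\<lambda>m. lookup m i < 0) (?r * ?P)"
      by (rule u_support_mult[OF u_support_u_recip[OF zi] u_support_prod_u_recip])
        (use insert in \<open>auto simp: lookup_add\<close>)
    show "\<not> lookup (u_neg J) i < 0" using insert.hyps by (simp add: lookup_u_neg)
  qed
  ultimately show ?case
    using insert by simp
qed

private lemma \<Lambda>_1: "\<Lambda> 1 = 1"
  using u_coeff_prod_u_recip[of I] by (simp add: \<Lambda>_def R_def)

private lemma \<Lambda>_y_embed: "\<Lambda> (y_embed c * f) = c * \<Lambda> f"
  by (simp add: \<Lambda>_def to_laurent_mult to_laurent_y_embed u_coeff_y_const_mult mult.assoc)

private lemma \<Lambda>_const: "\<Lambda> (mps_const c * f) = mps_const c * \<Lambda> f"
  using \<Lambda>_y_embed[of "mps_const c"] by (simp add: y_embed_def mps_admissible_yvar)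

private lemma u_support_R: "u_support (\<lambda>m. \<forall>i. i \<notin> I \<longrightarrow> lookup m i = 0) R"
  unfolding R_def by (rule u_support_prod_u_recip) simp

text \<open>For \<open>i\<close> in \<open>I\<close>, write u_i = (u_i - z_i) + z_i: the first part
  cancels the pole and leaves no negative power of u_i. For other \<open>i\<close>, the functional
  would need exponent -1 of u_i, which does not occur.\<close>

private lemma \<Lambda>_uvar: "\<Lambda> (uvar i * f) = u_eval I z (Inl i) * \<Lambda> f"
proof (cases "i \<in> I")
  case True
  let ?P = "\<Prod>i\<in>I - {i}. u_recip i (z i)" and ?r = "u_recip i (z i)"
  have R: "R = ?r * ?P" unfolding R_def by (rule prod.remove[OF fin True])
  have "to_laurent (uvar i) * ?r = (to_laurent (uvar i) - y_const (z i)) * ?r + y_const (z i) * ?r"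
    by (simp add: algebra_simps)
  then have r: "to_laurent (uvar i) * ?r = 1 + y_const (z i) * ?r"
    by (simp add: u_recip_inverse[OF z0[OF True]])
  have "to_laurent (uvar i * f) * R = to_laurent f * ?P * (to_laurent (uvar i) * ?r)"
    by (simp add: R to_laurent_mult mult_ac)
  also have "\<dots> = to_laurent f * ?P + y_const (z i) * (to_laurent f * R)"
    unfolding r R by (simp add: algebra_simps)
  finally have "\<Lambda> (uvar i * f) = u_coeff (u_neg I) (to_laurent f * ?P) + z i * \<Lambda> f"
    by (simp add: \<Lambda>_def u_coeff_add u_coeff_y_const_mult)
  moreover have "u_coeff (u_neg I) (to_laurent f * ?P) = 0"
  proof (rule u_coeff_eq_0)
    show "u_support (\<lambda>m. 0 \<le> lookup m i) (to_laurent f * ?P)"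
      by (rule u_support_mult[OF u_support_to_laurent u_support_prod_u_recip]) (auto simp: lookup_add)
    show "\<not> 0 \<le> lookup (u_neg I) i" using fin True by (simp add: lookup_u_neg)
  qed
  ultimately show ?thesis using True by (simp add: u_eval_def)
next
  case False
  have "\<Lambda> (uvar i * f) = u_coeff (u_neg I - Poly_Mapping.single i 1) (to_laurent f * R)"
    by (simp add: \<Lambda>_def to_laurent_mult to_laurent_uvar u_coeff_u_monom_mult mult.assoc)
  also have "\<dots> = 0"
  proof (rule u_coeff_eq_0)
    show "u_support (\<lambda>m. 0 \<le> lookup m i) (to_laurent f * R)"
      by (rule u_support_mult[OF u_support_to_laurent u_support_R]) (use False in \<open>auto simp: lookup_add\<close>)
    show "\<not> 0 \<le> lookup (u_neg I - Poly_Mapping.single i 1) i"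
      using fin False by (simp add: lookup_u_neg lookup_minus)
  qed
  finally show ?thesis using False by (simp add: u_eval_def)
qed

private lemma \<Lambda>_var: "\<Lambda> (mps_var v * f) = u_eval I z v * \<Lambda> f"
proof (cases v)
  case (Inl i)
  then show ?thesis by (simp add: \<Lambda>_uvar)
next
  case (Inr j)
  then show ?thesis
    using \<Lambda>_y_embed[of "Y j"] by (simp add: y_embed_def mps_admissible_yvar u_eval_def)
qed

private lemma \<Lambda>_monom: "\<Lambda> (mps_monom m) = mps_pow (u_eval I z) m"
proof (induction m rule: pm_nat_induct)
  case zero
  then show ?case by (simp add: \<Lambda>_1)
next
  case (add v m)
  then show ?case
    unfolding mps_pow_add mps_monom_add using \<Lambda>_var[of v] by (simp add: mps_var_eq_monom)
qed

text \<open>The exponents of u in the coefficient of \<open>R\<close> at each monomial in y are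
  bounded below, and only finitely many such monomials divide \<open>e\<close>. Hence finitely many
  coefficients of \<open>f\<close> enter.\<close>

private lemma \<Lambda>_linear:
  obtains M t where "\<And>e. finite (M e)" "\<And>f e. mps_coeff (\<Lambda> f) e = (\<Sum>x\<in>M e. mps_coeff f x * t x e)"
proof -
  have "\<forall>b. \<exists>c. mls_bound c (mls_coeff (mps_coeff R b))"
    by (meson mls_coeff_bounded)
  then obtain c where c: "\<And>b. mls_bound (c b) (mls_coeff (mps_coeff R b))" by metis
  let ?D = "\<lambda>e. SIGMA p:{(a, b). a + b = e}. mls_splittings 0 (c (snd p)) (u_neg I)"
  let ?j = "\<lambda>(p, r). join_exponent (fst r) (fst p)"
  define M where "M e = ?j ` ?D e" for e
  define t where "t x e = uy_coeff R (e - exponent_y x) (u_neg I - exponent_u x)" for x e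
  have fin: "finite (?D e)" for e
    by (intro finite_SigmaI finite_mps_splittings finite_mls_splittings)
  have eu: "exponent_u (join_exponent (fst r) a) = fst r" if "r \<in> mls_splittings 0 d m" for r d m a
    using that by (intro exponent_u_join) (auto simp: mls_splittings_def)
  have "mps_coeff (\<Lambda> f) e = (\<Sum>x\<in>M e. mps_coeff f x * t x e)" for f e
  proof -
    let ?T = "\<lambda>a. mls_coeff (mps_coeff (to_laurent f) a)"
    have "mps_coeff (\<Lambda> f) e = (\<Sum>p\<in>{(a, b). a + b = e}. \<Sum>r\<in>mls_splittings 0 (c (snd p)) (u_neg I).
        ?T (fst p) (fst r) * uy_coeff R (snd p) (snd r))"
      unfolding \<Lambda>_def mps_coeff_u_coeff uy_coeff_mult case_prod_unfold
      by (simp add: mls_convol_eq[OF to_laurent_coeff_bound c] case_prod_unfold)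
    also have "\<dots> = (\<Sum>(p, r)\<in>?D e. ?T (fst p) (fst r) * uy_coeff R (snd p) (snd r))"
      by (rule sum.Sigma) (auto simp: finite_mps_splittings finite_mls_splittings)
    also have "\<dots> = (\<Sum>q\<in>?D e. mps_coeff f (?j q) * t (?j q) e)"
    proof (rule sum.cong[OF refl])
      fix q assume q: "q \<in> ?D e"
      obtain p r where pr: "q = (p, r)" by (cases q)
      with q have p: "e - fst p = snd p" and r: "r \<in> mls_splittings 0 (c (snd p)) (u_neg I)"
        by auto
      then have "u_neg I - fst r = snd r" "\<forall>i. 0 \<le> lookup (fst r) i"
        by (auto simp: mls_splittings_def) (metis add_diff_cancel_left')
      then show "(case q of (p, r) \<Rightarrow> ?T (fst p) (fst r) * uy_coeff R (snd p) (snd r)) =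
          mps_coeff f (?j q) * t (?j q) e"
        using eu[OF r] p by (simp add: pr t_def uy_coeff_to_laurent)
    qed
    also have "\<dots> = (\<Sum>x\<in>M e. mps_coeff f x * t x e)"
      unfolding M_def
    proof (rule sum.reindex_cong[OF _ refl, symmetric])
      \<comment> \<open>Since \<open>fst r\<close> is nonnegative, the joined exponent determines
        \<open>fst r\<close> and \<open>fst p\<close>; the fixed totals \<open>u_neg I\<close> and
        \<open>e\<close> determine the other halves.\<close>
      show "inj_on ?j (?D e)"
      proof (rule inj_onI)
        fix q q' assume q: "q \<in> ?D e" "q' \<in> ?D e" "?j q = ?j q'"
        obtain p r p' r' where pr: "q = (p, r)" "q' = (p', r')" by (cases q; cases q')
        from q have r: "r \<in> mls_splittings 0 (c (snd p)) (u_neg I)" "r' \<in> mls_splittings 0 (c (snd p')) (u_neg I)"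
          by (auto simp: pr)
        have "fst r = fst r'" using eu[OF r(1)] eu[OF r(2)] q(3) by (metis pr case_prod_conv)
        moreover have "fst p = fst p'"
          using q(3) by (metis exponent_y_join pr case_prod_conv)
        moreover have "fst p + snd p = fst p' + snd p'" "fst r + snd r = fst r' + snd r'"
          using q(1,2) r by (auto simp: pr mls_splittings_def)
        ultimately show "q = q'"
          by (simp add: pr prod_eq_iff)
      qed
    qed auto
    finally show ?thesis .
  qed
  with fin that[of M t] show thesis by (auto simp: M_def)
qed

text \<open>Residues at simple poles: with \<open>u_recip\<close> standing for \<open>1 / (u\<^sub>i - z\<^sub>i)\<close>, the iterated
  residue of a power series is its value. Both sides are linear and continuous, so that it
  suffices to compare them on monomials.\<close>

lemma u_coeff_residue:
  "u_coeff (u_neg I) (to_laurent f * (\<Prod>i\<in>I. u_recip i (z i))) = mps_subst (u_eval I z) f"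
proof -
  note adm = mps_admissible_u_eval[OF fin z0]
  obtain M t where Mt: "\<And>e. finite (M e)" "\<And>f e. mps_coeff (\<Lambda> f) e = (\<Sum>x\<in>M e. mps_coeff f x * t x e)"
    by (rule \<Lambda>_linear) blast
  have "\<Lambda> f = mps_subst (u_eval I z) f"
  proof (rule mps_linear_eq[OF Mt _ mps_coeff_subst])
    show "finite {m. mps_coeff (mps_pow (u_eval I z) m) e \<noteq> 0}" for e
      using mps_summable_pow[OF adm] by (simp add: mps_summable_def)
    show "mps_admissible (u_eval I z)" by (rule adm)
    show "\<Lambda> (mps_const c * mps_monom m) = mps_subst (u_eval I z) (mps_const c * mps_monom m)" for c m
      using adm by (simp add: \<Lambda>_const \<Lambda>_monom)
  qed
  then show ?thesis by (simp add: \<Lambda>_def R_def)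
qed

end

text \<open>The power series quotient in the expansion convention is the slope of the formal group
  law; what is left is the expansion of an additive simple pole.\<close>

lemma recip_expansion_y_embed:
  assumes "mps_coeff z 0 = 0"
  shows "recip_expansion i (y_embed z) =
    to_laurent (addL_slope (y_embed z) (uvar i +\<^sub>L invL (y_embed z))) * u_recip i z"
proof -
  let ?z = "y_embed z"
  have z0: "mps_coeff ?z 0 = 0" using assms by (simp add: y_embed_def mps_admissible_yvar)
  have "mps_quot (uvar i - ?z) (uvar i +\<^sub>L invL ?z) = addL_slope ?z (uvar i +\<^sub>L invL ?z)"
  proof (rule mps_quotI)
    show eq: "addL_slope ?z (uvar i +\<^sub>L invL ?z) * (uvar i +\<^sub>L invL ?z) = uvar i - ?z"
      using diff_eq_mult_slope[of "uvar i" ?z] z0 by (simp add: mult.commute)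
    fix a assume "a * (uvar i +\<^sub>L invL ?z) = 0"
    then have "a * (uvar i - ?z) = 0"
      unfolding eq[symmetric] by (metis mult.left_commute mult_zero_right)
    then show "a = 0" using uvar_minus_nonzerodivisor[OF assms] by blast
  qed
  then show ?thesis
    by (simp add: recip_expansion_def u_recip_def to_laurent_y_embed mult_ac)
qed

text \<open>Lagrange interpolation of the constant polynomial 1 at the nodes z_k, multiplied by the
  product of all differences. In this form it makes sense in every commutative ring, also where the
  differences are not invertible.\<close>

lemma lagrange_interpolation_of_one:
  fixes z :: "'k \<Rightarrow> 'a::comm_ring_1"
  assumes "finite K" "K \<noteq> {}"
  shows "(\<Sum>k\<in>K. (\<Prod>k'\<in>K - {k}. \<Prod>l\<in>K - {k'}. z k' - z l) * (\<Prod>l\<in>K - {k}. u - z l)) =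
    (\<Prod>k\<in>K. \<Prod>l\<in>K - {k}. z k - z l)"
  using assms
proof (induction K arbitrary: u rule: finite_ne_induct)
  case (singleton x)
  then show ?case by simp
next
  case (insert x K)
  define D where "D = (\<Prod>k\<in>K. \<Prod>l\<in>K - {k}. z k - z l)"
  define C where "C k = (\<Prod>k'\<in>K - {k}. \<Prod>l\<in>K - {k'}. z k' - z l)" for k
  define E where "E = (\<Prod>k\<in>K. z k - z x)"
  define E' where "E' = (\<Prod>k\<in>K. z x - z k)"
  define Ek where "Ek k = (\<Prod>k'\<in>K - {k}. z k' - z x)" for k
  define W where "W = (\<Prod>k\<in>K. u - z k)"
  define Wk where "Wk k = (\<Prod>l\<in>K - {k}. u - z l)" for k
  have IH: "(\<Sum>k\<in>K. C k * (\<Prod>l\<in>K - {k}. v - z l)) = D" for v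
    using insert.IH[of v] by (simp add: C_def D_def)
  have inner: "(\<Prod>l\<in>insert x K - {k}. f l) = f x * (\<Prod>l\<in>K - {k}. f l)" if "k \<in> K" for k and f :: "'k \<Rightarrow> 'a"
  proof -
    have "insert x K - {k} = insert x (K - {k})" using that insert.hyps by auto
    then show ?thesis using insert.hyps by simp
  qed
  have outer: "insert x K - {x} = K" using insert.hyps by auto
  have E: "E = (z k - z x) * Ek k" and W: "W = (u - z k) * Wk k" and E': "E' = (z x - z k) * (\<Prod>l\<in>K - {k}. z x - z l)"
    if "k \<in> K" for k
    using that insert.hyps unfolding E_def Ek_def W_def Wk_def E'_def by (auto intro: prod.remove)
  have factor: "(\<Prod>k'\<in>A. \<Prod>l\<in>insert x K - {k'}. z k' - z l) = (\<Prod>k'\<in>A. z k' - z x) * (\<Prod>k'\<in>A. \<Prod>l\<in>K - {k'}. z k' - z l)"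
    if "A \<subseteq> K" for A
    unfolding prod.distrib[symmetric] using that by (intro prod.cong refl) (auto simp: inner)
  define A where "A k = (\<Prod>k'\<in>insert x K - {k}. \<Prod>l\<in>insert x K - {k'}. z k' - z l)" for k
  define B where "B k = (\<Prod>l\<in>insert x K - {k}. u - z l)" for k
  have RHS: "(\<Prod>k\<in>insert x K. \<Prod>l\<in>insert x K - {k}. z k - z l) = E' * E * D"
    using insert.hyps factor[of K] by (simp add: outer E'_def E_def D_def mult.assoc)
  have A: "A k = E' * Ek k * C k" and B: "B k = (u - z x) * Wk k" if "k \<in> K" for k
    using factor[of "K - {k}"] that insert.hyps
    by (simp_all add: A_def B_def inner outer E'_def Ek_def C_def Wk_def mult.assoc)
  have Ax: "A x = E * D" and Bx: "B x = W"
    using factor[of K] unfolding A_def B_def outer E_def D_def W_def by simp_all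
  \<comment> \<open>The term of the new node is split off; the sum over the old nodes will cancel
    it.\<close>
  have "(\<Sum>k\<in>insert x K. A k * B k) = E * D * W + (\<Sum>k\<in>K. E' * Ek k * C k * ((u - z x) * Wk k))"
    unfolding sum.insert[OF insert.hyps(1,3)] Ax Bx
    by (intro arg_cong2[where f = "(+)"] refl sum.cong) (simp add: A B)
  also have "(\<Sum>k\<in>K. E' * Ek k * C k * ((u - z x) * Wk k)) =
      (\<Sum>k\<in>K. E' * E * (C k * Wk k) - E * W * (C k * (\<Prod>l\<in>K - {k}. z x - z l)))"
  proof (rule sum.cong[OF refl])
    fix k assume k: "k \<in> K"
    let ?V = "\<Prod>l\<in>K - {k}. z x - z l"
    \<comment> \<open>The two products share the difference of \<open>z x\<close> and
      \<open>z k\<close> up to sign.\<close>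
    have EE: "E' * Ek k = - E * ?V" unfolding E[OF k] E'[OF k] by (simp add: algebra_simps)
    \<comment> \<open>Here u - z_x is written as (z_k - z_x) + (u - z_k), which completes
      \<open>E\<close> in the first summand and \<open>W\<close> in the second.\<close>
    have "E' * Ek k * (u - z x) * Wk k = E' * Wk k * ((z k - z x) * Ek k) + E' * Ek k * ((u - z k) * Wk k)"
      by (simp add: algebra_simps)
    also have "\<dots> = E' * E * Wk k - E * W * ?V"
      unfolding EE E[OF k, symmetric] W[OF k, symmetric] by (simp add: mult_ac)
    finally have eq: "E' * Ek k * (u - z x) * Wk k = E' * E * Wk k - E * W * ?V" .
    have "E' * Ek k * C k * ((u - z x) * Wk k) = (E' * Ek k * (u - z x) * Wk k) * C k"
      by (simp only: mult_ac)
    then show "E' * Ek k * C k * ((u - z x) * Wk k) = E' * E * (C k * Wk k) - E * W * (C k * ?V)"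
      unfolding eq by (simp only: left_diff_distrib right_diff_distrib mult_ac)
  qed
  also have "\<dots> = E' * E * D - E * W * D"
    \<comment> \<open>The hypothesis at the point \<open>z x\<close> evaluates the second sum, which
      is why the induction keeps \<open>u\<close> arbitrary.\<close>
    using IH[of u] IH[of "z x"] by (simp add: sum_subtractf Wk_def flip: sum_distrib_left)
  finally show ?case by (simp add: RHS A_def B_def algebra_simps)
qed


section \<open>The Chern roots\<close>

definition chern_root :: "nat \<times> bool \<Rightarrow> yseries" where
  "chern_root k = sgnY (snd k) (fst k)"

text \<open>The 2n indices of the roots: products and sums run over these indices, not over the set
  of their values.\<close>

definition chern_roots :: "nat \<Rightarrow> (nat \<times> bool) set" where
  "chern_roots n = {1..n} \<times> UNIV"

lemma finite_roots [simp]: "finite (chern_roots n)"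
  by (simp add: chern_roots_def)

lemma sgnY_coeff_0 [simp]: "mps_coeff (sgnY s i) 0 = 0"
  by (simp add: sgnY_def)

lemma root_coeff_0 [simp]: "mps_coeff (chern_root k) 0 = 0"
  by (simp add: chern_root_def)

lemma invL_sgnY: "invL (sgnY s i) = sgnY (\<not> s) i"
  by (simp add: sgnY_def invL_invL)

lemma invL_chern_root: "invL (chern_root k) = chern_root (fst k, \<not> snd k)"
  by (simp add: chern_root_def invL_sgnY)

lemma schur_denoms_two: "twoL (chern_root k) \<in> schur_denoms"
  using schur_denoms.two[OF schur_denoms.one] by (simp add: chern_root_def)

lemma schur_denoms_add: "fst k \<noteq> fst l \<Longrightarrow> chern_root k +\<^sub>L chern_root l \<in> schur_denoms"
  using schur_denoms.add[OF schur_denoms.one] by (simp add: chern_root_def)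

lemma schur_denoms_prod: "(\<And>x. x \<in> A \<Longrightarrow> f x \<in> schur_denoms) \<Longrightarrow> (\<Prod>x\<in>A. f x) \<in> schur_denoms"
  by (induction A rule: infinite_finite_induct) (auto intro: schur_denoms.one schur_denoms_mult)

text \<open>Two distinct roots in the same variable are inverse to each other, and their formal
  difference is then [2] of the first. Roots in different variables give a generator of the second
  kind.\<close>

lemma schur_denoms_diff:
  assumes "k \<noteq> l"
  shows "chern_root k +\<^sub>L invL (chern_root l) \<in> schur_denoms"
proof (cases "fst k = fst l")
  case True
  with assms have "(fst l, \<not> snd l) = k" by (cases k; cases l) auto
  then show ?thesis using schur_denoms_two[of k] by (simp add: invL_chern_root twoL_def)
next
  case False
  then show ?thesis by (simp add: invL_chern_root schur_denoms_add)
qed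

section \<open>Clearing denominators in the localisation\<close>

lemma yfrac_embed_alt: "yfrac_embed f = abs_yfrac (f, 1)"
  by (simp add: yfrac_embed_def yfrac_of_def schur_denoms.one)

lemma yfrac_embed_mult: "yfrac_embed (f * g) = yfrac_embed f * yfrac_embed g"
  by (simp add: yfrac_embed_alt abs_yfrac_mult schur_denoms.one)

lemma yfrac_embed_add: "yfrac_embed (f + g) = yfrac_embed f + yfrac_embed g"
  by (simp add: yfrac_embed_alt abs_yfrac_add schur_denoms.one)

lemma yfrac_embed_zero [simp]: "yfrac_embed 0 = 0"
  by (simp add: yfrac_embed_alt zero_yfrac_def)

lemma yfrac_embed_sum: "yfrac_embed (sum f A) = (\<Sum>x\<in>A. yfrac_embed (f x))"
  by (induction A rule: infinite_finite_induct) (auto simp: yfrac_embed_add)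

lemma yfrac_embed_of:
  assumes "g \<in> schur_denoms" "a * f = b * g"
  shows "yfrac_embed a * yfrac_of f g = yfrac_embed b"
  unfolding yfrac_embed_alt yfrac_of_def using assms
  by (simp add: abs_yfrac_mult schur_denoms.one) (rule abs_yfrac_eqI, auto simp: schur_denoms.one)

text \<open>A divisor \<open>f\<close> of a denominator is invertible in the localisation, with
  inverse v / (f v).\<close>

lemma yfrac_embed_cancel:
  assumes "f * v \<in> schur_denoms" "yfrac_embed f * x = yfrac_embed f * y"
  shows "x = y"
proof -
  have "yfrac_embed f * yfrac_of v (f * v) = yfrac_embed 1"
    by (rule yfrac_embed_of) (use assms(1) in auto)
  moreover have "yfrac_embed 1 = 1" by (simp add: yfrac_embed_alt one_yfrac_def)
  ultimately have "yfrac_of v (f * v) * (yfrac_embed f * t) = t" for t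
    by (metis mult.assoc mult.commute mult_1)
  then show ?thesis using assms(2) by metis
qed

section \<open>The discriminant of the roots\<close>

definition root_disc :: "nat \<Rightarrow> yseries" where
  "root_disc n = (\<Prod>k\<in>chern_roots n. \<Prod>l\<in>chern_roots n - {k}. chern_root k - chern_root l)"

text \<open>The discriminant with the factors z_k - z_l of one fixed k left out: the coefficient of
  1 / (u - z_k) in the cleared partial fractions.\<close>

definition root_cofactor :: "nat \<Rightarrow> nat \<times> bool \<Rightarrow> yseries" where
  "root_cofactor n k = (\<Prod>k'\<in>chern_roots n - {k}. \<Prod>l\<in>chern_roots n - {k'}. chern_root k' - chern_root l)"

definition root_denom :: "nat \<Rightarrow> nat \<times> bool \<Rightarrow> yseries" where
  "root_denom n k = (\<Prod>l\<in>chern_roots n - {k}. chern_root k +\<^sub>L invL (chern_root l))"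

definition root_slope :: "nat \<times> bool \<Rightarrow> nat \<times> bool \<Rightarrow> yseries" where
  "root_slope k l = addL_slope (chern_root l) (chern_root k +\<^sub>L invL (chern_root l))"

text \<open>The quotient of the discriminant by \<open>root_denom n k\<close>: the slopes convert
  the additive differences z_k - z_l into formal ones.\<close>

definition root_numer :: "nat \<Rightarrow> nat \<times> bool \<Rightarrow> yseries" where
  "root_numer n k = root_cofactor n k * (\<Prod>l\<in>chern_roots n - {k}. root_slope k l)"

lemma root_diff: "chern_root k - chern_root l = (chern_root k +\<^sub>L invL (chern_root l)) * root_slope k l"
  unfolding root_slope_def by (rule diff_eq_mult_slope) auto

lemma root_slope_unit: "root_slope k l dvd 1"
  unfolding root_slope_def by (intro mps_unit addL_slope_coeff_0) simp

lemma root_disc_eq: "k \<in> chern_roots n \<Longrightarrow> root_disc n = root_numer n k * root_denom n k"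
  unfolding root_disc_def root_numer_def root_denom_def root_cofactor_def
  by (subst prod.remove[of _ k]) (auto simp: root_diff prod.distrib mult_ac)

lemma prod_unit: "(\<And>x. x \<in> A \<Longrightarrow> f x dvd 1) \<Longrightarrow> (\<Prod>x\<in>A. f x) dvd (1 :: 'a::comm_semiring_1)"
proof (induction A rule: infinite_finite_induct)
  case (insert x A)
  then show ?case using mult_dvd_mono[of "f x" 1 "prod f A" 1] by simp
qed auto

lemma root_disc_power_schur_denom: "\<exists>v. root_disc n ^ q * v \<in> schur_denoms"
proof -
  have "(\<Prod>k\<in>chern_roots n. \<Prod>l\<in>chern_roots n - {k}. root_slope k l) dvd 1" (is "?s dvd 1")
    by (intro prod_unit root_slope_unit)
  then obtain v where v: "1 = ?s * v" by (rule dvdE)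
  have "root_disc n = (\<Prod>k\<in>chern_roots n. root_denom n k) * ?s"
    unfolding root_disc_def root_denom_def by (simp add: root_diff prod.distrib)
  then have "root_disc n * v = (\<Prod>k\<in>chern_roots n. root_denom n k)" by (simp add: mult.assoc flip: v)
  also have "\<dots> \<in> schur_denoms"
    unfolding root_denom_def by (intro schur_denoms_prod schur_denoms_diff) auto
  finally have "root_disc n * v \<in> schur_denoms" .
  then have "(\<Prod>i\<in>{..<q}. root_disc n * v) \<in> schur_denoms" by (intro schur_denoms_prod)
  then show ?thesis by (auto simp: power_mult_distrib)
qed

lemma u_recip_partial_fractions:
  assumes "n > 0"
  shows "y_const (root_disc n) * (\<Prod>k\<in>chern_roots n. u_recip i (chern_root k)) =
    (\<Sum>k\<in>chern_roots n. y_const (root_cofactor n k) * u_recip i (chern_root k))"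
proof -
  let ?u = "to_laurent (uvar i)" and ?z = "\<lambda>k. y_const (chern_root k)"
  let ?R = "\<Prod>k\<in>chern_roots n. u_recip i (chern_root k)"
  \<comment> \<open>Without nodes the interpolation sum would be 0 and the discriminant 1, hence the
    assumption on \<open>n\<close>.\<close>
  have "chern_roots n \<noteq> {}" using assms by (auto simp: chern_roots_def)
  from lagrange_interpolation_of_one[OF finite_roots this, of ?z ?u]
  have "y_const (root_disc n) =
      (\<Sum>k\<in>chern_roots n. y_const (root_cofactor n k) * (\<Prod>l\<in>chern_roots n - {k}. ?u - ?z l))"
    by (simp add: root_disc_def root_cofactor_def y_const_prod y_const_diff)
  then have "y_const (root_disc n) * ?R =
      (\<Sum>k\<in>chern_roots n. y_const (root_cofactor n k) * ((\<Prod>l\<in>chern_roots n - {k}. ?u - ?z l) * ?R))"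
    by (simp add: sum_distrib_right mult.assoc)
  also have "\<dots> = (\<Sum>k\<in>chern_roots n. y_const (root_cofactor n k) * u_recip i (chern_root k))"
  proof (rule sum.cong[OF refl])
    fix k assume "k \<in> chern_roots n"
    then have R: "?R = u_recip i (chern_root k) * (\<Prod>l\<in>chern_roots n - {k}. u_recip i (chern_root l))"
      by (intro prod.remove) auto
    have "(\<Prod>l\<in>chern_roots n - {k}. ?u - ?z l) * (\<Prod>l\<in>chern_roots n - {k}. u_recip i (chern_root l)) = 1"
      unfolding prod.distrib[symmetric] by (rule prod.neutral) (simp add: u_recip_inverse)
    then have "(\<Prod>l\<in>chern_roots n - {k}. ?u - ?z l) * ?R = u_recip i (chern_root k)"
      unfolding R mult.left_commute[of _ "u_recip i (chern_root k)"] by simp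
    then show "y_const (root_cofactor n k) * ((\<Prod>l\<in>chern_roots n - {k}. ?u - ?z l) * ?R) =
        y_const (root_cofactor n k) * u_recip i (chern_root k)" by simp
  qed
  finally show ?thesis .
qed

text \<open>Multiplying out the partial fractions of all variables yields one simple pole in each
  variable for every tuple \<kappa> of roots. The alternative \<open>I = {}\<close> admits the empty
  partition with n = 0.\<close>

lemma u_coeff_residues:
  assumes "finite I" "n > 0 \<or> I = {}"
  shows "root_disc n ^ card I *
      u_coeff (u_neg I) (to_laurent f * (\<Prod>i\<in>I. \<Prod>k\<in>chern_roots n. u_recip i (chern_root k))) =
    (\<Sum>\<kappa>\<in>I \<rightarrow>\<^sub>E chern_roots n. (\<Prod>i\<in>I. root_cofactor n (\<kappa> i)) * mps_subst (u_eval I (chern_root \<circ> \<kappa>)) f)"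
proof -
  let ?R = "\<Prod>i\<in>I. \<Prod>k\<in>chern_roots n. u_recip i (chern_root k)"
  have "y_const (root_disc n ^ card I) * ?R =
      (\<Prod>i\<in>I. y_const (root_disc n) * (\<Prod>k\<in>chern_roots n. u_recip i (chern_root k)))"
    using y_const_prod[of "\<lambda>_. root_disc n" I] by (simp add: prod.distrib)
  also have "\<dots> = (\<Prod>i\<in>I. \<Sum>k\<in>chern_roots n. y_const (root_cofactor n k) * u_recip i (chern_root k))"
    using assms(2) by (auto simp: u_recip_partial_fractions)
  also have "\<dots> = (\<Sum>\<kappa>\<in>I \<rightarrow>\<^sub>E chern_roots n. \<Prod>i\<in>I. y_const (root_cofactor n (\<kappa> i)) * u_recip i (chern_root (\<kappa> i)))"
    using assms(1) by (intro prod_sum_PiE) auto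
  finally have R: "y_const (root_disc n ^ card I) * ?R = \<dots>" .
  have "root_disc n ^ card I * u_coeff (u_neg I) (to_laurent f * ?R) =
      u_coeff (u_neg I) (to_laurent f * (y_const (root_disc n ^ card I) * ?R))"
    by (simp add: mult.left_commute flip: u_coeff_y_const_mult)
  also have "\<dots> = (\<Sum>\<kappa>\<in>I \<rightarrow>\<^sub>E chern_roots n. u_coeff (u_neg I)
      (y_const (\<Prod>i\<in>I. root_cofactor n (\<kappa> i)) * (to_laurent f * (\<Prod>i\<in>I. u_recip i ((chern_root \<circ> \<kappa>) i)))))"
    unfolding R by (simp add: sum_distrib_left u_coeff_sum prod.distrib y_const_prod mult.left_commute)
  also have "\<dots> = (\<Sum>\<kappa>\<in>I \<rightarrow>\<^sub>E chern_roots n. (\<Prod>i\<in>I. root_cofactor n (\<kappa> i)) * mps_subst (u_eval I (chern_root \<circ> \<kappa>)) f)"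
    unfolding u_coeff_y_const_mult by (subst u_coeff_residue) (use assms(1) in auto)
  finally show ?thesis .
qed

lemma y_embed_coeff_0: "mps_coeff f 0 = 0 \<Longrightarrow> mps_coeff (y_embed f) 0 = 0"
  by (simp add: y_embed_def mps_admissible_yvar)

lemma y_embed_chern_root: "y_embed (chern_root (j, s)) = (if s then invL (yvar j) else yvar j)"
  by (simp add: chern_root_def sgnY_def y_embed_def mps_admissible_yvar mps_subst_invL)

section \<open>The generating function as a power series times simple poles\<close>

definition PL_recip :: "nat \<Rightarrow> uyseries" where
  "PL_recip i = mps_quot 1 (PL (uvar i))"

lemma PL_recip: "PL_recip i * PL (uvar i) = 1"
proof -
  have "PL (uvar i :: uyseries) dvd 1" by (intro mps_unit PL_coeff_0) simp
  then obtain h where h: "1 = PL (uvar i :: uyseries) * h" by (rule dvdE)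
  have "mps_quot 1 (PL (uvar i)) = h"
  proof (rule mps_quotI)
    fix a assume "a * PL (uvar i :: uyseries) = 0"
    then have "a * (PL (uvar i) * h) = 0" by (simp flip: mult.assoc)
    then show "a = 0" by (simp flip: h)
  qed (simp add: h mult.commute)
  then show ?thesis by (simp add: PL_recip_def h mult.commute)
qed

definition gen_slope :: "nat \<Rightarrow> nat \<times> bool \<Rightarrow> uyseries" where
  "gen_slope i k = addL_slope (y_embed (chern_root k)) (uvar i +\<^sub>L invL (y_embed (chern_root k)))"

lemma prod_chern_roots: "(\<Prod>k\<in>chern_roots n. f k) = (\<Prod>j=1..n. f (j, True) * f (j, False))"
proof -
  have "(\<Prod>k\<in>chern_roots n. f k) = (\<Prod>j=1..n. \<Prod>s\<in>UNIV. f (j, s))"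
    by (simp add: chern_roots_def prod.cartesian_product case_prod_unfold)
  then show ?thesis by (simp add: UNIV_bool mult.commute)
qed

lemma gen_one_eq:
  "gen_one n i = to_laurent (PL_recip i * uvar i ^ (2 * n) * (\<Prod>k\<in>chern_roots n. gen_slope i k)) *
     (\<Prod>k\<in>chern_roots n. u_recip i (chern_root k))"
proof -
  have "(\<Prod>j=1..n. recip_expansion i (invL (yvar j)) * recip_expansion i (yvar j)) =
      (\<Prod>k\<in>chern_roots n. recip_expansion i (y_embed (chern_root k)))"
    unfolding prod_chern_roots by (simp add: y_embed_chern_root)
  also have "\<dots> = (\<Prod>k\<in>chern_roots n. to_laurent (gen_slope i k)) * (\<Prod>k\<in>chern_roots n. u_recip i (chern_root k))"
    by (simp add: recip_expansion_y_embed gen_slope_def prod.distrib)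
  finally show ?thesis
    by (simp add: gen_one_def PL_recip_def to_laurent_mult to_laurent_power to_laurent_prod mult.assoc)
qed


section \<open>The quadratic Schur function\<close>

lemma prod_triangle_swap:
  fixes g :: "nat \<Rightarrow> nat \<Rightarrow> 'a::comm_monoid_mult"
  shows "(\<Prod>i=1..q. \<Prod>j=i+1..q. g i j) = (\<Prod>j=1..q. \<Prod>i=1..<j. g i j)"
proof -
  have "(\<Prod>i=1..q. \<Prod>j=i+1..q. g i j) = (\<Prod>(i, j)\<in>(SIGMA i:{1..q}. {i+1..q}). g i j)"
    by (rule prod.Sigma) auto
  also have "\<dots> = (\<Prod>(j, i)\<in>(SIGMA j:{1..q}. {1..<j}). g i j)"
    by (rule prod.reindex_bij_witness[where i = "\<lambda>(i, j). (j, i)" and j = "\<lambda>(i, j). (j, i)"]) auto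
  also have "\<dots> = (\<Prod>j=1..q. \<Prod>i=1..<j. g i j)"
    by (rule prod.Sigma[symmetric]) auto
  finally show ?thesis .
qed

lemma u_monom_sum: "u_monom (\<Sum>x\<in>A. a x) = (\<Prod>x\<in>A. u_monom (a x))"
  by (induction A rule: infinite_finite_induct) (auto simp: u_monom_add)

lemma u_monom_single: "u_monom (Poly_Mapping.single i (int k)) = to_laurent (uvar i) ^ k"
proof (induction k)
  case (Suc k)
  have "Poly_Mapping.single i (int (Suc k)) = Poly_Mapping.single i 1 + Poly_Mapping.single i (int k)"
    by (simp flip: single_add)
  then show ?case by (simp only: u_monom_add Suc to_laurent_uvar power_Suc)
qed simp

lemma uvar_power_uinv_power: "to_laurent (uvar i) ^ (a + b) * uinv i ^ b = to_laurent (uvar i) ^ a"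
proof -
  have "to_laurent (uvar i) ^ b * uinv i ^ b = 1"
    by (simp add: to_laurent_uvar_uinv flip: power_mult_distrib)
  then show ?thesis by (simp add: power_add mult.assoc)
qed

text \<open>For 1 \<le> i \<le> n the subtraction of natural numbers is not truncated.\<close>

definition numer_exponent :: "nat \<Rightarrow> nat list \<Rightarrow> nat \<Rightarrow> nat" where
  "numer_exponent n lam i = lam ! (i - 1) + 2 * n - 2 * i + 1"

text \<open>The power series whose values at tuples of roots are taken. It has absorbed the monomial
  that moves the coefficient to exponent -1 and all divisions by the u_j.\<close>

definition gen_poly :: "nat \<Rightarrow> nat list \<Rightarrow> uyseries" where
  "gen_poly n lam = (\<Prod>i=1..length lam.
       PL_recip i * uvar i ^ numer_exponent n lam i * (\<Prod>k\<in>chern_roots n. gen_slope i k)) *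
     (\<Prod>i=1..length lam. \<Prod>j=i+1..length lam. (uvar j +\<^sub>L invL (uvar i)) * (uvar j +\<^sub>L uvar i))"

lemma u_coeff_gen_series:
  assumes lam: "is_partition lam" and n: "length lam \<le> n"
  shows "u_coeff (neg_exponent lam) (gen_series n (length lam)) =
    u_coeff (u_neg {1..length lam})
      (to_laurent (gen_poly n lam) * (\<Prod>i=1..length lam. \<Prod>k\<in>chern_roots n. u_recip i (chern_root k)))"
proof -
  let ?q = "length lam"
  let ?U = "\<lambda>i. to_laurent (uvar i)"
  define A :: "nat \<Rightarrow> nat \<Rightarrow> uyseries"
    where "A i j = (uvar j +\<^sub>L invL (uvar i)) * (uvar j +\<^sub>L uvar i)" for i j
  \<comment> \<open>The parts of the partition are positive, so lambda_i - 1 is a nonnegative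
    shift.\<close>
  define a where "a = (\<Sum>i=1..?q. Poly_Mapping.single i (int (lam ! (i - 1) - 1)))"
  have pos: "lam ! (i - 1) > 0" if "i \<in> {1..?q}" for i
    using that lam by (auto simp: is_partition_def)
  have neg: "neg_exponent lam = u_neg {1..?q} - a"
    unfolding neg_exponent_def u_neg_def a_def sum_subtractf[symmetric]
  proof (rule sum.cong[OF refl])
    fix i assume "i \<in> {1..?q}"
    then show "Poly_Mapping.single i (- int (lam ! (i - 1))) =
        Poly_Mapping.single i (- 1) - Poly_Mapping.single i (int (lam ! (i - 1) - 1))"
      using pos[of i] by (simp add: int_ops(6) flip: single_diff)
  qed
  define S where "S i = (\<Prod>k\<in>chern_roots n. gen_slope i k)" for i
  define R where "R i = (\<Prod>k\<in>chern_roots n. u_recip i (chern_root k))" for i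
  have "(\<Prod>i=1..?q. \<Prod>j=i+1..?q.
        (to_laurent (uvar j +\<^sub>L invL (uvar i)) * uinv j) * (to_laurent (uvar j +\<^sub>L uvar i) * uinv j)) =
      (\<Prod>i=1..?q. \<Prod>j=i+1..?q. to_laurent (A i j) * uinv j ^ 2)"
    by (simp add: A_def to_laurent_mult power2_eq_square mult_ac)
  also have "\<dots> = to_laurent (\<Prod>i=1..?q. \<Prod>j=i+1..?q. A i j) * (\<Prod>i=1..?q. \<Prod>j=i+1..?q. uinv j ^ 2)"
    by (simp only: prod.distrib to_laurent_prod)
  \<comment> \<open>For each j there are j - 1 smaller indices i, each with two divisions by
    u_j.\<close>
  also have "(\<Prod>i=1..?q. \<Prod>j=i+1..?q. uinv j ^ 2) = (\<Prod>j=1..?q. uinv j ^ (2 * (j - 1)))"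
    unfolding prod_triangle_swap by (simp add: power_mult)
  finally have cross: "(\<Prod>i=1..?q. \<Prod>j=i+1..?q.
        (to_laurent (uvar j +\<^sub>L invL (uvar i)) * uinv j) * (to_laurent (uvar j +\<^sub>L uvar i) * uinv j)) =
      to_laurent (\<Prod>i=1..?q. \<Prod>j=i+1..?q. A i j) * (\<Prod>j=1..?q. uinv j ^ (2 * (j - 1)))" .
  have single: "?U i ^ (lam ! (i - 1) - 1) * gen_one n i * uinv i ^ (2 * (i - 1)) =
      to_laurent (PL_recip i * uvar i ^ numer_exponent n lam i * S i) * R i" if i: "i \<in> {1..?q}" for i
  proof -
    have e: "(lam ! (i - 1) - 1) + 2 * n = numer_exponent n lam i + 2 * (i - 1)"
      using pos[OF i] i n by (auto simp: numer_exponent_def)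
    have "?U i ^ (lam ! (i - 1) - 1) * gen_one n i * uinv i ^ (2 * (i - 1)) =
        to_laurent (PL_recip i * S i) * R i * (?U i ^ ((lam ! (i - 1) - 1) + 2 * n) * uinv i ^ (2 * (i - 1)))"
      by (simp only: gen_one_eq to_laurent_mult to_laurent_power power_add S_def R_def mult_ac)
    also have "\<dots> = to_laurent (PL_recip i * uvar i ^ numer_exponent n lam i * S i) * R i"
      unfolding e uvar_power_uinv_power by (simp only: to_laurent_mult to_laurent_power mult_ac)
    finally show ?thesis .
  qed
  have "u_monom a * gen_series n ?q =
      (\<Prod>i=1..?q. ?U i ^ (lam ! (i - 1) - 1) * gen_one n i * uinv i ^ (2 * (i - 1))) *
      to_laurent (\<Prod>i=1..?q. \<Prod>j=i+1..?q. A i j)"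
    unfolding gen_series_def cross a_def u_monom_sum u_monom_single by (simp only: prod.distrib mult_ac)
  also have "\<dots> = (\<Prod>i=1..?q. to_laurent (PL_recip i * uvar i ^ numer_exponent n lam i * S i) * R i) *
      to_laurent (\<Prod>i=1..?q. \<Prod>j=i+1..?q. A i j)"
    by (intro arg_cong2[where f = "(*)"] refl prod.cong single)
  also have "\<dots> = to_laurent (gen_poly n lam) * (\<Prod>i=1..?q. R i)"
    unfolding gen_poly_def A_def[symmetric] S_def[symmetric]
    by (simp only: prod.distrib to_laurent_mult to_laurent_prod mult_ac)
  finally show ?thesis
    unfolding neg R_def[symmetric] u_coeff_u_monom_mult[symmetric] by simp
qed

section \<open>Denominators grouped by variable\<close>

definition pair_factor :: "nat \<times> bool \<Rightarrow> nat \<Rightarrow> yseries" where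
  "pair_factor k m = (chern_root k +\<^sub>L Y m) * (chern_root k +\<^sub>L invL (Y m))"

text \<open>Inverting y_m exchanges the two factors, so only the variable of the second root matters
  and not its sign.\<close>

lemma pair_factor_chern_root:
  "(chern_root k +\<^sub>L chern_root l) * (chern_root k +\<^sub>L invL (chern_root l)) = pair_factor k (fst l)"
  unfolding invL_chern_root pair_factor_def
  by (cases l) (auto simp: chern_root_def sgnY_def mult.commute)

lemma pair_factor_self: "pair_factor k (fst k) = 0"
  unfolding pair_factor_chern_root[symmetric] by (simp add: addL_invL)

lemma pair_factor_schur_denoms:
  assumes "fst k \<noteq> m"
  shows "pair_factor k m \<in> schur_denoms"
  using assms unfolding pair_factor_chern_root[of k "(m, False)", simplified, symmetric] invL_chern_root
  by (intro schur_denoms_mult schur_denoms_add) auto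

text \<open>Of the other 2n - 1 roots, the inverse of the k-th one gives [2]; the remaining ones are
  paired by variable.\<close>

lemma root_denom_eq:
  assumes "k \<in> chern_roots n"
  shows "root_denom n k = twoL (chern_root k) * (\<Prod>m\<in>{1..n} - {fst k}. pair_factor k m)"
proof -
  let ?f = "\<lambda>l. chern_root k +\<^sub>L invL (chern_root l)"
  let ?M = "{1..n} - {fst k}"
  have "chern_roots n - {k} = insert (fst k, \<not> snd k) (?M \<times> UNIV)"
    using assms by (cases k) (auto simp: chern_roots_def)
  then have "root_denom n k = ?f (fst k, \<not> snd k) * (\<Prod>l\<in>?M \<times> UNIV. ?f l)"
    unfolding root_denom_def by simp
  also have "?f (fst k, \<not> snd k) = twoL (chern_root k)"
    by (simp add: invL_chern_root twoL_def)
  also have "(\<Prod>l\<in>?M \<times> UNIV. ?f l) = (\<Prod>m\<in>?M. \<Prod>s\<in>UNIV. ?f (m, s))"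
    by (simp add: prod.cartesian_product case_prod_unfold)
  also have "\<dots> = (\<Prod>m\<in>?M. pair_factor k m)"
    by (rule prod.cong[OF refl])
      (simp add: UNIV_bool pair_factor_chern_root[of k "(_, False)", simplified, symmetric] invL_chern_root mult.commute)
  finally show ?thesis .
qed

definition residue_term :: "nat \<Rightarrow> nat list \<Rightarrow> (nat \<Rightarrow> nat \<times> bool) \<Rightarrow> yseries" where
  "residue_term n lam \<kappa> =
     (\<Prod>i=1..length lam. root_numer n (\<kappa> i) * chern_root (\<kappa> i) ^ numer_exponent n lam i) *
     (\<Prod>i=1..length lam. \<Prod>j=i+1..length lam. pair_factor (\<kappa> j) (fst (\<kappa> i)))"

lemma eval_gen_poly:
  assumes "\<kappa> \<in> {1..length lam} \<rightarrow>\<^sub>E chern_roots n"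
  shows "(\<Prod>i=1..length lam. root_cofactor n (\<kappa> i)) *
      mps_subst (u_eval {1..length lam} (chern_root \<circ> \<kappa>)) (gen_poly n lam) = residue_term n lam \<kappa>"
proof -
  let ?q = "length lam"
  define e where "e = u_eval {1..?q} (chern_root \<circ> \<kappa>)"
  have adm: "mps_admissible e" unfolding e_def by (rule mps_admissible_u_eval) auto
  have e_u: "e (Inl i) = chern_root (\<kappa> i)" if "i \<in> {1..?q}" for i
    using that by (simp add: e_def u_eval_def)
  have e_root: "mps_subst e (y_embed (chern_root k)) = chern_root k" for k
  proof (cases k)
    case (Pair j s)
    have "mps_subst e (yvar j) = Y j" using adm by (simp add: e_def u_eval_def)
    then show ?thesis
      by (simp add: Pair y_embed_chern_root mps_subst_invL[OF adm]) (simp add: chern_root_def sgnY_def)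
  qed
  have slope: "mps_subst e (gen_slope i k) = root_slope (\<kappa> i) k" if "i \<in> {1..?q}" for i k
    using that adm unfolding gen_slope_def root_slope_def
    by (simp add: mps_subst_slope mps_subst_addL mps_subst_invL y_embed_coeff_0 e_root e_u)
  \<comment> \<open>At u_i = z_i the formal difference vanishes, so this slope is \<open>PL\<close>
    of the root and meets its reciprocal.\<close>
  have PL: "mps_subst e (PL_recip i) * root_slope (\<kappa> i) (\<kappa> i) = 1" if "i \<in> {1..?q}" for i
  proof -
    have "mps_subst e (PL_recip i * PL (uvar i)) = 1" using adm by (simp add: PL_recip)
    moreover have "root_slope (\<kappa> i) (\<kappa> i) = PL (chern_root (\<kappa> i))"
      by (simp add: root_slope_def addL_invL addL_slope_0)
    ultimately show ?thesis using adm that by (simp add: mps_subst_PL e_u)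
  qed
  define P where "P i = PL_recip i * uvar i ^ numer_exponent n lam i * (\<Prod>k\<in>chern_roots n. gen_slope i k)" for i
  define C :: "nat \<Rightarrow> nat \<Rightarrow> uyseries"
    where "C i j = (uvar j +\<^sub>L invL (uvar i)) * (uvar j +\<^sub>L uvar i)" for i j
  have single: "root_cofactor n (\<kappa> i) * mps_subst e (P i) =
      root_numer n (\<kappa> i) * chern_root (\<kappa> i) ^ numer_exponent n lam i" if i: "i \<in> {1..?q}" for i
  proof -
    have \<kappa>: "\<kappa> i \<in> chern_roots n" using assms i by auto
    let ?V = "\<Prod>l\<in>chern_roots n - {\<kappa> i}. root_slope (\<kappa> i) l"
    \<comment> \<open>The slope at the root itself is split off for \<open>PL_recip\<close>; the
      others complete \<open>root_cofactor\<close> to \<open>root_numer\<close>.\<close>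
    have "mps_subst e (\<Prod>k\<in>chern_roots n. gen_slope i k) = root_slope (\<kappa> i) (\<kappa> i) * ?V"
      using adm \<kappa> by (simp add: slope[OF i] prod.remove)
    then have "mps_subst e (P i) =
        (mps_subst e (PL_recip i) * root_slope (\<kappa> i) (\<kappa> i)) * (?V * chern_root (\<kappa> i) ^ numer_exponent n lam i)"
      by (simp only: P_def mps_subst_mult[OF adm] mps_subst_power[OF adm] mps_subst_var[OF adm] e_u[OF i] mult_ac)
    then show ?thesis unfolding PL[OF i] root_numer_def by (simp only: mult_ac mult_1)
  qed
  have cross: "mps_subst e (C i j) = pair_factor (\<kappa> j) (fst (\<kappa> i))"
    if "i \<in> {1..?q}" "j \<in> {i+1..?q}" for i j
  proof -
    have "j \<in> {1..?q}" using that by auto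
    then show ?thesis
      using that adm unfolding C_def pair_factor_chern_root[symmetric]
      by (simp add: mps_subst_addL mps_subst_invL e_u mult.commute)
  qed
  have "(\<Prod>i=1..?q. root_cofactor n (\<kappa> i)) * mps_subst e (gen_poly n lam) =
      (\<Prod>i=1..?q. root_cofactor n (\<kappa> i) * mps_subst e (P i)) * (\<Prod>i=1..?q. \<Prod>j=i+1..?q. mps_subst e (C i j))"
    unfolding gen_poly_def P_def[symmetric] C_def[symmetric]
    by (simp only: mps_subst_mult[OF adm] mps_subst_prod[OF adm] prod.distrib mult.assoc)
  also have "\<dots> = residue_term n lam \<kappa>"
    unfolding residue_term_def by (intro arg_cong2[where f = "(*)"] prod.cong refl single cross)
  finally show ?thesis unfolding e_def .
qed

lemma residue_term_not_inj:
  assumes "\<not> inj_on (fst \<circ> \<kappa>) {1..length lam}"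
  shows "residue_term n lam \<kappa> = 0"
proof -
  let ?q = "length lam"
  from assms obtain i j where ij: "i < j" "i \<in> {1..?q}" "j \<in> {1..?q}" "fst (\<kappa> i) = fst (\<kappa> j)"
    unfolding inj_on_def comp_def by (metis linorder_neqE_nat)
  have "(\<Prod>j=i+1..?q. pair_factor (\<kappa> j) (fst (\<kappa> i))) = 0"
    using ij pair_factor_self[of "\<kappa> j"] by (intro prod_zero) auto
  with ij(2) have "\<exists>i\<in>{1..?q}. (\<Prod>j=i+1..?q. pair_factor (\<kappa> j) (fst (\<kappa> i))) = 0" by blast
  then have "(\<Prod>i=1..?q. \<Prod>j=i+1..?q. pair_factor (\<kappa> j) (fst (\<kappa> i))) = 0"
    by (intro prod_zero) simp_all
  then show ?thesis by (simp add: residue_term_def)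
qed

lemma root_disc_u_coeff_gen_series:
  assumes "is_partition lam" "length lam \<le> n"
  shows "root_disc n ^ length lam * u_coeff (neg_exponent lam) (gen_series n (length lam)) =
    (\<Sum>\<kappa>\<in>{1..length lam} \<rightarrow>\<^sub>E chern_roots n. residue_term n lam \<kappa>)"
proof -
  have "n > 0 \<or> {1..length lam} = {}" using assms(2) by auto
  then have "root_disc n ^ card {1..length lam} * u_coeff (neg_exponent lam) (gen_series n (length lam)) =
      (\<Sum>\<kappa>\<in>{1..length lam} \<rightarrow>\<^sub>E chern_roots n. (\<Prod>i=1..length lam. root_cofactor n (\<kappa> i)) *
        mps_subst (u_eval {1..length lam} (chern_root \<circ> \<kappa>)) (gen_poly n lam))"
    unfolding u_coeff_gen_series[OF assms] by (intro u_coeff_residues) auto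
  also have "\<dots> = (\<Sum>\<kappa>\<in>{1..length lam} \<rightarrow>\<^sub>E chern_roots n. residue_term n lam \<kappa>)"
    by (rule sum.cong[OF refl]) (rule eval_gen_poly)
  finally show ?thesis by simp
qed

section \<open>The summand of a signed permutation\<close>

definition weyl_root :: "nat set \<times> (nat \<Rightarrow> nat) \<Rightarrow> nat \<Rightarrow> nat \<times> bool" where
  "weyl_root w i = (snd w i, snd w i \<in> fst w)"

lemma weyl_act_alt: "weyl_act w = mps_subst (\<lambda>i. chern_root (weyl_root w i))"
  by (simp add: weyl_act_def weyl_root_def chern_root_def case_prod_unfold)

text \<open>The image of y_i is divisible by the variable with index \<open>snd w i\<close>. A
  monomial contains finitely many variables, and injectivity of the permutation leaves finitely many
  i.\<close>

lemma mps_admissible_weyl: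
  assumes "inj (snd w)"
  shows "mps_admissible (\<lambda>i. chern_root (weyl_root w i))"
  unfolding mps_admissible_def mps_summable_def
proof (intro conjI allI)
  fix e :: "nat \<Rightarrow>\<^sub>0 nat"
  have "{i. mps_coeff (chern_root (weyl_root w i)) e \<noteq> 0} \<subseteq> snd w -` keys e"
  proof (rule subsetI)
    fix i assume "i \<in> {i. mps_coeff (chern_root (weyl_root w i)) e \<noteq> 0}"
    then have i: "mps_coeff (chern_root (weyl_root w i)) e \<noteq> 0" by simp
    have "Y (snd w i) dvd chern_root (weyl_root w i)"
      by (simp add: chern_root_def weyl_root_def sgnY_def dvd_invL)
    then obtain h where "chern_root (weyl_root w i) = Y (snd w i) * h" by (rule dvdE)
    with i obtain b where "Poly_Mapping.single (snd w i) 1 + b = e"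
      by (auto simp: mps_var_eq_monom mps_coeff_monom_mult split: if_splits)
    then show "i \<in> snd w -` keys e" by (auto simp: in_keys_iff lookup_add)
  qed
  then show "finite {i. mps_coeff (chern_root (weyl_root w i)) e \<noteq> 0}"
    by (rule finite_subset) (simp add: assms finite_vimageI)
qed simp

text \<open>The q denominators \<open>root_denom\<close> contain, for each i, the pairs with all j
  \<noteq> i. The definition has those with j > i; those with j < i are exactly the cross factors in
  \<open>residue_term\<close>. Only the first q values of the signed permutation enter the residue,
  so \<kappa> may be its restriction.\<close>

lemma schur_summand:
  assumes perm: "snd w permutes {1..n}" and n: "length lam \<le> n"
    and \<kappa>: "\<And>i. i \<in> {1..length lam} \<Longrightarrow> \<kappa> i = weyl_root w i"
  shows "yfrac_embed (root_disc n ^ length lam) *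
      yfrac_of (weyl_act w (schur_numer n lam)) (weyl_act w (schur_denom n (length lam))) =
    yfrac_embed (residue_term n lam \<kappa>)"
proof (rule yfrac_embed_of)
  let ?q = "length lam" and ?\<sigma> = "snd w" and ?p = "\<lambda>i j. pair_factor (weyl_root w i) (snd w j)"
  let ?N = "\<Prod>i=1..?q. chern_root (weyl_root w i) ^ numer_exponent n lam i"
  have inj: "inj ?\<sigma>" using perm by (rule permutes_inj)
  note adm = mps_admissible_weyl[OF inj]
  have numer: "weyl_act w (schur_numer n lam) = ?N"
    using adm by (simp add: weyl_act_alt schur_numer_def numer_exponent_def)
  have fst_root [simp]: "fst (weyl_root w i) = ?\<sigma> i" for i by (simp add: weyl_root_def)
  have denom: "weyl_act w (schur_denom n ?q) =
      (\<Prod>i=1..?q. twoL (chern_root (weyl_root w i))) * (\<Prod>i=1..?q. \<Prod>j=i+1..n. ?p i j)"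
    using adm pair_factor_chern_root[of "weyl_root w _" "weyl_root w _"]
    by (simp add: weyl_act_alt schur_denom_def twoL_def mps_subst_addL mps_subst_invL)
  show "weyl_act w (schur_denom n ?q) \<in> schur_denoms"
    unfolding denom using inj
    by (intro schur_denoms_mult schur_denoms_prod schur_denoms_two pair_factor_schur_denoms)
      (auto simp: inj_eq)
  have in_roots: "weyl_root w i \<in> chern_roots n" if "i \<in> {1..?q}" for i
    using that n permutes_in_image[OF perm, of i] by (auto simp: weyl_root_def chern_roots_def)
  have "root_denom n (weyl_root w i) = twoL (chern_root (weyl_root w i)) * (\<Prod>j=i+1..n. ?p i j) * (\<Prod>j=1..<i. ?p i j)"
    if i: "i \<in> {1..?q}" for i
  proof -
    have "(\<Prod>m\<in>{1..n} - {?\<sigma> i}. pair_factor (weyl_root w i) m) = (\<Prod>j\<in>{1..n} - {i}. ?p i j)"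
    proof (rule prod.reindex_cong)
      show "inj_on ?\<sigma> ({1..n} - {i})" using inj by (rule inj_on_subset) simp
      show "{1..n} - {?\<sigma> i} = ?\<sigma> ` ({1..n} - {i})"
        using permutes_image[OF perm] inj by (simp add: image_set_diff)
    qed simp
    also have "{1..n} - {i} = {i+1..n} \<union> {1..<i}" using i n by auto
    also have "(\<Prod>j\<in>{i+1..n} \<union> {1..<i}. ?p i j) = (\<Prod>j=i+1..n. ?p i j) * (\<Prod>j=1..<i. ?p i j)"
      by (rule prod.union_disjoint) auto
    finally show ?thesis using root_denom_eq[OF in_roots[OF i]] by (simp add: mult.assoc)
  qed
  then have "(\<Prod>i=1..?q. root_denom n (weyl_root w i)) =
      weyl_act w (schur_denom n ?q) * (\<Prod>i=1..?q. \<Prod>j=1..<i. ?p i j)"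
    unfolding denom by (simp add: prod.distrib)
  \<comment> \<open>Exchanging the roles of i and j brings the lower triangle into the order used by
    \<open>residue_term\<close>.\<close>
  also have "(\<Prod>i=1..?q. \<Prod>j=1..<i. ?p i j) = (\<Prod>i=1..?q. \<Prod>j=i+1..?q. ?p j i)"
    by (rule prod_triangle_swap[symmetric])
  finally have den: "(\<Prod>i=1..?q. root_denom n (weyl_root w i)) =
      weyl_act w (schur_denom n ?q) * (\<Prod>i=1..?q. \<Prod>j=i+1..?q. ?p j i)" .
  have "root_disc n ^ ?q = (\<Prod>i=1..?q. root_disc n)" by simp
  also have "\<dots> = (\<Prod>i=1..?q. root_numer n (weyl_root w i) * root_denom n (weyl_root w i))"
    using root_disc_eq[OF in_roots] by (rule prod.cong[OF refl])
  finally have disc: "root_disc n ^ ?q =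
      (\<Prod>i=1..?q. root_numer n (weyl_root w i)) * (\<Prod>i=1..?q. root_denom n (weyl_root w i))"
    by (simp only: prod.distrib)
  have "residue_term n lam \<kappa> = residue_term n lam (weyl_root w)"
    unfolding residue_term_def using \<kappa> by (intro arg_cong2[where f = "(*)"] prod.cong refl) auto
  also have "\<dots> = (\<Prod>i=1..?q. root_numer n (weyl_root w i)) * ?N * (\<Prod>i=1..?q. \<Prod>j=i+1..?q. ?p j i)"
    by (simp add: residue_term_def prod.distrib)
  finally show "root_disc n ^ ?q * weyl_act w (schur_numer n lam) =
      residue_term n lam \<kappa> * weyl_act w (schur_denom n ?q)"
    unfolding numer disc den by (simp only: mult_ac)
qed

section \<open>Cosets as tuples of roots in distinct variables\<close>

definition coset_key :: "nat \<Rightarrow> nat set \<times> (nat \<Rightarrow> nat) \<Rightarrow> nat \<Rightarrow> nat \<times> bool" where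
  "coset_key q w = restrict (weyl_root w) {1..q}"

lemma signed_perms_carrier: "w \<in> carrier (signed_perms I) \<longleftrightarrow> fst w \<subseteq> I \<and> snd w permutes I"
  by (cases w) (auto simp: signed_perms_def)

lemma signed_perms_mult:
  "v \<otimes>\<^bsub>signed_perms I\<^esub> w =
     ((fst v - snd v ` fst w) \<union> (snd v ` fst w - fst v), snd v \<circ> snd w)"
  by (simp add: signed_perms_def case_prod_unfold)

lemma coset_key_eq_iff:
  "coset_key q v = coset_key q w \<longleftrightarrow>
    (\<forall>i\<in>{1..q}. snd v i = snd w i \<and> (snd v i \<in> fst v \<longleftrightarrow> snd w i \<in> fst w))"
  by (auto simp: coset_key_def weyl_root_def restrict_def fun_eq_iff)

text \<open>Right factors from C_(n-q) fix y_1, ..., y_q, so the images of these variables are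
  constant on a coset; conversely they determine it.\<close>

lemma l_coset_signed_perms:
  assumes v: "v \<in> carrier (signed_perms {1..n})" and "q \<le> n"
  shows "v <#\<^bsub>signed_perms {1..n}\<^esub> carrier (signed_perms {q+1..n}) =
    {w \<in> carrier (signed_perms {1..n}). coset_key q w = coset_key q v}"
proof (intro equalityI subsetI)
  let ?I = "{1..n}" and ?J = "{q+1..n}"
  have pv: "snd v permutes ?I" and Ev: "fst v \<subseteq> ?I" using v by (auto simp: signed_perms_carrier)
  have inj: "inj (snd v)" using pv by (rule permutes_inj)
  fix w
  {
    assume "w \<in> v <#\<^bsub>signed_perms ?I\<^esub> carrier (signed_perms ?J)"
    then obtain h where h: "fst h \<subseteq> ?J" "snd h permutes ?J" and w: "w = v \<otimes>\<^bsub>signed_perms ?I\<^esub> h"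
      by (auto simp: l_coset_def signed_perms_carrier)
    have "snd h permutes ?I" using h(2) by (rule permutes_subset) auto
    then have "snd w permutes ?I" unfolding w signed_perms_mult using pv by (simp add: permutes_compose)
    moreover have "fst w \<subseteq> ?I"
      using Ev h(1) permutes_in_image[OF pv] by (auto simp: w signed_perms_mult)
    moreover have "snd h i = i" "snd v i \<notin> snd v ` fst h" if "i \<in> {1..q}" for i
      using that h permutes_not_in[OF h(2), of i] inj by (auto simp: inj_eq)
    then have "coset_key q w = coset_key q v"
      by (auto simp: coset_key_eq_iff w signed_perms_mult)
    ultimately show "w \<in> {w \<in> carrier (signed_perms ?I). coset_key q w = coset_key q v}"
      by (simp add: signed_perms_carrier)
  next
    assume "w \<in> {w \<in> carrier (signed_perms ?I). coset_key q w = coset_key q v}"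
    then have pw: "snd w permutes ?I" and Ew: "fst w \<subseteq> ?I" and key: "coset_key q w = coset_key q v"
      by (auto simp: signed_perms_carrier)
    \<comment> \<open>The element of C_(n-q) leading from \<open>v\<close> to \<open>w\<close>: its
      permutation is the quotient of the two permutations, its signs are the discrepancies of the
      two sign sets, pulled back along \<open>v\<close>.\<close>
    define \<tau> where "\<tau> = inv_into UNIV (snd v) \<circ> snd w"
    define A where "A = {j \<in> ?J. (snd v j \<in> fst v) \<noteq> (snd v j \<in> fst w)}"
    have "\<tau> permutes ?I" unfolding \<tau>_def by (rule permutes_compose[OF pw permutes_inv[OF pv]])
    moreover have "\<tau> x = x" if "x \<in> ?I - ?J" for x
    proof -
      have "x \<in> {1..q}" using that by auto
      with key have "snd w x = snd v x" by (simp add: coset_key_eq_iff)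
      then show ?thesis using inj by (simp add: \<tau>_def)
    qed
    ultimately have \<tau>: "\<tau> permutes ?J" by (rule permutes_superset)
    have comp: "snd v \<circ> \<tau> = snd w"
      using permutes_surj[OF pv] by (simp add: \<tau>_def fun_eq_iff surj_f_inv_f)
    \<comment> \<open>Agreement of the keys puts all sign discrepancies outside the images of 1,
      ..., q. The symmetric difference with \<open>fst v\<close> then restores
      \<open>fst w\<close>.\<close>
    have "snd v ` A = (fst v - fst w) \<union> (fst w - fst v)"
    proof (intro equalityI subsetI)
      fix m assume "m \<in> (fst v - fst w) \<union> (fst w - fst v)"
      then have m: "m \<in> ?I" "(m \<in> fst v) \<noteq> (m \<in> fst w)" using Ev Ew by auto
      then obtain j where j: "j \<in> ?I" "m = snd v j" using permutes_image[OF pv] by blast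
      have "j \<notin> {1..q}"
      proof
        assume "j \<in> {1..q}"
        with key have "snd w j = snd v j" "snd w j \<in> fst w \<longleftrightarrow> snd v j \<in> fst v"
          unfolding coset_key_eq_iff by blast+
        then show False using m(2) by (simp add: j(2))
      qed
      then show "m \<in> snd v ` A" using j m(2) by (auto simp: A_def)
    qed (auto simp: A_def)
    then have signs: "(fst v - snd v ` A) \<union> (snd v ` A - fst v) = fst w" by auto
    have "v \<otimes>\<^bsub>signed_perms ?I\<^esub> (A, \<tau>) = w"
      unfolding signed_perms_mult fst_conv snd_conv comp signs by simp
    moreover have "(A, \<tau>) \<in> carrier (signed_perms ?J)"
      using \<tau> by (auto simp: signed_perms_carrier A_def)
    ultimately have "w = v \<otimes>\<^bsub>signed_perms ?I\<^esub> (A, \<tau>)" "(A, \<tau>) \<in> carrier (signed_perms ?J)"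
      by simp_all
    then show "w \<in> v <#\<^bsub>signed_perms ?I\<^esub> carrier (signed_perms ?J)"
      unfolding l_coset_def by blast
  }
qed

lemma coset_key_image:
  assumes "q \<le> n"
  shows "coset_key q ` carrier (signed_perms {1..n}) =
    {\<kappa> \<in> {1..q} \<rightarrow>\<^sub>E chern_roots n. inj_on (fst \<circ> \<kappa>) {1..q}}"
proof (intro equalityI subsetI)
  fix \<kappa> assume "\<kappa> \<in> coset_key q ` carrier (signed_perms {1..n})"
  then obtain w where w: "snd w permutes {1..n}" "\<kappa> = coset_key q w"
    by (auto simp: signed_perms_carrier)
  have "snd w i \<in> {1..n}" if "i \<in> {1..q}" for i
    using that assms by (subst permutes_in_image[OF w(1)]) auto
  then have "\<kappa> \<in> {1..q} \<rightarrow>\<^sub>E chern_roots n"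
    unfolding w(2) coset_key_def by (auto simp: weyl_root_def chern_roots_def)
  moreover have "inj_on (fst \<circ> \<kappa>) {1..q}"
    using permutes_inj[OF w(1)] by (auto simp: w(2) coset_key_def weyl_root_def inj_on_def)
  ultimately show "\<kappa> \<in> {\<kappa> \<in> {1..q} \<rightarrow>\<^sub>E chern_roots n. inj_on (fst \<circ> \<kappa>) {1..q}}" by simp
next
  fix \<kappa> assume "\<kappa> \<in> {\<kappa> \<in> {1..q} \<rightarrow>\<^sub>E chern_roots n. inj_on (fst \<circ> \<kappa>) {1..q}}"
  then have \<kappa>: "\<kappa> \<in> {1..q} \<rightarrow>\<^sub>E chern_roots n" and inj: "inj_on (fst \<circ> \<kappa>) {1..q}" by auto
  let ?p = "fst \<circ> \<kappa>"
  have img: "?p ` {1..q} \<subseteq> {1..n}" using \<kappa> by (auto simp: chern_roots_def PiE_iff mem_Times_iff)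
  have "card ({1..n} - {1..q}) = card ({1..n} - ?p ` {1..q})"
    using img assms card_image[OF inj] by (simp add: card_Diff_subset)
  \<comment> \<open>The injection of the first q indices extends to a permutation because the
    complements have the same size.\<close>
  then obtain g where g: "bij_betw g ({1..n} - {1..q}) ({1..n} - ?p ` {1..q})"
    using finite_same_card_bij[of "{1..n} - {1..q}" "{1..n} - ?p ` {1..q}"] by auto
  define \<sigma> where "\<sigma> x = (if x \<in> {1..q} then ?p x else if x \<in> {1..n} then g x else x)" for x
  have "bij_betw \<sigma> {1..q} (?p ` {1..q})"
    using inj by (subst bij_betw_cong[of _ \<sigma> ?p]) (auto simp: \<sigma>_def bij_betw_def)
  moreover have "bij_betw \<sigma> ({1..n} - {1..q}) ({1..n} - ?p ` {1..q})"
    using g by (subst bij_betw_cong[of _ \<sigma> g]) (auto simp: \<sigma>_def)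
  ultimately have "bij_betw \<sigma> ({1..q} \<union> ({1..n} - {1..q})) (?p ` {1..q} \<union> ({1..n} - ?p ` {1..q}))"
    by (rule bij_betw_combine) auto
  moreover have "{1..q} \<union> ({1..n} - {1..q}) = {1..n}" using assms by auto
  moreover have "?p ` {1..q} \<union> ({1..n} - ?p ` {1..q}) = {1..n}" using img by auto
  ultimately have "bij_betw \<sigma> {1..n} {1..n}" by simp
  then have perm: "\<sigma> permutes {1..n}" by (rule bij_imp_permutes) (use assms in \<open>auto simp: \<sigma>_def\<close>)
  \<comment> \<open>The signs prescribed by the tuple; injectivity of \<open>?p\<close> makes the
    prescriptions consistent.\<close>
  define E where "E = {m. \<exists>i\<in>{1..q}. m = ?p i \<and> snd (\<kappa> i)}"
  have "E \<subseteq> {1..n}" using img by (auto simp: E_def)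
  moreover have "\<kappa> = coset_key q (E, \<sigma>)"
  proof
    fix i show "\<kappa> i = coset_key q (E, \<sigma>) i"
    proof (cases "i \<in> {1..q}")
      case True
      have "?p i \<in> E \<longleftrightarrow> snd (\<kappa> i)"
      proof
        assume "?p i \<in> E"
        then obtain i' where "i' \<in> {1..q}" "?p i = ?p i'" "snd (\<kappa> i')" by (auto simp: E_def)
        with inj_onD[OF inj _ True] show "snd (\<kappa> i)" by metis
      qed (use True in \<open>auto simp: E_def\<close>)
      with True show ?thesis by (auto simp: coset_key_def weyl_root_def \<sigma>_def prod_eq_iff)
    next
      case False
      then show ?thesis using \<kappa> by (auto simp: coset_key_def PiE_def extensional_def)
    qed
  qed
  ultimately show "\<kappa> \<in> coset_key q ` carrier (signed_perms {1..n})"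
    using perm by (auto simp: signed_perms_carrier)
qed

lemma coset_representative:
  assumes "c \<in> lcosets\<^bsub>signed_perms {1..n}\<^esub> (carrier (signed_perms {q+1..n}))" "q \<le> n"
  shows "(SOME w. w \<in> c) \<in> carrier (signed_perms {1..n})"
    and "c = {w \<in> carrier (signed_perms {1..n}). coset_key q w = coset_key q (SOME w. w \<in> c)}"
proof -
  obtain v where v: "v \<in> carrier (signed_perms {1..n})"
    and "c = v <#\<^bsub>signed_perms {1..n}\<^esub> carrier (signed_perms {q+1..n})"
    using assms(1) by (auto simp: LCOSETS_def)
  then have c: "c = {w \<in> carrier (signed_perms {1..n}). coset_key q w = coset_key q v}"
    using l_coset_signed_perms[OF v assms(2)] by simp
  \<comment> \<open>The coset contains \<open>v\<close>, so the choice is a genuine element and has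
    the key of the coset.\<close>
  then have "(SOME w. w \<in> c) \<in> c" using v by (intro someI[of "\<lambda>w. w \<in> c" v]) simp
  then show "(SOME w. w \<in> c) \<in> carrier (signed_perms {1..n})"
    "c = {w \<in> carrier (signed_perms {1..n}). coset_key q w = coset_key q (SOME w. w \<in> c)}"
    using c by auto
qed

lemma bij_betw_cosets:
  assumes "q \<le> n"
  shows "bij_betw (\<lambda>c. coset_key q (SOME w. w \<in> c))
    (lcosets\<^bsub>signed_perms {1..n}\<^esub> (carrier (signed_perms {q+1..n})))
    {\<kappa> \<in> {1..q} \<rightarrow>\<^sub>E chern_roots n. inj_on (fst \<circ> \<kappa>) {1..q}}"
  unfolding bij_betw_def
proof (intro conjI)
  let ?G = "signed_perms {1..n}" and ?L = "lcosets\<^bsub>signed_perms {1..n}\<^esub> (carrier (signed_perms {q+1..n}))"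
  show "inj_on (\<lambda>c. coset_key q (SOME w. w \<in> c)) ?L"
  proof (rule inj_onI)
    fix c c' assume "c \<in> ?L" "c' \<in> ?L"
    from this[THEN coset_representative(2), OF assms]
    show "coset_key q (SOME w. w \<in> c) = coset_key q (SOME w. w \<in> c') \<Longrightarrow> c = c'" by simp
  qed
  show "(\<lambda>c. coset_key q (SOME w. w \<in> c)) ` ?L = {\<kappa> \<in> {1..q} \<rightarrow>\<^sub>E chern_roots n. inj_on (fst \<circ> \<kappa>) {1..q}}"
    unfolding coset_key_image[OF assms, symmetric]
  proof (intro equalityI subsetI)
    fix \<kappa> assume "\<kappa> \<in> (\<lambda>c. coset_key q (SOME w. w \<in> c)) ` ?L"
    then show "\<kappa> \<in> coset_key q ` carrier ?G" using coset_representative(1)[OF _ assms] by blast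
  next
    fix \<kappa> assume "\<kappa> \<in> coset_key q ` carrier ?G"
    then obtain v where v: "v \<in> carrier ?G" "\<kappa> = coset_key q v" by blast
    let ?c = "v <#\<^bsub>?G\<^esub> carrier (signed_perms {q+1..n})"
    have c: "?c \<in> ?L" using v(1) by (auto simp: LCOSETS_def)
    have "v \<in> ?c" unfolding l_coset_signed_perms[OF v(1) assms] using v(1) by simp
    then have "coset_key q v = coset_key q (SOME w. w \<in> ?c)"
      using coset_representative(2)[OF c assms] by blast
    then show "\<kappa> \<in> (\<lambda>c. coset_key q (SOME w. w \<in> c)) ` ?L" using c v(2) by blast
  qed
qed

theorem theorem4p6:
  fixes n q :: nat and lam :: "nat list"
  assumes "is_partition lam" and "length lam = q" and "q \<le> n"
  shows "quadratic_schur n lam = yfrac_embed (u_coeff (neg_exponent lam) (gen_series n q))"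
proof -
  let ?L = "lcosets\<^bsub>signed_perms {1..n}\<^esub> (carrier (signed_perms {q+1..n}))"
  let ?P = "{1..q} \<rightarrow>\<^sub>E chern_roots n"
  \<comment> \<open>One discriminant for each of the q variables clears every summand at
    once.\<close>
  let ?D = "root_disc n ^ q"
  have "yfrac_embed ?D * quadratic_schur n lam =
      (\<Sum>c\<in>?L. let w = (SOME w. w \<in> c) in
        yfrac_embed ?D * yfrac_of (weyl_act w (schur_numer n lam)) (weyl_act w (schur_denom n q)))"
    using assms(2) by (simp add: quadratic_schur_def sum_distrib_left Let_def)
  also have "\<dots> = (\<Sum>c\<in>?L. yfrac_embed (residue_term n lam (coset_key q (SOME w. w \<in> c))))"
  proof (rule sum.cong[OF refl])
    fix c assume "c \<in> ?L"
    then have "snd (SOME w. w \<in> c) permutes {1..n}"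
      using coset_representative(1)[OF _ assms(3)] by (simp add: signed_perms_carrier)
    from schur_summand[OF this, of lam "coset_key q (SOME w. w \<in> c)"] show "(let w = (SOME w. w \<in> c) in
        yfrac_embed ?D * yfrac_of (weyl_act w (schur_numer n lam)) (weyl_act w (schur_denom n q))) =
      yfrac_embed (residue_term n lam (coset_key q (SOME w. w \<in> c)))"
      using assms(2,3) by (simp add: coset_key_def Let_def)
  qed
  also have "\<dots> = (\<Sum>\<kappa>\<in>{\<kappa> \<in> ?P. inj_on (fst \<circ> \<kappa>) {1..q}}. yfrac_embed (residue_term n lam \<kappa>))"
    by (rule sum.reindex_bij_betw[OF bij_betw_cosets[OF assms(3)]])
  \<comment> \<open>The added tuples repeat a variable, hence contain a vanishing cross
    factor.\<close>
  also have "\<dots> = (\<Sum>\<kappa>\<in>?P. yfrac_embed (residue_term n lam \<kappa>))"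
    using residue_term_not_inj[of _ lam n] assms(2)
    by (intro sum.mono_neutral_left) (auto intro!: finite_PiE)
  also have "\<dots> = yfrac_embed ?D * yfrac_embed (u_coeff (neg_exponent lam) (gen_series n q))"
    using root_disc_u_coeff_gen_series[OF assms(1), of n] assms(2,3)
    by (simp flip: yfrac_embed_sum yfrac_embed_mult)
  finally have "yfrac_embed ?D * quadratic_schur n lam =
      yfrac_embed ?D * yfrac_embed (u_coeff (neg_exponent lam) (gen_series n q))" .
  moreover obtain v where "?D * v \<in> schur_denoms" using root_disc_power_schur_denom by blast
  ultimately show ?thesis by (rule yfrac_embed_cancel[rotated])
qed

end
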